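(* Let $q$ be an odd prime power and let $l$ be a line of an elliptic quadric $Q^-(5,q)$ of $\mathrm{PG}(5,q)$. Then $\mathfrak{X}_l=(\mathcal{X}',\{R'_0,\dots,R'_5\})$ is a symmetric, imprimitive association scheme, and it is isomorphic to the association scheme $\mathfrak{X}_P$ for any point $P$ of $H(3,q^2)$.
   Context: Let $\perp$ be the polarity of $Q^-(5,q)$; dimensions are vector-space dimensions over $\mathrm{GF}(q)$. Three pairwise disjoint lines $l_1,l_2,l_3$ of $Q^-(5,q)$ spanning the whole space are in perspective if, with $T_i=l_i^\perp$, $s_k=T_i\cap T_j$, $\Sigma_k=\langle s_k,l_k\rangle$ ($\{i,j,k\}=\{1,2,3\}$), $\Sigma_1\cap\Sigma_2\cap\Sigma_3$ is 2-dimensional. $\mathcal{X}'$ is the set of lines of $Q^-(5,q)$ disjoint from $l$; relations: $R'_0$ diagonal; $R'_1$: $m,n$ meet in a point; $R'_2$: $\dim\langle l,m,n\rangle=4$; $R'_3$: $m,n$ disjoint and $\dim\langle l,m,n\rangle=5$; $R'_4$: $l,m,n$ span the whole space and are not in perspective; $R'_5$: $l,m,n$ span the whole space and are in perspective. $H(3,q^2)$ is the Hermitian surface of $\mathrm{PG}(3,q^2)$ given by $h(\mathbf{x},\mathbf{y})=x_0y_3^q-x_1y_1^q-x_2y_2^q+x_3y_0^q$; collinear points are those with $h(\mathbf p,\mathbf q)=0$. For distinct points, $z(P,Q,R)=h(\mathbf p,\mathbf q)h(\mathbf q,\mathbf r)h(\mathbf r,\mathbf p)\mathrm{GF}(q)^*\in\{0\}\cup\mathrm{GF}(q^2)^*/\mathrm{GF}(q)^*$;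 $e=\mathrm{GF}(q)^*$, $t=\theta\mathrm{GF}(q)^*$ with $\theta^q=-\theta$, $\Gamma$ the remaining cosets. $\mathfrak{X}_P$ has vertex set the points of $H(3,q^2)$ not collinear with $P$, with $R_0$ diagonal and, for distinct $Q,R$: $R_1$: $z(P,Q,R)=0$; $R_2$: $P,Q,R$ lie on a common line; $R_3$: $z=t$; $R_4$: $z\in\Gamma$; $R_5$: $z=e$.
   Formalization: R_3 is taken as "z = t and P, Q, R not on a common line" (points on a common line also have z = t, so literally R_2 lies in R_3), and R'_2 requires m, n distinct (dim<l,m,m> = 4); literally the relations would not partition. *)

theory Defs
  imports "HOL-Analysis.Analysis" "HOL-Number_Theory.Number_Theory"
begin

definition association_scheme :: "nat \<Rightarrow> 'a set \<Rightarrow> (nat \<Rightarrow> ('a \<times> 'a) set) \<Rightarrow> bool" where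
  "association_scheme d X R \<longleftrightarrow>
     finite X \<and> X \<noteq> {} \<and>
     (\<forall>i\<le>d. R i \<noteq> {}) \<and> disjoint_family_on R {..d} \<and> (\<Union>i\<le>d. R i) = X \<times> X \<and>
     R 0 = Id_on X \<and>
     (\<forall>i\<le>d. \<exists>j\<le>d. (R i)\<inverse> = R j) \<and>
     (\<forall>i\<le>d. \<forall>j\<le>d. \<forall>k\<le>d. \<exists>p. \<forall>(x, y) \<in> R k.
        card {w \<in> X. (x, w) \<in> R i \<and> (w, y) \<in> R j} = p)"

definition symmetric_scheme :: "nat \<Rightarrow> 'a set \<Rightarrow> (nat \<Rightarrow> ('a \<times> 'a) set) \<Rightarrow> bool" where
  "symmetric_scheme d X R \<longleftrightarrow> association_scheme d X R \<and> (\<forall>i\<le>d. sym (R i))"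

definition imprimitive_scheme :: "nat \<Rightarrow> 'a set \<Rightarrow> (nat \<Rightarrow> ('a \<times> 'a) set) \<Rightarrow> bool" where
  "imprimitive_scheme d X R \<longleftrightarrow> association_scheme d X R \<and>
     (\<exists>I\<subseteq>{..d}. equiv X (\<Union>i\<in>I. R i) \<and> (\<Union>i\<in>I. R i) \<noteq> R 0 \<and> (\<Union>i\<in>I. R i) \<noteq> X \<times> X)"

text \<open>The isomorphism respects the numbering of the relations, not only the partition of
  \<open>X \<times> X\<close> that they form.\<close>

definition scheme_isomorphic ::
  "nat \<Rightarrow> 'a set \<Rightarrow> (nat \<Rightarrow> ('a \<times> 'a) set) \<Rightarrow> 'b set \<Rightarrow> (nat \<Rightarrow> ('b \<times> 'b) set) \<Rightarrow> bool" where
  "scheme_isomorphic d X R Y S \<longleftrightarrow>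
     association_scheme d X R \<and> association_scheme d Y S \<and>
     (\<exists>\<phi>. bij_betw \<phi> X Y \<and>
        (\<forall>i\<le>d. \<forall>x\<in>X. \<forall>y\<in>X. (x, y) \<in> R i \<longleftrightarrow> (\<phi> x, \<phi> y) \<in> S i))"

text \<open>Points, lines, ... of a projective space are the vector subspaces of dimension 1, 2, ....\<close>

definition polar_form :: "('f::field ^ 'n \<Rightarrow> 'f) \<Rightarrow> 'f ^ 'n \<Rightarrow> 'f ^ 'n \<Rightarrow> 'f" where
  "polar_form Q u v = Q (u + v) - Q u - Q v"

definition quadratic_form :: "('f::field ^ 'n \<Rightarrow> 'f) \<Rightarrow> bool" where
  "quadratic_form Q \<longleftrightarrow> (\<forall>c v. Q (c *s v) = c\<^sup>2 * Q v) \<and>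
     (\<forall>u. Vector_Spaces.linear (*s) (*) (polar_form Q u))"

definition totally_singular :: "('f::field ^ 'n \<Rightarrow> 'f) \<Rightarrow> ('f ^ 'n) set \<Rightarrow> bool" where
  "totally_singular Q U \<longleftrightarrow> vec.subspace U \<and> (\<forall>u\<in>U. Q u = 0)"

definition polar_perp :: "('f::field ^ 'n \<Rightarrow> 'f) \<Rightarrow> ('f ^ 'n) set \<Rightarrow> ('f ^ 'n) set" where
  "polar_perp Q U = {v. \<forall>u\<in>U. polar_form Q u v = 0}"

text \<open>A nondegenerate quadric of \<open>PG(5,q)\<close> is elliptic when it contains lines but no planes.\<close>

definition elliptic_form :: "('f::field ^ 6 \<Rightarrow> 'f) \<Rightarrow> bool" where
  "elliptic_form Q \<longleftrightarrow> quadratic_form Q \<and> polar_perp Q UNIV = {0} \<and>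
     (\<exists>U. totally_singular Q U \<and> vec.dim U = 2) \<and>
     \<not> (\<exists>U. totally_singular Q U \<and> vec.dim U = 3)"

definition quadric_lines :: "('f::field ^ 6 \<Rightarrow> 'f) \<Rightarrow> ('f ^ 6) set set" where
  "quadric_lines Q = {m. totally_singular Q m \<and> vec.dim m = 2}"

text \<open>Only meaningful for lines that together span the whole space (and so are pairwise
  disjoint); \<open>line_rel\<close> imposes that condition wherever it uses this predicate.\<close>

definition in_perspective ::
  "('f::field ^ 6 \<Rightarrow> 'f) \<Rightarrow> ('f ^ 6) set \<Rightarrow> ('f ^ 6) set \<Rightarrow> ('f ^ 6) set \<Rightarrow> bool" where
  "in_perspective Q l\<^sub>1 l\<^sub>2 l\<^sub>3 \<longleftrightarrow>
     (let T\<^sub>1 = polar_perp Q l\<^sub>1; T\<^sub>2 = polar_perp Q l\<^sub>2; T\<^sub>3 = polar_perp Q l\<^sub>3;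
          s\<^sub>1 = T\<^sub>2 \<inter> T\<^sub>3; s\<^sub>2 = T\<^sub>1 \<inter> T\<^sub>3; s\<^sub>3 = T\<^sub>1 \<inter> T\<^sub>2;
          \<Sigma>\<^sub>1 = vec.span (s\<^sub>1 \<union> l\<^sub>1); \<Sigma>\<^sub>2 = vec.span (s\<^sub>2 \<union> l\<^sub>2); \<Sigma>\<^sub>3 = vec.span (s\<^sub>3 \<union> l\<^sub>3)
      in vec.dim (\<Sigma>\<^sub>1 \<inter> \<Sigma>\<^sub>2 \<inter> \<Sigma>\<^sub>3) = 2)"

definition disjoint_lines :: "('f::field ^ 6 \<Rightarrow> 'f) \<Rightarrow> ('f ^ 6) set \<Rightarrow> ('f ^ 6) set set" where
  "disjoint_lines Q l = {m \<in> quadric_lines Q. l \<inter> m = {0}}"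

text \<open>The condition \<open>m \<noteq> n\<close> is needed for \<open>i = 2\<close>, since \<open>dim \<langle>l, m, m\<rangle> = 4\<close>.\<close>

definition line_rel ::
  "('f::field ^ 6 \<Rightarrow> 'f) \<Rightarrow> ('f ^ 6) set \<Rightarrow> nat \<Rightarrow> (('f ^ 6) set \<times> ('f ^ 6) set) set" where
  "line_rel Q l i = {(m, n). m \<in> disjoint_lines Q l \<and> n \<in> disjoint_lines Q l \<and>
     (if i = 0 then m = n else m \<noteq> n \<and>
      (if i = 1 then vec.dim (m \<inter> n) = 1
       else if i = 2 then vec.dim (l \<union> m \<union> n) = 4
       else if i = 3 then m \<inter> n = {0} \<and> vec.dim (l \<union> m \<union> n) = 5
       else if i = 4 then vec.span (l \<union> m \<union> n) = UNIV \<and> \<not> in_perspective Q l m n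
       else if i = 5 then vec.span (l \<union> m \<union> n) = UNIV \<and> in_perspective Q l m n
       else False))}"

definition herm :: "nat \<Rightarrow> 'g::field ^ 4 \<Rightarrow> 'g ^ 4 \<Rightarrow> 'g" where
  "herm q x y = x$0 * (y$3) ^ q - x$1 * (y$1) ^ q - x$2 * (y$2) ^ q + x$3 * (y$0) ^ q"

definition hermitian_points :: "nat \<Rightarrow> ('g::field ^ 4) set set" where
  "hermitian_points q = {P. vec.subspace P \<and> vec.dim P = 1 \<and> (\<forall>p\<in>P. herm q p p = 0)}"

definition collinear_points :: "nat \<Rightarrow> ('g::field ^ 4) set \<Rightarrow> ('g ^ 4) set \<Rightarrow> bool" where
  "collinear_points q P Q \<longleftrightarrow> (\<forall>p\<in>P. \<forall>r\<in>Q. herm q p r = 0)"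

definition on_common_line ::
  "('g::field ^ 4) set \<Rightarrow> ('g ^ 4) set \<Rightarrow> ('g ^ 4) set \<Rightarrow> bool" where
  "on_common_line P Q R \<longleftrightarrow>
     (\<exists>L. vec.subspace L \<and> vec.dim L = 2 \<and> P \<subseteq> L \<and> Q \<subseteq> L \<and> R \<subseteq> L)"

text \<open>The subfield \<open>GF(q)\<close> of \<open>GF(q\<^sup>2)\<close> is the fixed field of \<open>x \<mapsto> x\<^sup>q\<close>.  Cosets of
  \<open>GF(q)\<^sup>*\<close> are sets of field elements, and the coset of 0 is \<open>{0}\<close>.\<close>

definition subfield_units :: "nat \<Rightarrow> 'g::field set" where
  "subfield_units q = {c. c ^ q = c \<and> c \<noteq> 0}"

definition unit_coset :: "nat \<Rightarrow> 'g::field \<Rightarrow> 'g set" where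
  "unit_coset q a = (\<lambda>c. a * c) ` subfield_units q"

text \<open>Rescaling the representatives \<open>p\<close>, \<open>r\<close>, \<open>s\<close> of the three points multiplies the triple
  product by norms, which lie in \<open>GF(q)\<^sup>*\<close>; the union below is therefore a single coset.\<close>

definition z_coset ::
  "nat \<Rightarrow> ('g::field ^ 4) set \<Rightarrow> ('g ^ 4) set \<Rightarrow> ('g ^ 4) set \<Rightarrow> 'g set" where
  "z_coset q P Q R = (\<Union>p\<in>P - {0}. \<Union>r\<in>Q - {0}. \<Union>s\<in>R - {0}.
     unit_coset q (herm q p r * herm q r s * herm q s p))"

definition other_cosets :: "nat \<Rightarrow> 'g::field \<Rightarrow> 'g set set" where
  "other_cosets q \<theta> = {unit_coset q a | a. a \<noteq> 0} - {unit_coset q 1, unit_coset q \<theta>}"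

definition noncollinear_points :: "nat \<Rightarrow> ('g::field ^ 4) set \<Rightarrow> ('g ^ 4) set set" where
  "noncollinear_points q P = {Q \<in> hermitian_points q. \<not> collinear_points q P Q}"

text \<open>Three points of the surface on a common nonisotropic line also have \<open>z = t\<close>, so they have
  to be excluded for \<open>i = 3\<close>.\<close>

definition point_rel ::
  "nat \<Rightarrow> 'g::field \<Rightarrow> ('g ^ 4) set \<Rightarrow> nat \<Rightarrow> (('g ^ 4) set \<times> ('g ^ 4) set) set" where
  "point_rel q \<theta> P i = {(Q, R). Q \<in> noncollinear_points q P \<and> R \<in> noncollinear_points q P \<and>
     (if i = 0 then Q = R else Q \<noteq> R \<and>
      (if i = 1 then z_coset q P Q R = {0}
       else if i = 2 then on_common_line P Q R
       else if i = 3 then z_coset q P Q R = unit_coset q \<theta> \<and> \<not> on_common_line P Q R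
       else if i = 4 then z_coset q P Q R \<in> other_cosets q \<theta>
       else if i = 5 then z_coset q P Q R = unit_coset q 1
       else False))}"

end

theory Submission
  imports Defs
begin

text \<open>
  Both schemes are identified with one explicit scheme on pairs \<open>(u, a)\<close>, where
  \<open>u = (x\<^sub>1, y\<^sub>1, x\<^sub>2, y\<^sub>2)\<close> represents a vector \<open>(z\<^sub>1, z\<^sub>2)\<close> over \<open>GF(q\<^sup>2)\<close> with
  \<open>z\<^sub>i = x\<^sub>i + y\<^sub>i \<surd>d\<close>, \<open>d\<close> is a nonsquare of \<open>GF(q)\<close>, and \<open>a\<close> is in \<open>GF(q)\<close>.  On these
  pairs acts a Heisenberg group of order \<open>q\<^sup>5\<close>; the relation between two pairs depends only on the
  rank over \<open>GF(q)\<close> of the difference \<open>u - v\<close>, seen as a \<open>2 \<times> 2\<close> matrix, and on whether the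
  invariant \<open>a - b + \<omega>(u, v)\<close> vanishes, for an alternating form \<open>\<omega>\<close>.

  The translations and the similitudes from \<open>GL(2, q)\<close> and \<open>GF(q\<^sup>2)\<^sup>*\<close> are transitive on every
  relation except the one with rank 2 and nonzero invariant \<open>s\<close>.  For that one the intersection
  numbers are counted, and what could depend on \<open>s\<close> is the number of points of the conic
  \<open>X\<^sup>2 - d Y\<^sup>2 = 1 - s\<^sup>2/d\<close>; the right-hand side is never 0, so this is the number of elements of
  norm 1.

  A line disjoint from \<open>l\<close> has a unique basis dual to a basis of \<open>l\<close>, and the coordinates of that
  basis give the pair \<open>(u, a)\<close>.  Two such lines and \<open>l\<close> are in perspective exactly if the matrix of
  the polar form between the two dual bases is symmetric.  A point not collinear with \<open>P = \<langle>p\<rangle>\<close>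
  has a unique representative \<open>r\<close> with \<open>h(r, p) = 1\<close>; for two of them \<open>h(r, r')\<close> has the components
  \<open>- d det(u - v)\<close> and minus the invariant with respect to the basis \<open>1, \<theta>\<close>, where \<open>\<theta>\<^sup>2 = d\<close>.
\<close>

text \<open>The two geometries are dual generalized quadrangles, which is why lines disjoint from
  \<open>l\<close> should match points not collinear with \<open>P\<close>. The duality itself is
  never constructed: coordinatizing both sets by the same \<open>q^5\<close> pairs lets the axioms
  be proved once and makes the isomorphism a composition of two bijections. The price is that both
  coordinatizations must agree in \<open>d\<close>. On the Hermitian side the numbering of the
  relations mentions \<theta>, which forces \<open>d = \<theta>\<^sup>2\<close>; on the quadric
  \<open>d\<close> describes the anisotropic part of the form only up to a square factor, so any
  nonsquare can be prescribed there. That \<open>d\<close> is a nonsquare enters mostly in one way: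
  the norm \<open>x\<^sup>2 - d y\<^sup>2\<close> vanishes only at 0. This decides when two lines
  meet, makes the rank 1 vectors a single orbit, and lets the points of the conic be counted through
  elements of equal norm.\<close>

section \<open>Finite fields\<close>

hide_const (open) up_ring.coeff up_ring.monom module.smult

text \<open>Multiplication by a nonzero \<open>x\<close> permutes the nonzero elements, so their
  product absorbs the factor \<open>x ^ (CARD('a) - 1)\<close>.\<close>

lemma finite_field_power_card:
  fixes x :: "'a::{field,finite}"
  shows "x ^ CARD('a) = x"
proof (cases "x = 0")
  case False
  have "x * (\<Prod>y\<in>UNIV-{0}. x * y) = x * x ^ (CARD('a) - 1) * \<Prod>(UNIV-{0})"
    by (simp add: prod.distrib mult_ac card_Diff_singleton)
  also have "x * x ^ (CARD('a) - 1) = x ^ CARD('a)"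
    by (metis power_eq_if zero_less_card_finite less_numeral_extra(3))
  also have "(\<Prod>y\<in>UNIV-{0}. x * y) = (\<Prod>y\<in>UNIV-{0}. y)"
    by (rule prod.reindex_bij_witness[of _ "\<lambda>y. y / x" "\<lambda>y. x * y"]) (use False in auto)
  finally show ?thesis
    by simp
qed simp

text \<open>The ring record moves the type into the setting with carriers, where the multiplicative
  group of a finite field is known to be cyclic.\<close>

lemma finite_field_generator:
  "\<exists>g::'a::{field,finite}. \<forall>x. x \<noteq> 0 \<longrightarrow> (\<exists>i::nat. x = g ^ i)"
proof -
  let ?R = "\<lparr>carrier = UNIV, monoid.mult = (*), one = 1, ring.zero = 0, add = (+)\<rparr> :: 'a ring"
  have "\<exists>y. x + y = 0" for x :: 'a
    using add.right_inverse by blast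
  moreover have "x \<noteq> 0 \<Longrightarrow> \<exists>y. x * y = 1" for x :: 'a
    by (rule exI[of _ "inverse x"]) auto
  ultimately interpret R: field ?R
    by unfold_locales (auto simp: algebra_simps Units_def)
  have pow: "a [^]\<^bsub>?R\<^esub> i = a ^ i" for a :: 'a and i :: nat
    by (induction i) (auto simp: mult.commute)
  from R.finite_field_mult_group_has_gen obtain a :: 'a
    where "carrier (mult_of ?R) = {a [^]\<^bsub>?R\<^esub> i | i::nat. i \<in> UNIV}" by auto
  then have "x \<in> {a ^ i | i. True}" if "x \<noteq> 0" for x
    using that by (auto simp: pow)
  then show ?thesis by blast
qed

section \<open>Characteristic and embeddings of finite fields\<close>

lemma CHAR_finite_field:
  assumes "prime p" "CARD('a::{field,finite}) = p ^ n"
  shows "CHAR('a) = p"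
proof -
  have "CHAR('a) > 0" by (simp add: finite_imp_CHAR_pos)
  then have "prime CHAR('a)" by (rule prime_CHAR_semidom)
  moreover have "CHAR('a) dvd p ^ n" using CHAR_dvd_CARD[where 'a='a] assms(2) by simp
  ultimately show ?thesis using assms(1) prime_dvd_power primes_dvd_imp_eq by blast
qed

lemma two_neq_zero_if_odd_card:
  assumes "odd CARD('a::{field,finite})"
  shows "(2::'a) \<noteq> 0"
proof
  assume "(2::'a) = 0"
  then have "of_nat 2 = (0::'a)" by simp
  then have "CHAR('a) dvd 2" using of_nat_eq_0_iff_char_dvd by blast
  moreover have "CHAR('a) dvd CARD('a)" by (rule CHAR_dvd_CARD)
  moreover have "CHAR('a) \<noteq> 1" by simp
  ultimately show False using assms prime_nat_iff two_is_prime_nat by (metis)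
qed

text \<open>The factor introduced by pseudo-division is a power of the leading coefficient, which is
  1 here.\<close>

lemma monic_int_poly_division:
  fixes m P :: "int poly"
  assumes "lead_coeff m = 1"
  obtains r s where "P = m * r + s" "s = 0 \<or> degree s < degree m"
proof -
  obtain r s where rs: "pseudo_divmod P m = (r, s)" by force
  have "m \<noteq> 0" using assms by auto
  from pseudo_divmod[OF this rs] assms that show ?thesis by simp
qed

text \<open>Let \<open>m\<close> be monic of least degree among the integer polynomials vanishing at a generator \<open>g\<close> of
  the smaller field.  Modulo the characteristic it divides \<open>X\<^bsup>Q\<^esup> - X\<close>, where \<open>Q\<close> is the order of the
  larger field, and so has a root there; \<open>g\<close> is sent to that root.\<close>

lemma finite_field_embedding:
  assumes "prime p" "CARD('a::{field,finite}) = p ^ k" "CARD('b::{field,finite}) = p ^ (k * j)"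
  obtains \<sigma> :: "'a::{field,finite} \<Rightarrow> 'b::{field,finite}" where
    "\<And>x y. \<sigma> (x + y) = \<sigma> x + \<sigma> y" "\<And>x y. \<sigma> (x * y) = \<sigma> x * \<sigma> y" "\<sigma> 1 = 1"
proof -
  have ca: "CHAR('a) = p" using assms CHAR_finite_field by blast
  have cb: "CHAR('b) = p" using assms CHAR_finite_field by blast
  obtain g :: 'a where g: "\<And>x. x \<noteq> 0 \<Longrightarrow> \<exists>i::nat. x = g ^ i" using finite_field_generator by blast
  have hom_add: "map_poly of_int (P + R) = map_poly of_int P + (map_poly of_int R :: 'c::field poly)" for P R
    by (rule poly_eqI) (simp add: coeff_map_poly)
  have hom_mult: "map_poly of_int (P * R) = map_poly of_int P * (map_poly of_int R :: 'c::field poly)" for P R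
    by (rule poly_eqI) (simp add: coeff_map_poly coeff_mult)
  define ea where "ea P = poly (map_poly of_int P) g" for P
  define eb where "eb c P = poly (map_poly of_int P) c" for c :: 'b and P
  have ea_add: "ea (P + R) = ea P + ea R" and ea_mult: "ea (P * R) = ea P * ea R" for P R
    by (simp_all add: ea_def hom_add hom_mult)
  have eb_add: "eb c (P + R) = eb c P + eb c R" and eb_mult: "eb c (P * R) = eb c P * eb c R" for c P R
    by (simp_all add: eb_def hom_add hom_mult)
  have ea_monom: "ea (monom 1 n) = g ^ n" and eb_monom: "eb c (monom 1 n) = c ^ n" for c n
    by (simp_all add: ea_def eb_def map_poly_monom poly_monom)
  have ea_minus: "ea (- P) = - ea P" and eb_minus: "eb c (- P) = - eb c P" for c P
    using ea_add[of P "- P"] eb_add[of c P "- P"]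
    by (simp_all add: ea_def eb_def minus_unique eq_neg_iff_add_eq_0 add.commute)
  have ea_diff: "ea (P - R) = ea P - ea R" and eb_diff: "eb c (P - R) = eb c P - eb c R" for c P R
    using ea_add[of P "- R"] eb_add[of c P "- R"] by (simp_all add: ea_minus eb_minus)
  have surj: "\<exists>P. ea P = x" for x
  proof (cases "x = 0")
    case True
    then show ?thesis by (intro exI[of _ 0]) (simp add: ea_def)
  next
    case False
    then obtain i where "x = g ^ i" using g by blast
    then show ?thesis using ea_monom by blast
  qed
  define Q where "Q = CARD('b)"
  have Q1: "Q > 1" unfolding Q_def using card_mono[of UNIV "{0, 1::'b}"] by simp
  have Qpow: "Q = CARD('a) ^ j" unfolding Q_def using assms by (simp add: power_mult)
  have gQ: "g ^ Q = g" unfolding Qpow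
    by (induction j) (simp_all add: power_mult finite_field_power_card)
  define W where "W = monom (1::int) Q - monom 1 1"
  have coeffW: "coeff W Q = 1" using Q1 by (simp add: W_def)
  moreover have "degree W \<le> Q" unfolding W_def
    using Q1 by (intro degree_diff_le) (simp_all add: degree_monom_eq)
  ultimately have degW: "degree W = Q" by (metis le_antisym le_degree zero_neq_one)
  have eaW: "ea W = 0" by (simp only: W_def ea_diff ea_monom gQ) simp
  have ebW: "eb c W = 0" for c
    using finite_field_power_card[of c] by (simp only: W_def eb_diff eb_monom) (simp add: Q_def)
  define A where "A m \<longleftrightarrow> lead_coeff m = 1 \<and> ea m = 0" for m
  have "A W" using coeffW degW eaW by (simp add: A_def)
  then obtain m where "A m" and mmin: "\<And>m'. A m' \<Longrightarrow> degree m \<le> degree m'"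
    using ex_has_least_nat[of A W degree] by blast
  then have lm: "lead_coeff m = 1" and eam: "ea m = 0" by (auto simp: A_def)
  \<comment> \<open>Below the degree of \<open>m\<close>, vanishing at \<open>g\<close> forces the
    polynomial to be zero modulo \<open>p\<close>: by minimality of \<open>m\<close> the leading
    coefficient is divisible by \<open>p\<close>, and the leading terms are stripped off one by
    one.\<close>
  have low: "eb c s = 0 \<and> (\<forall>i. int p dvd coeff s i)" if "ea s = 0" "s = 0 \<or> degree s < degree m" for s c
    using that
  proof (induction "degree s" arbitrary: s rule: less_induct)
    case less
    show ?case
    proof (cases "s = 0")
      case True
      then show ?thesis by (simp add: eb_def)
    next
      case False
      let ?l = "lead_coeff s" and ?t = "monom (lead_coeff s) (degree s)"
      have pl: "int p dvd ?l"
      proof (rule ccontr)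
        assume "\<not> int p dvd ?l"
        then have "coprime ?l (int p)"
          using assms(1) by (meson coprime_commute prime_imp_coprime prime_nat_int_transfer)
        then obtain w where w: "[?l * w = 1] (mod int p)" using cong_solve_coprime_int by blast
        \<comment> \<open>The leading coefficient of \<open>smult w s\<close> is only congruent to
          1. The added term makes it exactly 1, and its coefficient, a multiple of \<open>p\<close>,
          leaves the value at \<open>g\<close> unchanged; the result contradicts the choice of
          \<open>m\<close>.\<close>
        define s' where "s' = smult w s + monom (1 - w * ?l) (degree s)"
        have z: "of_int (1 - w * ?l) = (0::'a)"
          using w of_int_eq_iff_cong_CHAR[where 'a='a, of "?l * w" 1] by (simp add: ca mult.commute)
        have "ea s' = of_int w * ea s + of_int (1 - w * ?l) * g ^ degree s"
          by (simp add: s'_def ea_def hom_add map_poly_monom poly_monom map_poly_smult)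
        then have "ea s' = 0" using less.prems z by simp
        moreover have cs': "coeff s' (degree s) = 1" by (simp add: s'_def)
        moreover have "degree s' \<le> degree s"
          unfolding s'_def by (intro degree_add_le degree_smult_le degree_monom_le)
        moreover from this cs' have "degree s' = degree s" by (metis le_antisym le_degree zero_neq_one)
        ultimately have "A s'" by (simp add: A_def)
        then show False using mmin \<open>degree s' = degree s\<close> less.prems(2) False by fastforce
      qed
      have z: "of_int ?l = (0::'a)" "of_int ?l = (0::'b)"
        using pl of_int_eq_iff_cong_CHAR[where 'a='a, of ?l 0] of_int_eq_iff_cong_CHAR[where 'a='b, of ?l 0]
        by (simp_all add: ca cb cong_0_iff)
      have "ea ?t = of_int ?l * g ^ degree s" "eb c ?t = of_int ?l * c ^ degree s"
        by (simp_all add: ea_def eb_def map_poly_monom poly_monom)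
      then have t0: "ea ?t = 0" "eb c ?t = 0" using z by simp_all
      have ih: "eb c (s - ?t) = 0 \<and> (\<forall>i. int p dvd coeff (s - ?t) i)"
      proof (cases "s - ?t = 0")
        case True
        then show ?thesis by (simp only: True) (simp add: eb_def)
      next
        case nz: False
        have "degree (s - ?t) \<le> degree s" by (intro degree_diff_le degree_monom_le) simp
        moreover have "coeff (s - ?t) (degree s) = 0" by simp
        ultimately have "degree (s - ?t) < degree s"
          using nz by (metis le_neq_implies_less leading_coeff_0_iff)
        then show ?thesis using less.hyps[of "s - ?t"] less.prems False t0 by (simp add: ea_diff)
      qed
      have "int p dvd coeff s i" for i
        using ih pl by (cases "i = degree s") (auto dest: spec[of _ i])
      then show ?thesis using ih t0 by (simp add: eb_diff)
    qed
  qed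
  obtain r s where rs: "W = m * r + s" "s = 0 \<or> degree s < degree m"
    using monic_int_poly_division[OF lm] by blast
  have eas: "ea s = 0" using eaW rs(1) eam by (simp add: ea_add ea_mult)
  \<comment> \<open>Modulo \<open>p\<close> the quotient \<open>r\<close> is nonzero, since
    \<open>W\<close> is monic and \<open>s\<close> is zero there. Its degree is below the number
    \<open>Q\<close> of field elements, so it is nonzero at some \<open>c\<close>. As
    \<open>W\<close> and \<open>s\<close> vanish on the whole larger field, this \<open>c\<close> is
    a root of \<open>m\<close>.\<close>
  have rne: "map_poly of_int r \<noteq> (0::'b poly)" "degree (map_poly of_int r :: 'b poly) < Q"
  proof -
    have m0: "m \<noteq> 0" using lm by auto
    have d0: "degree m > 0"
    proof (rule ccontr)
      assume "\<not> degree m > 0"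
      then have "m = 1" using lm by (metis degree_eq_zeroE lead_coeff_pCons(2) pCons_one degree_pCons_0 gr0I coeff_pCons_0)
      then show False using eam by (simp add: ea_def)
    qed
    have dm: "degree m \<le> Q" using mmin[OF \<open>A W\<close>] degW by simp
    show 1: "map_poly of_int r \<noteq> (0::'b poly)"
    proof
      assume "map_poly of_int r = (0::'b poly)"
      then have "map_poly of_int W = (map_poly of_int s :: 'b poly)"
        unfolding rs(1) hom_add hom_mult by simp
      then have "coeff (map_poly of_int W) Q = coeff (map_poly of_int s :: 'b poly) Q" by simp
      then have "of_int (coeff s Q) = (1::'b)" using coeffW by (simp add: coeff_map_poly)
      moreover have "int p dvd coeff s Q" using low[OF eas rs(2)] by blast
      ultimately show False using of_int_eq_iff_cong_CHAR[where 'a='b, of "coeff s Q" 0]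
        by (simp add: cb cong_0_iff)
    qed
    have "r \<noteq> 0" using 1 by auto
    then have dmr: "degree (m * r) = degree m + degree r" using m0 by (simp add: degree_mult_eq)
    have "degree r < Q"
    proof (rule ccontr)
      assume "\<not> degree r < Q"
      then have "degree (m * r) > Q" using dmr d0 by simp
      moreover have "degree (W - s) \<le> Q" using degW rs(2) dm by (intro degree_diff_le) auto
      moreover have "m * r = W - s" using rs(1) by simp
      ultimately show False by simp
    qed
    then show "degree (map_poly of_int r :: 'b poly) < Q"
      using map_poly_degree_leq[of "of_int :: int \<Rightarrow> 'b" r] le_less_trans by blast
  qed
  have "\<exists>c. poly (map_poly of_int r) c \<noteq> (0::'b)"
  proof (rule ccontr)
    assume "\<not> ?thesis"
    then have "{c. poly (map_poly of_int r) c = (0::'b)} = UNIV" by auto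
    then have "Q \<le> degree (map_poly of_int r :: 'b poly)"
      using card_poly_roots_bound[OF rne(1)] by (simp add: Q_def)
    then show False using rne(2) by simp
  qed
  then obtain c where "eb c r \<noteq> 0" by (auto simp: eb_def)
  moreover have "eb c m * eb c r = 0"
    using ebW[of c] low[OF eas rs(2), of c] unfolding rs(1) by (simp add: eb_add eb_mult)
  ultimately have ebm: "eb c m = 0" by simp
  have ker: "eb c P = 0" if "ea P = 0" for P
  proof -
    obtain u v where uv: "P = m * u + v" "v = 0 \<or> degree v < degree m"
      using monic_int_poly_division[OF lm] by blast
    have "ea v = 0" using that eam unfolding uv(1) by (simp add: ea_add ea_mult)
    then show ?thesis using low[OF _ uv(2)] ebm unfolding uv(1) by (simp add: eb_add eb_mult)
  qed
  \<comment> \<open>The chosen polynomial does not matter: two polynomials with equal value at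
    \<open>g\<close> have equal value at \<open>c\<close>, by \<open>ker\<close>.\<close>
  define \<sigma> where "\<sigma> x = eb c (SOME P. ea P = x)" for x
  have \<sigma>: "\<sigma> (ea P) = eb c P" for P
  proof -
    have "ea (SOME R. ea R = ea P) = ea P" by (rule someI) simp
    then show ?thesis using ker[of "(SOME R. ea R = ea P) - P"] by (simp add: \<sigma>_def ea_diff eb_diff)
  qed
  have one: "ea 1 = 1" "eb c 1 = 1" by (simp_all add: ea_def eb_def)
  show thesis
  proof
    show "\<sigma> (x + y) = \<sigma> x + \<sigma> y" for x y using surj[of x] surj[of y] \<sigma> ea_add eb_add by metis
    show "\<sigma> (x * y) = \<sigma> x * \<sigma> y" for x y using surj[of x] surj[of y] \<sigma> ea_mult eb_mult by metis
    show "\<sigma> 1 = 1" using \<sigma>[of 1] one by simp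
  qed
qed

section \<open>Squares and norms\<close>

lemma card_squares:
  "CARD('a::{field,finite}) + 1 \<le> 2 * card (range (\<lambda>x::'a. x\<^sup>2))"
proof -
  let ?S = "range (\<lambda>x::'a. x\<^sup>2)"
  \<comment> \<open>Each nonzero square has at most two roots; adding 0, the squares fill more than
    half of the field.\<close>
  have fib: "card {x::'a. x\<^sup>2 = s} \<le> 2" if "s \<in> ?S - {0}" for s
  proof -
    obtain r where "s = r\<^sup>2" using \<open>s \<in> ?S - {0}\<close> by auto
    then have "{x. x\<^sup>2 = s} \<subseteq> {r, - r}" by (auto simp: power2_eq_iff)
    then show ?thesis using card_mono[of "{r, - r}" "{x. x\<^sup>2 = s}"] card_insert_le_m1[of 2 "{- r}" r] by simp
  qed
  have "UNIV - {0} = (\<Union>s\<in>?S - {0}. {x. x\<^sup>2 = s})" by auto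
  then have "card (UNIV - {0::'a}) \<le> (\<Sum>s\<in>?S - {0}. card {x. x\<^sup>2 = s})"
    using card_UN_le[of "?S - {0}" "\<lambda>s. {x. x\<^sup>2 = s}"] by simp
  also have "\<dots> \<le> (\<Sum>s\<in>?S - {0}. 2)" by (intro sum_mono fib)
  also have "\<dots> = 2 * (card ?S - 1)"
  proof -
    have "(0::'a) \<in> ?S" by (rule range_eqI[of _ _ 0]) simp
    then show ?thesis by (simp add: card_Diff_singleton)
  qed
  finally have "CARD('a) - 1 \<le> 2 * (card ?S - 1)" by (simp add: card_Diff_singleton)
  moreover have "card ?S > 0" by (simp add: card_gt_0_iff)
  ultimately show ?thesis by linarith
qed

text \<open>Pigeonhole: the values of \<open>a * x\<^sup>2\<close> and those of
  \<open>c - b * y\<^sup>2\<close> each fill more than half of the field, so the two sets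
  meet.\<close>

lemma binary_form_universal:
  fixes a b c :: "'a::{field,finite}"
  assumes "a \<noteq> 0" "b \<noteq> 0"
  obtains x y where "a * x\<^sup>2 + b * y\<^sup>2 = c"
proof -
  let ?S = "range (\<lambda>x::'a. x\<^sup>2)"
  have "card ((*) a ` ?S) = card ?S"
    using assms(1) by (intro card_image inj_onI) simp
  moreover have "card ((\<lambda>s. c - b * s) ` ?S) = card ?S"
    using assms(2) by (intro card_image inj_onI) simp
  moreover have "card ((*) a ` ?S \<union> (\<lambda>s. c - b * s) ` ?S) \<le> CARD('a)"
    by (intro card_mono) auto
  ultimately have "(*) a ` ?S \<inter> (\<lambda>s. c - b * s) ` ?S \<noteq> {}"
    using card_Un_disjoint[of "(*) a ` ?S" "(\<lambda>s. c - b * s) ` ?S"] card_squares[where 'a='a] by fastforce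
  then obtain x y where "a * x\<^sup>2 = c - b * y\<^sup>2" by auto
  then have "a * x\<^sup>2 + b * y\<^sup>2 = c" by simp
  then show thesis by (rule that)
qed

lemma ex_nonsquare:
  assumes "(2::'a::{field,finite}) \<noteq> 0"
  obtains d :: "'a::{field,finite}" where "\<And>x. x\<^sup>2 \<noteq> d"
proof -
  have "\<not> inj (\<lambda>x::'a. x\<^sup>2)"
  proof
    assume "inj (\<lambda>x::'a. x\<^sup>2)"
    from injD[OF this, of 1 "- 1"] have "(1::'a) + 1 = 0" by (simp add: eq_neg_iff_add_eq_0)
    with assms show False by simp
  qed
  then have "\<not> surj (\<lambda>x::'a. x\<^sup>2)" using finite_UNIV_surj_inj[OF finite] by blast
  then obtain d :: 'a where "d \<notin> range (\<lambda>x. x\<^sup>2)" by blast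
  then show thesis using that[of d] by blast
qed

text \<open>The nonzero squares and their multiples by \<open>d\<close> are disjoint and together
  too many to leave out a nonzero element. This later rescales a frame vector so that a prescribed
  \<open>d\<close> appears.\<close>

lemma nonsquare_ratio:
  fixes d d' :: "'a::{field,finite}"
  assumes "\<And>x. x\<^sup>2 \<noteq> d" "\<And>x. x\<^sup>2 \<noteq> d'"
  obtains t where "d' = d * t\<^sup>2" "t \<noteq> 0"
proof -
  let ?S = "range (\<lambda>x::'a. x\<^sup>2) - {0}"
  have d0: "d \<noteq> 0" "d' \<noteq> 0" using assms(1)[of 0] assms(2)[of 0] by auto
  have z: "(0::'a) \<in> range (\<lambda>x::'a. x\<^sup>2)" by (rule range_eqI[of _ _ 0]) simp
  have "card (range (\<lambda>x::'a. x\<^sup>2)) > 0" by (simp add: card_gt_0_iff)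
  then have cS: "CARD('a) \<le> 2 * card ?S + 1"
    using card_squares[where 'a='a] z by (simp add: card_Diff_singleton)
  have "card ((*) d ` ?S) = card ?S" using d0 by (intro card_image inj_onI) simp
  moreover have "?S \<inter> (*) d ` ?S = {}"
  proof -
    have False if "x\<^sup>2 = d * y\<^sup>2" "y\<^sup>2 \<noteq> 0" for x y :: 'a
      using assms(1)[of "x / y"] that by (simp add: power_divide)
    then show ?thesis by fastforce
  qed
  ultimately have "card (?S \<union> (*) d ` ?S) = 2 * card ?S"
    using card_Un_disjoint[of ?S "(*) d ` ?S"] by simp
  moreover have "?S \<union> (*) d ` ?S \<subseteq> UNIV - {0}" using d0 by auto
  moreover have "card (UNIV - {0::'a}) = CARD('a) - 1" by (simp add: card_Diff_singleton)
  ultimately have "?S \<union> (*) d ` ?S = UNIV - {0}"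
    using cS by (intro card_seteq) auto
  then have "d' \<in> ?S \<union> (*) d ` ?S" using d0 by blast
  then obtain t where "d' = d * t\<^sup>2" using assms(2) by fastforce
  moreover then have "t \<noteq> 0" using d0 by auto
  ultimately show thesis by (rule that)
qed

text \<open>The norm of \<open>x + y\<surd>d\<close>, defined also when \<open>d\<close> is a square.\<close>

definition qnorm :: "'a::field \<Rightarrow> 'a \<Rightarrow> 'a \<Rightarrow> 'a" where
  "qnorm d x y = x\<^sup>2 - d * y\<^sup>2"

lemma qnorm_eq_0_iff:
  assumes "\<And>x. x\<^sup>2 \<noteq> (d::'a::field)"
  shows "qnorm d x y = 0 \<longleftrightarrow> x = 0 \<and> y = 0"
proof
  assume n: "qnorm d x y = 0"
  have "y = 0"
  proof (rule ccontr)
    assume "y \<noteq> 0"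
    then have "(x / y)\<^sup>2 = d" using n by (simp add: qnorm_def power_divide)
    then show False using assms by blast
  qed
  then show "x = 0 \<and> y = 0" using n by (simp add: qnorm_def)
qed (simp add: qnorm_def)

lemma qnorm_surj:
  fixes d :: "'a::{field,finite}"
  assumes "d \<noteq> 0"
  obtains x y where "qnorm d x y = c"
proof -
  obtain x y where "1 * x\<^sup>2 + (- d) * y\<^sup>2 = c" using assms by (auto intro: binary_form_universal[of 1 "- d" c])
  then have "qnorm d x y = c" by (simp add: qnorm_def)
  then show thesis by (rule that)
qed

lemma qnorm_mult: "qnorm d x y * qnorm d x' y' = qnorm d (x * x' + d * y * y') (x * y' + y * x')"
  by (simp add: qnorm_def power2_eq_square algebra_simps)

text \<open>Multiplication by an element of norm \<open>b / a\<close> injects the elements of norm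
  \<open>a\<close> into those of norm \<open>b\<close>, and this works in both directions.\<close>

lemma card_qnorm_eq:
  fixes d :: "'a::{field,finite}"
  assumes d: "\<And>x. x\<^sup>2 \<noteq> d" and "c \<noteq> 0" "c' \<noteq> 0"
  shows "card {(x, y). qnorm d x y = c} = card {(x, y). qnorm d x y = c'}"
proof -
  have le: "card {(x, y). qnorm d x y = a} \<le> card {(x, y). qnorm d x y = b}"
    if a: "a \<noteq> 0" and b: "b \<noteq> 0" for a b
  proof -
    have "d \<noteq> 0" using d[of 0] by auto
    then obtain u v where uv: "qnorm d u v = b / a" by (rule qnorm_surj)
    define m where "m = (\<lambda>(x, y). (x * u + d * y * v, x * v + y * u))"
    have nm: "qnorm d u v \<noteq> 0" using uv a b by simp
    have "inj m"
    proof (rule injI)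
      fix p q assume pq: "m p = m q"
      obtain x y where [simp]: "p = (x, y)" by (cases p)
      obtain z w where [simp]: "q = (z, w)" by (cases q)
      have e: "(x - z) * u + d * (y - w) * v = 0" "(x - z) * v + (y - w) * u = 0"
        using pq by (simp_all add: m_def algebra_simps)
      \<comment> \<open>Multiplying by the conjugate of \<open>u + v\<surd>d\<close> recovers the
        differences up to the nonzero norm.\<close>
      have "(x - z) * qnorm d u v = u * ((x - z) * u + d * (y - w) * v) - d * v * ((x - z) * v + (y - w) * u)"
        "(y - w) * qnorm d u v = u * ((x - z) * v + (y - w) * u) - v * ((x - z) * u + d * (y - w) * v)"
        by (simp_all add: qnorm_def power2_eq_square algebra_simps)
      then have "(x - z) * qnorm d u v = 0" "(y - w) * qnorm d u v = 0" unfolding e by simp_all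
      then show "p = q" using nm by simp
    qed
    moreover have "m ` {(x, y). qnorm d x y = a} \<subseteq> {(x, y). qnorm d x y = b}"
      using a uv by (auto simp: m_def qnorm_mult[symmetric])
    ultimately show ?thesis
      by (meson card_inj_on_le finite inj_on_subset subset_UNIV)
  qed
  show ?thesis using le[of c c'] le[of c' c] assms(2,3) by (simp add: le_antisym)
qed

section \<open>The scheme on the Heisenberg group\<close>

declare split_paired_All [simp del] split_paired_Ex [simp del]

type_synonym 'a quad = "'a \<times> 'a \<times> 'a \<times> 'a"

fun dt :: "'a::field quad \<Rightarrow> 'a" where
  "dt (x1, y1, x2, y2) = x1 * y2 - x2 * y1"

text \<open>The rational part of \<open>z\<^sub>1 \<cdot> conj z\<^sub>2' - z\<^sub>2 \<cdot> conj z\<^sub>1'\<close>.\<close>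

fun om :: "'a::field \<Rightarrow> 'a quad \<Rightarrow> 'a quad \<Rightarrow> 'a" where
  "om d (x1, y1, x2, y2) (x1', y1', x2', y2') = x1 * x2' - d * y1 * y2' - x2 * x1' + d * y2 * y1'"

definition rk :: "'a::field quad \<Rightarrow> nat" where
  "rk v = (if v = 0 then 0 else if dt v = 0 then 1 else 2)"

text \<open>The index of the relation with rank \<open>r\<close>, where \<open>z\<close> tells whether the invariant is 0.\<close>

definition cls :: "nat \<Rightarrow> bool \<Rightarrow> nat" where
  "cls r z = (if r = 0 then (if z then 0 else 2) else if r = 1 then (if z then 1 else 3)
     else (if z then 5 else 4))"

fun height :: "'a::field \<Rightarrow> 'a quad \<times> 'a \<Rightarrow> 'a quad \<times> 'a \<Rightarrow> 'a" where
  "height d (u, a) (v, b) = a - b + om d u v"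

definition hcls :: "'a::field \<Rightarrow> 'a quad \<times> 'a \<Rightarrow> 'a quad \<times> 'a \<Rightarrow> nat" where
  "hcls d p q = cls (rk (fst p - fst q)) (height d p q = 0)"

lemma rk_le: "rk v \<le> 2" by (simp add: rk_def)

lemma cls_le: "cls r z \<le> 5" by (simp add: cls_def)

lemma cls_inj: "cls r z = cls r' z' \<longleftrightarrow> r = r' \<and> z = z'" if "r \<le> 2" "r' \<le> 2"
  using that by (auto simp: cls_def split: if_splits)

lemma hcls_eq_iff:
  "hcls d p q = hcls d p' q' \<longleftrightarrow>
     rk (fst p - fst q) = rk (fst p' - fst q') \<and> (height d p q = 0 \<longleftrightarrow> height d p' q' = 0)"
  by (simp add: hcls_def cls_inj rk_le)

lemma om_add: "om d (u + u') v = om d u v + om d u' v" "om d u (v + v') = om d u v + om d u v'"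
  by (cases u; cases u'; cases v; cases v'; simp add: algebra_simps)+

lemma om_minus: "om d (- u) v = - om d u v" "om d u (- v) = - om d u v"
  by (cases u; cases v; simp add: algebra_simps)+

lemma om_diff: "om d (u - u') v = om d u v - om d u' v" "om d u (v - v') = om d u v - om d u v'"
  using om_add(1)[of d u "- u'"] om_add(2)[of d u v "- v'"] by (simp_all add: om_minus)

lemma om_zero [simp]: "om d 0 v = 0" "om d v 0 = 0"
  by (cases v; simp add: zero_prod_def)+

lemma om_self [simp]: "om d v v = 0"
  by (cases v) (simp add: algebra_simps)

lemma om_swap: "om d u v = - om d v u"
  by (cases u; cases v) (simp add: algebra_simps)

lemma dt_zero [simp]: "dt 0 = 0" by (simp add: zero_prod_def)

lemma dt_minus: "dt (- v) = dt v" by (cases v) simp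

lemma rk_minus: "rk (- v) = rk v" by (simp add: rk_def dt_minus)

lemma rk_diff_commute: "rk (u - v) = rk (v - u)"
  using rk_minus[of "v - u"] by simp

lemma height_swap: "height d q p = - height d p q"
  using om_swap[of d "fst q" "fst p"] by (cases p; cases q) simp

lemma hcls_commute: "hcls d q p = hcls d p q"
  using height_swap[of d q p] by (simp add: hcls_def rk_diff_commute[of "fst q"])

section \<open>Automorphisms: translations and similitudes\<close>

definition aut :: "'a::field \<Rightarrow> ('a quad \<times> 'a \<Rightarrow> 'a quad \<times> 'a) \<Rightarrow> bool" where
  "aut d \<phi> \<longleftrightarrow> bij \<phi> \<and> (\<forall>p q. hcls d (\<phi> p) (\<phi> q) = hcls d p q)"

definition path_count :: "'a::field \<Rightarrow> nat \<Rightarrow> nat \<Rightarrow> 'a quad \<times> 'a \<Rightarrow> 'a quad \<times> 'a \<Rightarrow> nat" where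
  "path_count d i j p q = card {w. hcls d p w = i \<and> hcls d w q = j}"

lemma path_count_aut:
  assumes "aut d \<phi>"
  shows "path_count d i j (\<phi> p) (\<phi> q) = path_count d i j p q"
proof -
  have b: "bij \<phi>" and h: "\<And>p q. hcls d (\<phi> p) (\<phi> q) = hcls d p q" using assms by (auto simp: aut_def)
  have "\<phi> ` {w. hcls d p w = i \<and> hcls d w q = j} = {w. hcls d (\<phi> p) w = i \<and> hcls d w (\<phi> q) = j}"
    (is "_ ` ?A = ?B")
  proof
    show "\<phi> ` ?A \<subseteq> ?B" by (auto simp: h)
    show "?B \<subseteq> \<phi> ` ?A"
    proof
      fix w assume w: "w \<in> ?B"
      obtain v where "w = \<phi> v" using b by (metis bij_pointE)
      with w show "w \<in> \<phi> ` ?A" by (auto simp: h)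
    qed
  qed
  moreover have "card (\<phi> ` ?A) = card ?A"
    by (rule card_image) (rule inj_on_subset[OF bij_is_inj[OF b] subset_UNIV])
  ultimately show ?thesis by (simp add: path_count_def)
qed

text \<open>The summand \<open>om d t u\<close> cancels the cross terms of
  \<open>om d (u + t) (v + t)\<close>, so heights are unchanged. These maps form the Heisenberg
  group.\<close>

lemma aut_translation:
  "aut d (\<lambda>(u, a). (u + t, a + c + om d t u))"
proof -
  let ?f = "\<lambda>(u, a). (u + t, a + c + om d t u)"
  let ?g = "\<lambda>(u, a). (u - t, a - c - om d t u)"
  have "bij ?f"
    by (rule o_bij[of ?g]) (auto simp: fun_eq_iff om_add om_diff)
  moreover have "height d (?f p) (?f q) = height d p q" for p q
    using om_swap[of d "fst p" t]
    by (cases p; cases q) (simp add: om_add)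
  moreover have "fst (?f p) - fst (?f q) = fst p - fst q" for p q :: "'a quad \<times> 'a"
    by (cases p; cases q) simp
  ultimately show ?thesis unfolding aut_def hcls_def by presburger
qed

text \<open>Combined with multiplication of the last coordinate by \<open>n\<close>, such an
  \<open>f\<close> preserves ranks and multiplies heights by \<open>n\<close>.\<close>

definition similitude :: "'a::field \<Rightarrow> ('a quad \<Rightarrow> 'a quad) \<Rightarrow> 'a \<Rightarrow> bool" where
  "similitude d f n \<longleftrightarrow> n \<noteq> 0 \<and> (\<forall>u v. f (u - v) = f u - f v) \<and> (\<forall>u. dt (f u) = n * dt u) \<and>
     (\<forall>u v. om d (f u) (f v) = n * om d u v)"

lemma similitude_comp:
  "similitude d f n \<Longrightarrow> similitude d g m \<Longrightarrow> similitude d (f \<circ> g) (n * m)"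
  by (simp add: similitude_def mult.assoc)

lemma om_nondegenerate:
  assumes "d \<noteq> 0" "\<And>v. om d u v = 0"
  shows "u = 0"
proof -
  obtain x1 y1 x2 y2 where u: "u = (x1, y1, x2, y2)" by (cases u)
  show ?thesis
    using assms(2)[of "(1, 0, 0, 0)"] assms(2)[of "(0, 1, 0, 0)"] assms(2)[of "(0, 0, 1, 0)"]
      assms(2)[of "(0, 0, 0, 1)"] assms(1)
    by (simp add: u zero_prod_def)
qed

text \<open>A vector killed by \<open>f\<close> lies in the radical of \<open>om d\<close>, so
  nondegeneracy makes \<open>f\<close> injective, and finiteness makes the induced map
  bijective.\<close>

lemma aut_similitude:
  fixes d :: "'a::{field,finite}"
  assumes d: "d \<noteq> 0" and f: "similitude d f n"
  shows "aut d (\<lambda>(u, a). (f u, n * a))" "f 0 = 0"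
proof -
  have n: "n \<noteq> 0" and df: "\<And>u v. f (u - v) = f u - f v" and dtf: "\<And>u. dt (f u) = n * dt u"
    and omf: "\<And>u v. om d (f u) (f v) = n * om d u v"
    using f by (auto simp: similitude_def)
  show f0: "f 0 = 0" using df[of 0 0] by simp
  have ker: "u = 0" if "f u = 0" for u
    by (rule om_nondegenerate[OF d]) (use omf[of u] that n in simp)
  have inj: "inj f"
    by (rule injI) (use df ker in \<open>metis eq_iff_diff_eq_0\<close>)
  have "inj (\<lambda>(u, a). (f u, n * a))"
    using inj n by (auto simp: inj_on_def)
  then have "bij (\<lambda>(u, a). (f u, n * a))" by (simp add: finite_UNIV_inj_surj bij_def)
  moreover have "rk (f u) = rk u" for u
    using ker[of u] f0 n dtf[of u] by (auto simp: rk_def)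
  then have "rk (f u - f v) = rk (u - v)" for u v by (simp flip: df)
  moreover have "height d (f u, n * a) (f v, n * b) = n * height d (u, a) (v, b)" for u a v b
    by (simp add: omf algebra_simps)
  ultimately show "aut d (\<lambda>(u, a). (f u, n * a))"
    using n by (auto simp: aut_def hcls_def simp del: height.simps)
qed

text \<open>Row operations: both forms are alternating contractions over the two rows of the matrix,
  so the determinant factors out.\<close>

lemma similitude_left:
  assumes "a * e - b * c \<noteq> 0"
  shows "similitude d (\<lambda>(x1, y1, x2, y2). (a * x1 + b * x2, a * y1 + b * y2, c * x1 + e * x2, c * y1 + e * y2))
    (a * e - b * c)"
  unfolding similitude_def split_paired_All using assms by (simp add: algebra_simps)

text \<open>Multiplication of \<open>z\<^sub>1\<close> and \<open>z\<^sub>2\<close> by \<open>z + w\<surd>d\<close>.\<close>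

lemma similitude_right:
  assumes "qnorm d z w \<noteq> 0"
  shows "similitude d (\<lambda>(x1, y1, x2, y2). (x1 * z + d * y1 * w, x1 * w + y1 * z, x2 * z + d * y2 * w, x2 * w + y2 * z))
    (qnorm d z w)"
  unfolding similitude_def split_paired_All using assms by (simp add: qnorm_def power2_eq_square algebra_simps)

lemma similitude_rank_1:
  assumes d: "\<And>x. x\<^sup>2 \<noteq> (d::'a::field)" and u: "dt u = 0" "u \<noteq> 0"
  obtains f n where "similitude d f n" "f u = (1, 0, 0, 0)"
proof -
  obtain x1 y1 x2 y2 where ueq: "u = (x1, y1, x2, y2)" by (cases u)
  have dt: "x1 * y2 = x2 * y1" using u ueq by simp
  \<comment> \<open>The two rows are proportional, so a row operation, or an exchange of rows if the
    first one is 0, clears the second row.\<close>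
  obtain g n x y where g: "similitude d g n" "g u = (x, y, 0, 0)" "x \<noteq> 0 \<or> y \<noteq> 0"
  proof (cases "x1 = 0 \<and> y1 = 0")
    case True
    then have "x2 \<noteq> 0 \<or> y2 \<noteq> 0" using u ueq by (auto simp: zero_prod_def)
    then show thesis
      using True ueq by (intro that[OF similitude_left[of 0 0 1 "- 1"]]) auto
  next
    case False
    define t where "t = (if x1 = 0 then y2 / y1 else x2 / x1)"
    have "x2 = t * x1" "y2 = t * y1"
      using dt False by (auto simp: t_def field_simps)
    then show thesis
      using False ueq by (intro that[OF similitude_left[of 1 1 0 "- t"]]) auto
  qed
  have N: "qnorm d x y \<noteq> 0" using qnorm_eq_0_iff[OF d] g(3) by blast
  let ?N = "qnorm d x y"
  \<comment> \<open>The pair consists of the coordinates of the inverse of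
    \<open>x + y\<surd>d\<close>; multiplying by it turns the first row into
    \<open>(1, 0)\<close>.\<close>
  have "qnorm d (x / ?N) (- (y / ?N)) = ?N / ?N\<^sup>2"
    by (simp add: qnorm_def power_divide diff_divide_distrib)
  then have "qnorm d (x / ?N) (- (y / ?N)) \<noteq> 0" using N by simp
  note sr = similitude_right[OF this]
  have "x * (x / ?N) + d * y * (- (y / ?N)) = ?N / ?N"
    by (simp add: qnorm_def power2_eq_square diff_divide_distrib mult.assoc del: divide_self_if)
  then have one: "x * (x / ?N) + d * y * (- (y / ?N)) = 1" by (simp only: divide_self[OF N])
  show thesis
    by (rule that[OF similitude_comp[OF sr g(1)]]) (use one in \<open>simp add: g(2)\<close>)
qed

lemma similitude_rank_2:
  assumes u: "dt u \<noteq> (0::'a::field)"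
  obtains f n where "similitude d f n" "f u = (1, 0, 0, 1)"
proof -
  obtain x1 y1 x2 y2 where ueq: "u = (x1, y1, x2, y2)" by (cases u)
  let ?D = "x1 * y2 - x2 * y1"
  have D: "?D \<noteq> 0" using u ueq by simp
  \<comment> \<open>The four coefficients are the entries of the inverse of the matrix
    \<open>u\<close>.\<close>
  have "(y2 / ?D) * (x1 / ?D) - (- y1 / ?D) * (- x2 / ?D) = ?D / (?D * ?D)"
    by (simp add: diff_divide_distrib mult.commute)
  then have "(y2 / ?D) * (x1 / ?D) - (- y1 / ?D) * (- x2 / ?D) \<noteq> 0" using D by simp
  note sl = similitude_left[OF this]
  have "(y2 / ?D) * x1 + (- y1 / ?D) * x2 = ?D / ?D" "(- x2 / ?D) * y1 + (x1 / ?D) * y2 = ?D / ?D"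
    by (simp_all add: diff_divide_distrib mult.commute del: divide_self_if)
  then have "(y2 / ?D) * x1 + (- y1 / ?D) * x2 = 1" "(- x2 / ?D) * y1 + (x1 / ?D) * y2 = 1"
    by (simp_all only: divide_self[OF D])
  then show thesis
    by (intro that[OF sl]) (simp add: ueq mult.commute)
qed

text \<open>In rank at most 1 the row scaling by \<open>(1, t)\<close> fixes the representative and
  multiplies the last coordinate by \<open>t\<close>, which normalizes a nonzero value to 1. In rank
  2 only the vanishing of that coordinate is controlled.\<close>

lemma aut_canonical:
  fixes d :: "'a::{field,finite}"
  assumes d: "\<And>x. x\<^sup>2 \<noteq> d"
  obtains \<phi> where "aut d \<phi>" "\<phi> 0 = 0"
    "rk (fst p) < 2 \<Longrightarrow> \<phi> p = (if rk (fst p) = 0 then 0 else (1, 0, 0, 0), if snd p = 0 then 0 else 1)"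
    "rk (fst p) = 2 \<Longrightarrow> fst (\<phi> p) = (1, 0, 0, 1) \<and> (snd (\<phi> p) = 0 \<longleftrightarrow> snd p = 0)"
proof -
  obtain u a where p: "p = (u, a)" by (cases p)
  have d0: "d \<noteq> 0" using d[of 0] by auto
  show thesis
  proof (cases "dt u = 0")
    case True
    obtain f n where f: "similitude d f n" "f u = (if rk u = 0 then 0 else (1, 0, 0, 0))"
    proof (cases "u = 0")
      case True
      have "similitude d (\<lambda>u. u) 1" by (simp add: similitude_def)
      then show thesis using that True by (simp add: rk_def)
    next
      case False
      from similitude_rank_1[OF d \<open>dt u = 0\<close> False] obtain f n
        where "similitude d f n" "f u = (1, 0, 0, 0)" by blast
      then show thesis using that False by (simp add: rk_def)
    qed
    have n: "n \<noteq> 0" using f by (simp add: similitude_def)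
    define t where "t = (if a = 0 then 1 else 1 / (n * a))"
    have t: "t \<noteq> 0" using n by (simp add: t_def)
    have s: "similitude d (\<lambda>(x1, y1, x2, y2). (x1, y1, t * x2, t * y2)) t" (is "similitude d ?g t")
      using similitude_left[of 1 t 0 0 d] t by simp
    have gf: "(?g \<circ> f) u = (if rk u = 0 then 0 else (1, 0, 0, 0))"
      unfolding o_apply f(2) by (simp add: zero_prod_def)
    note A = aut_similitude[OF d0 similitude_comp[OF s f(1)]]
    show thesis
    proof (rule that[OF A(1)])
      show "(case 0 of (u, a) \<Rightarrow> ((?g \<circ> f) u, t * n * a)) = 0"
        using A(2) by (simp add: zero_prod_def del: o_apply)
      show "(case p of (u, a) \<Rightarrow> ((?g \<circ> f) u, t * n * a)) =
          (if rk (fst p) = 0 then 0 else (1, 0, 0, 0), if snd p = 0 then 0 else 1)"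
        unfolding p prod.case gf using n by (simp add: t_def)
      show "fst (case p of (u, a) \<Rightarrow> ((?g \<circ> f) u, t * n * a)) = (1, 0, 0, 1) \<and>
        (snd (case p of (u, a) \<Rightarrow> ((?g \<circ> f) u, t * n * a)) = 0 \<longleftrightarrow> snd p = 0)" if "rk (fst p) = 2"
        using that True by (simp add: p rk_def split: if_splits)
    qed
  next
    case False
    from similitude_rank_2[OF False] obtain f n where f: "similitude d f n" "f u = (1, 0, 0, 1)" by blast
    note A = aut_similitude[OF d0 f(1)]
    have n: "n \<noteq> 0" using f by (simp add: similitude_def)
    show thesis
    proof (rule that[OF A(1)])
      show "(case 0 of (u, a) \<Rightarrow> (f u, n * a)) = 0" using A(2) by (simp add: zero_prod_def)
      show "(case p of (u, a) \<Rightarrow> (f u, n * a)) =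
          (if rk (fst p) = 0 then 0 else (1, 0, 0, 0), if snd p = 0 then 0 else 1)" if "rk (fst p) < 2"
        using that False by (simp add: p rk_def split: if_splits)
      show "fst (case p of (u, a) \<Rightarrow> (f u, n * a)) = (1, 0, 0, 1) \<and>
        (snd (case p of (u, a) \<Rightarrow> (f u, n * a)) = 0 \<longleftrightarrow> snd p = 0)"
        using f(2) n by (simp add: p)
    qed
  qed
qed

section \<open>Intersection numbers\<close>

lemma cls_cases:
  assumes "i \<le> 5"
  obtains r z where "r \<le> 2" "i = cls r z"
proof -
  consider "i = 0" | "i = 1" | "i = 2" | "i = 3" | "i = 4" | "i = 5" using assms by linarith
  then show thesis
    using that[of 0 True] that[of 1 True] that[of 0 False] that[of 1 False] that[of 2 False] that[of 2 True]
    by cases (simp_all add: cls_def)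
qed

text \<open>For a fixed \<open>v\<close>, the number of admissible \<open>b\<close> depends only on whether \<open>s + om d e v = 0\<close>.\<close>

lemma path_count_eqI:
  fixes d s s' :: "'a::{field,finite}"
  assumes V: "\<And>r r'. card {v. rk (e - v) = r \<and> rk v = r' \<and> om d e v = - s}
      = card {v. rk (e - v) = r \<and> rk v = r' \<and> om d e v = - s'}"
  shows "path_count d i j (e, s) 0 = path_count d i j (e, s') 0"
proof (cases "i \<le> 5 \<and> j \<le> 5")
  case False
  have "{w. hcls d p w = i \<and> hcls d w 0 = j} = {}" for p
    using False cls_le by (auto simp: hcls_def)
  then show ?thesis by (simp only: path_count_def)
next
  case True
  then obtain r z r' z' where rz: "r \<le> 2" "i = cls r z" "r' \<le> 2" "j = cls r' z'"
    by (meson cls_cases)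
  define U where "U = {v. rk (e - v) = r \<and> rk v = r'}"
  define c where "c t = card {b::'a. (b = t) = z \<and> (b = 0) = z'}" for t
  have c1: "c t = c 1" if "t \<noteq> 0" for t
    unfolding c_def
    by (rule bij_betw_same_card[of "\<lambda>b. b / t"], rule bij_betw_byWitness[of _ "\<lambda>b. b * t"])
      (use that in \<open>auto simp: field_simps\<close>)
  have "path_count d i j (e, a) 0 =
      card {v \<in> U. om d e v = - a} * c 0 + (card U - card {v \<in> U. om d e v = - a}) * c 1" for a
  proof -
    let ?U = "{v \<in> U. om d e v = - a}"
    have "{w. hcls d (e, a) w = i \<and> hcls d w 0 = j}
        = Sigma U (\<lambda>v. {b. (b = a + om d e v) = z \<and> (b = 0) = z'})"
      unfolding U_def rz hcls_def using rz(1,3)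
      by (auto simp: cls_inj rk_le zero_prod_def[where 'b='a] eq_diff_eq algebra_simps)
    then have "path_count d i j (e, a) 0 = (\<Sum>v\<in>U. c (a + om d e v))"
      unfolding path_count_def c_def by (simp add: card_SigmaI)
    also have "\<dots> = (\<Sum>v\<in>?U. c (a + om d e v)) + (\<Sum>v\<in>U - ?U. c (a + om d e v))"
      by (subst sum.subset_diff[of ?U U]) auto
    also have "(\<Sum>v\<in>?U. c (a + om d e v)) = card ?U * c 0" by simp
    also have "(\<Sum>v\<in>U - ?U. c (a + om d e v)) = (\<Sum>v\<in>U - ?U. c 1)"
      by (intro sum.cong refl c1) (auto simp: add_eq_0_iff)
    also have "\<dots> = (card U - card ?U) * c 1" by (simp add: card_Diff_subset)
    finally show ?thesis .
  qed
  moreover have "card {v \<in> U. om d e v = - s} = card {v \<in> U. om d e v = - s'}"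
    using V[of r r'] by (simp add: U_def conj_assoc)
  ultimately show ?thesis by simp
qed

definition smul :: "'a::field \<Rightarrow> 'a quad \<Rightarrow> 'a quad" where
  "smul t = (\<lambda>(x1, y1, x2, y2). (t * x1, t * y1, t * x2, t * y2))"

lemma smul_simps:
  "dt (smul t v) = t\<^sup>2 * dt v" "om d u (smul t v) = t * om d u v" "smul t (smul t' v) = smul (t * t') v"
  "smul 1 v = v"
  by (cases u; cases v; simp add: smul_def power2_eq_square algebra_simps)+

text \<open>Given \<open>dt v = 0\<close>, the condition \<open>dt (I - v) = 0\<close> for the
  identity matrix \<open>I\<close> says that \<open>v\<close> has trace 1, and the value of
  \<open>om\<close> determines \<open>x2\<close> from \<open>y1\<close>. One quadratic equation in
  \<open>x1\<close>, \<open>y1\<close> remains; completing the squares gives the conic, whence the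
  substitutions \<open>2 * x1 - 1\<close> and \<open>2 * y1 + s / d\<close>.\<close>

lemma card_identity_conic:
  fixes d :: "'a::{field,finite}"
  assumes d: "\<And>x. x\<^sup>2 \<noteq> d" and two: "(2::'a) \<noteq> 0"
  shows "card {v. dt v = 0 \<and> dt ((1, 0, 0, 1) - v) = 0 \<and> om d (1, 0, 0, 1) v = - s}
    = card {(x, y). qnorm d x y = 1 - s\<^sup>2 / d}"
proof -
  have d0: "d \<noteq> 0" using d[of 0] by auto
  let ?f = "\<lambda>(x1, y1, x2 :: 'a, y2 :: 'a). (2 * x1 - 1, 2 * y1 + s / d)"
  let ?g = "\<lambda>(X, Y :: 'a). ((X + 1) / 2, (Y - s / d) / 2, - s - d * ((Y - s / d) / 2), 1 - (X + 1) / 2)"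
  let ?A = "{v. dt v = 0 \<and> dt ((1, 0, 0, 1) - v) = 0 \<and> om d (1, 0, 0, 1) v = - s}"
  let ?B = "{(X, Y). qnorm d X Y = 1 - s\<^sup>2 / d}"
  have A: "(x1, y1, x2, y2) \<in> ?A \<longleftrightarrow> y2 = 1 - x1 \<and> x2 = - s - d * y1 \<and> x1 * y2 = x2 * y1" for x1 y1 x2 y2
  proof -
    have "(1 - x1) * (1 - y2) - x2 * y1 = 1 - x1 - y2 + (x1 * y2 - x2 * y1)" by (simp add: algebra_simps)
    then show ?thesis by (auto simp: algebra_simps eq_neg_iff_add_eq_0)
  qed
  have eq: "qnorm d (2 * x - 1) (2 * y + s / d) = 1 - s\<^sup>2 / d \<longleftrightarrow> x * (1 - x) = (- s - d * y) * y" for x y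
  proof -
    have "qnorm d (2 * x - 1) (2 * y + s / d) - (1 - s\<^sup>2 / d) = - 2 * 2 * (x * (1 - x) - (- s - d * y) * y)"
      using d0 by (simp add: qnorm_def power2_eq_square field_simps)
    then show ?thesis using two by (metis eq_iff_diff_eq_0 mult_eq_0_iff neg_equal_0_iff_equal)
  qed
  have t2: "2 * (z / 2) = z" "2 * z / 2 = z" for z :: 'a using two by simp_all
  have gf: "?f (?g p) = p" for p
    by (cases p) (simp only: prod.case t2 add_diff_cancel diff_add_cancel)
  have fg: "?g (?f v) = v" if "v \<in> ?A" for v
  proof -
    obtain x1 y1 x2 y2 where v: "v = (x1, y1, x2, y2)" by (cases v)
    have "y2 = 1 - x1" "x2 = - s - d * y1" using that unfolding v A by auto
    then show ?thesis unfolding v by (simp only: prod.case add_diff_cancel diff_add_cancel t2)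
  qed
  have fB: "?f v \<in> ?B" if "v \<in> ?A" for v
  proof -
    obtain x1 y1 x2 y2 where v: "v = (x1, y1, x2, y2)" by (cases v)
    show ?thesis using that unfolding v A by (auto simp: eq)
  qed
  have gA: "?g p \<in> ?A" if "p \<in> ?B" for p
  proof -
    obtain X Y where p: "p = (X, Y)" by (cases p)
    have XY: "2 * ((X + 1) / 2) - 1 = X" "2 * ((Y - s / d) / 2) + s / d = Y" unfolding t2 by simp_all
    have "qnorm d (2 * ((X + 1) / 2) - 1) (2 * ((Y - s / d) / 2) + s / d) = 1 - s\<^sup>2 / d"
      using that unfolding p XY by (simp only: mem_Collect_eq prod.case)
    from eq[THEN iffD1, OF this] show ?thesis unfolding p prod.case A by (intro conjI refl)
  qed
  have "bij_betw ?f ?A ?B"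
  proof (rule bij_betw_byWitness[of _ ?g])
    show "\<forall>v\<in>?A. ?g (?f v) = v" by (rule ballI) (rule fg)
    show "\<forall>p\<in>?B. ?f (?g p) = p" by (rule ballI) (rule gf)
    show "?f ` ?A \<subseteq> ?B" by (rule image_subsetI) (rule fB)
    show "?g ` ?B \<subseteq> ?A" by (rule image_subsetI) (rule gA)
  qed
  then show ?thesis by (rule bij_betw_same_card)
qed

text \<open>The similitudes fixing the identity matrix preserve \<open>s\<close> up to sign, so this case needs a count.\<close>

lemma path_count_rank_2:
  fixes d s s' :: "'a::{field,finite}"
  assumes d: "\<And>x. x\<^sup>2 \<noteq> d" and two: "(2::'a) \<noteq> 0" and s: "s \<noteq> 0" "s' \<noteq> 0"
  shows "path_count d i j ((1, 0, 0, 1), s) 0 = path_count d i j ((1, 0, 0, 1), s') 0"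
proof (rule path_count_eqI)
  fix r r'
  let ?I = "(1, 0, 0, 1) :: 'a quad"
  define T where "T a = {v. om d ?I v = - a}" for a
  define D1 where "D1 a = {v. dt v = 0 \<and> om d ?I v = - a}" for a
  define D2 where "D2 a = {v. dt (?I - v) = 0 \<and> om d ?I v = - a}" for a
  have sub: "D1 a \<subseteq> T a" "D2 a \<subseteq> T a" for a by (auto simp: D1_def D2_def T_def)
  have d0: "d \<noteq> 0" using d[of 0] by auto
  have "1 - a\<^sup>2 / d \<noteq> 0" if "a \<noteq> 0" for a
    using d[of a] d0 by (simp add: field_simps)
  then have "card {(x, y). qnorm d x y = 1 - s\<^sup>2 / d} = card {(x, y). qnorm d x y = 1 - s'\<^sup>2 / d}"
    using s by (intro card_qnorm_eq[OF d]) auto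
  then have cc: "card {v. dt v = 0 \<and> dt (?I - v) = 0 \<and> om d ?I v = - s}
      = card {v. dt v = 0 \<and> dt (?I - v) = 0 \<and> om d ?I v = - s'}"
    by (simp only: card_identity_conic[OF d two])
  have c12: "card (D1 s \<inter> D2 s) = card (D1 s' \<inter> D2 s')"
  proof -
    have "D1 a \<inter> D2 a = {v. dt v = 0 \<and> dt (?I - v) = 0 \<and> om d ?I v = - a}" for a
      by (auto simp only: D1_def D2_def)
    then show ?thesis using cc by (simp only:)
  qed
  \<comment> \<open>Scaling by \<open>s' / s\<close> moves the value of \<open>om\<close> from
    \<open>- s\<close> to \<open>- s'\<close>; in the next step it also preserves
    \<open>dt v = 0\<close>.\<close>
  have cT: "card (T s) = card (T s')"
    unfolding T_def
    by (rule bij_betw_same_card[of "smul (s' / s)"], rule bij_betw_byWitness[of _ "smul (s / s')"])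
      (use s in \<open>auto simp: smul_simps\<close>)
  have c1: "card (D1 s) = card (D1 s')"
    unfolding D1_def
    by (rule bij_betw_same_card[of "smul (s' / s)"], rule bij_betw_byWitness[of _ "smul (s / s')"])
      (use s in \<open>auto simp: smul_simps\<close>)
  \<comment> \<open>Since \<open>om\<close> vanishes on the pair \<open>(?I, ?I)\<close>,
    translation by \<open>?I\<close> keeps the value of \<open>om\<close> and exchanges the two
    determinant conditions.\<close>
  have c21: "card (D2 a) = card (D1 a)" if "a \<noteq> 0" for a
  proof -
    have dt': "dt (u - v) = dt (v - u)" for u v :: "'a quad"
      using dt_minus[of "u - v"] by simp
    have "(\<lambda>v. v - e) ` {v. dt (e - v) = 0 \<and> om d e v = b} = {v. dt v = 0 \<and> om d e v = b}" (is "_ ` ?A = ?B") for e b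
    proof
      show "(\<lambda>v. v - e) ` ?A \<subseteq> ?B" by (auto simp: om_diff dt'[of _ e])
      show "?B \<subseteq> (\<lambda>v. v - e) ` ?A"
      proof
        fix w assume "w \<in> ?B"
        then have "w + e \<in> ?A" using dt_minus[of w] by (simp add: om_add)
        then show "w \<in> (\<lambda>v. v - e) ` ?A" by (rule rev_image_eqI) simp
      qed
    qed
    note im = this
    have ci: "card ((\<lambda>v. v - e) ` X) = card X" for e :: "'a quad" and X
      by (intro card_image inj_onI) simp
    have "card {v. dt (e - v) = 0 \<and> om d e v = b} = card {v. dt v = 0 \<and> om d e v = b}" for e b
      unfolding im[of e b, symmetric] by (rule ci[symmetric])
    then show ?thesis by (simp only: D1_def D2_def)
  qed
  \<comment> \<open>For \<open>a \<noteq> 0\<close> neither \<open>v\<close> nor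
    \<open>?I - v\<close> can be 0, because \<open>om d ?I\<close> vanishes at 0 and at
    \<open>?I\<close>. Only ranks 1 and 2 occur, and inclusion-exclusion over \<open>D1\<close> and
    \<open>D2\<close> gives all four counts.\<close>
  have count: "{v. rk (?I - v) = r \<and> rk v = r' \<and> om d ?I v = - a} =
      (if r = 1 \<and> r' = 1 then D1 a \<inter> D2 a else if r = 2 \<and> r' = 1 then D1 a - (D1 a \<inter> D2 a)
       else if r = 1 \<and> r' = 2 then D2 a - (D1 a \<inter> D2 a) else if r = 2 \<and> r' = 2 then T a - (D1 a \<union> D2 a) else {})"
    if a: "a \<noteq> 0" for a
  proof -
    have "(rk (?I - v) = r \<and> rk v = r' \<and> om d ?I v = - a) \<longleftrightarrow>
      (r = (if dt (?I - v) = 0 then 1 else 2) \<and> r' = (if dt v = 0 then 1 else 2) \<and> om d ?I v = - a)" for v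
    proof (cases "om d ?I v = - a")
      case True
      then have "v \<noteq> 0" "?I - v \<noteq> 0" using a om_self[of d ?I] by (auto simp del: om.simps)
      then show ?thesis unfolding rk_def by auto
    qed simp
    then have "{v. rk (?I - v) = r \<and> rk v = r' \<and> om d ?I v = - a} =
      {v. r = (if dt (?I - v) = 0 then 1 else 2) \<and> r' = (if dt v = 0 then 1 else 2) \<and> om d ?I v = - a}"
      by (simp only:)
    also have "\<dots> = (if r = 1 \<and> r' = 1 then D1 a \<inter> D2 a else if r = 2 \<and> r' = 1 then D1 a - (D1 a \<inter> D2 a)
       else if r = 1 \<and> r' = 2 then D2 a - (D1 a \<inter> D2 a) else if r = 2 \<and> r' = 2 then T a - (D1 a \<union> D2 a) else {})"
      by (auto simp: D1_def D2_def T_def simp del: dt.simps om.simps diff_Pair split: if_splits)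
    finally show ?thesis .
  qed
  have fin: "finite X" for X :: "'a quad set" by simp
  have cU: "card (T a - (D1 a \<union> D2 a)) = card (T a) - (card (D1 a) + card (D2 a) - card (D1 a \<inter> D2 a))" for a
    using card_Diff_subset[OF fin, of "D1 a \<union> D2 a" "T a"] sub[of a] card_Un_Int[OF fin fin, of "D1 a" "D2 a"]
    by simp
  show "card {v. rk (?I - v) = r \<and> rk v = r' \<and> om d ?I v = - s}
      = card {v. rk (?I - v) = r \<and> rk v = r' \<and> om d ?I v = - s'}"
    unfolding count[OF s(1)] count[OF s(2)]
    using c12 cT c1 c21[OF s(1)] c21[OF s(2)] by (simp add: cU card_Diff_subset)
qed

lemma aut_hcls: "aut d \<phi> \<Longrightarrow> hcls d (\<phi> p) (\<phi> q) = hcls d p q"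
  by (simp add: aut_def)

lemma path_count_to_origin:
  "\<exists>p'. hcls d p' 0 = hcls d p q \<and> (\<forall>i j. path_count d i j p q = path_count d i j p' 0)"
proof -
  let ?\<phi> = "\<lambda>(u, a). (u + (- fst q), a + (- snd q) + om d (- fst q) u)"
  have A: "aut d ?\<phi>" by (rule aut_translation)
  have "?\<phi> q = 0" by (cases q) (simp add: om_minus zero_prod_def)
  then show ?thesis
    using aut_hcls[OF A, of p q] path_count_aut[OF A, of _ _ p q, symmetric]
    by (intro exI[of _ "?\<phi> p"] conjI allI) (simp_all only:)
qed

lemma aut_canonical':
  fixes d :: "'a::{field,finite}"
  assumes d: "\<And>x. x\<^sup>2 \<noteq> d"
  shows "\<exists>\<phi>. aut d \<phi> \<and> \<phi> 0 = 0 \<and>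
    (rk (fst p) < 2 \<longrightarrow> \<phi> p = (if rk (fst p) = 0 then 0 else (1, 0, 0, 0), if snd p = 0 then 0 else 1)) \<and>
    (rk (fst p) = 2 \<longrightarrow> fst (\<phi> p) = (1, 0, 0, 1) \<and> (snd (\<phi> p) = 0 \<longleftrightarrow> snd p = 0))"
  by (rule aut_canonical[OF d, where p=p]) (intro exI conjI impI; assumption | blast)

text \<open>Pairs of equal class have the same canonical form, except that in rank 2 two different
  nonzero last coordinates may remain; \<open>path_count_rank_2\<close> covers that case.\<close>

lemma path_count_cong:
  fixes d :: "'a::{field,finite}"
  assumes d: "\<And>x. x\<^sup>2 \<noteq> d" and two: "(2::'a) \<noteq> 0" and eq: "hcls d p q = hcls d p' q'"
  shows "path_count d i j p q = path_count d i j p' q'"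
proof -
  have origin: "path_count d i j p 0 = path_count d i j p' 0" if eq: "hcls d p 0 = hcls d p' 0" for p p'
  proof -
    have h0: "height d p 0 = snd p" for p by (cases p) (simp add: zero_prod_def[where 'b='a])
    have rz: "rk (fst p) = rk (fst p')" "snd p = 0 \<longleftrightarrow> snd p' = 0"
      using eq unfolding hcls_eq_iff h0 by simp_all
    obtain \<phi> where f: "aut d \<phi>" "\<phi> 0 = 0"
      "rk (fst p) < 2 \<longrightarrow> \<phi> p = (if rk (fst p) = 0 then 0 else (1, 0, 0, 0), if snd p = 0 then 0 else 1)"
      "rk (fst p) = 2 \<longrightarrow> fst (\<phi> p) = (1, 0, 0, 1) \<and> (snd (\<phi> p) = 0 \<longleftrightarrow> snd p = 0)"
      using aut_canonical'[OF d, where p=p] by blast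
    obtain \<psi> where g: "aut d \<psi>" "\<psi> 0 = 0"
      "rk (fst p') < 2 \<longrightarrow> \<psi> p' = (if rk (fst p') = 0 then 0 else (1, 0, 0, 0), if snd p' = 0 then 0 else 1)"
      "rk (fst p') = 2 \<longrightarrow> fst (\<psi> p') = (1, 0, 0, 1) \<and> (snd (\<psi> p') = 0 \<longleftrightarrow> snd p' = 0)"
      using aut_canonical'[OF d, where p=p'] by blast
    have "path_count d i j (\<phi> p) 0 = path_count d i j (\<psi> p') 0"
    proof (cases "rk (fst p) = 2")
      case True
      define s s' where "s = snd (\<phi> p)" and "s' = snd (\<psi> p')"
      have e: "\<phi> p = ((1, 0, 0, 1), s)" "\<psi> p' = ((1, 0, 0, 1), s')"
        using True f(4) g(4) rz(1) by (simp_all add: s_def s'_def prod_eq_iff)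
      have "s = 0 \<longleftrightarrow> s' = 0" using True f(4) g(4) rz by (simp add: s_def s'_def)
      then show ?thesis unfolding e using path_count_rank_2[OF d two, of s s'] by (cases "s = 0") auto
    next
      case False
      then have "\<phi> p = \<psi> p'" using f(3) g(3) rz rk_le[of "fst p"] by simp
      then show ?thesis by simp
    qed
    then show ?thesis
      using path_count_aut[OF f(1), of i j p 0] path_count_aut[OF g(1), of i j p' 0] f(2) g(2) by simp
  qed
  obtain r where r: "hcls d r 0 = hcls d p q" "\<And>i j. path_count d i j p q = path_count d i j r 0"
    using path_count_to_origin[of d p q] by blast
  obtain r' where r': "hcls d r' 0 = hcls d p' q'" "\<And>i j. path_count d i j p' q' = path_count d i j r' 0"
    using path_count_to_origin[of d p' q'] by blast
  show ?thesis using origin[of r r'] r(1) r'(1) eq by (simp only: r(2) r'(2))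
qed

section \<open>The scheme axioms and imprimitivity\<close>

definition heis_rel :: "'a::field \<Rightarrow> nat \<Rightarrow> (('a quad \<times> 'a) \<times> ('a quad \<times> 'a)) set" where
  "heis_rel d i = {(p, q). hcls d p q = i}"

lemma height_self [simp]: "height d p p = 0"
  by (cases p) simp

lemma hcls_eq_0_iff: "hcls d p q = 0 \<longleftrightarrow> p = q"
proof
  assume "hcls d p q = 0"
  then have "fst p = fst q" "height d p q = 0" by (auto simp: hcls_def cls_def rk_def split: if_splits)
  then show "p = q" by (cases p; cases q) simp
qed (simp add: hcls_def cls_def rk_def)

theorem heis_scheme:
  fixes d :: "'a::{field,finite}"
  assumes d: "\<And>x. x\<^sup>2 \<noteq> d" and two: "(2::'a) \<noteq> 0"
  shows "symmetric_scheme 5 UNIV (heis_rel d)" "imprimitive_scheme 5 UNIV (heis_rel d)"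
proof -
  have sym: "(heis_rel d i)\<inverse> = heis_rel d i" for i
    by (auto simp: heis_rel_def hcls_commute)
  have ne: "\<exists>p. hcls d p 0 = i" if "i \<le> 5" for i
  proof -
    obtain r z where rz: "r \<le> 2" "i = cls r z" using \<open>i \<le> 5\<close> by (rule cls_cases)
    obtain u :: "'a quad" where "rk u = r"
    proof -
      have "rk (0 :: 'a quad) = 0" "rk ((1, 0, 0, 0) :: 'a quad) = 1" "rk ((1, 0, 0, 1) :: 'a quad) = 2"
        by (auto simp: rk_def zero_prod_def)
      moreover have "r = 0 \<or> r = 1 \<or> r = 2" using rz(1) by linarith
      ultimately show thesis using that by blast
    qed
    then have "hcls d (u, if z then 0 else 1) 0 = i"
      by (simp add: hcls_def rz zero_prod_def[where 'b='a])
    then show ?thesis by blast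
  qed
  have "association_scheme 5 UNIV (heis_rel d)"
    unfolding association_scheme_def
  proof (intro conjI)
    show "\<forall>i\<le>5. heis_rel d i \<noteq> {}"
    proof (intro allI impI)
      fix i :: nat assume "i \<le> 5"
      then obtain p where "hcls d p 0 = i" using ne by blast
      then have "(p, 0) \<in> heis_rel d i" by (simp add: heis_rel_def)
      then show "heis_rel d i \<noteq> {}" by blast
    qed
    show "disjoint_family_on (heis_rel d) {..5}" by (auto simp: disjoint_family_on_def heis_rel_def)
    show "(\<Union>i\<le>5. heis_rel d i) = UNIV \<times> UNIV" using cls_le by (auto simp: heis_rel_def hcls_def)
    show "heis_rel d 0 = Id_on UNIV" by (auto simp: heis_rel_def hcls_eq_0_iff)
    show "\<forall>i\<le>5. \<exists>j\<le>5. (heis_rel d i)\<inverse> = heis_rel d j" using sym by blast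
    show "\<forall>i\<le>5. \<forall>j\<le>5. \<forall>k\<le>5. \<exists>c. \<forall>(x, y)\<in>heis_rel d k.
        card {w \<in> UNIV. (x, w) \<in> heis_rel d i \<and> (w, y) \<in> heis_rel d j} = c"
    proof (intro allI impI)
      fix i j k :: nat
      have pc: "card {w \<in> UNIV. (x, w) \<in> heis_rel d i \<and> (w, y) \<in> heis_rel d j} = path_count d i j x y" for x y
        by (simp add: heis_rel_def path_count_def)
      show "\<exists>c. \<forall>(x, y)\<in>heis_rel d k. card {w \<in> UNIV. (x, w) \<in> heis_rel d i \<and> (w, y) \<in> heis_rel d j} = c"
      proof (cases "\<exists>x y. hcls d x y = k")
        case True
        then obtain x0 y0 where "hcls d x0 y0 = k" by blast
        then have "path_count d i j x y = path_count d i j x0 y0" if "hcls d x y = k" for x y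
          using path_count_cong[OF d two, of x y x0 y0] that by (simp only:)
        then show ?thesis unfolding pc by (intro exI[of _ "path_count d i j x0 y0"]) (auto simp: heis_rel_def)
      next
        case False
        then have "heis_rel d k = {}" by (auto simp: heis_rel_def)
        then show ?thesis by (simp only: ball_empty) simp
      qed
    qed
  qed simp_all
  moreover have "sym (heis_rel d i)" for i using sym[of i] by (simp add: sym_conv_converse_eq)
  ultimately show "symmetric_scheme 5 UNIV (heis_rel d)" by (simp add: symmetric_scheme_def)
  \<comment> \<open>Relations 0 and 2 together form the equivalence that proves imprimitivity; its
    classes are the cosets of the centre of the Heisenberg group.\<close>
  have eqv: "(\<Union>i\<in>{0, 2}. heis_rel d i) = {(p, q). fst p = fst q}"
    by (auto simp: heis_rel_def hcls_def cls_def rk_def split: if_splits)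
  have "equiv UNIV {(p, q). fst p = (fst q :: 'a quad)}"
    by (auto simp: equiv_def refl_on_def sym_def trans_def)
  moreover have n0: "(((0, 0), (0, 1)) :: ('a quad \<times> 'a) \<times> ('a quad \<times> 'a)) \<in> {(p, q). fst p = fst q} - heis_rel d 0"
    by (simp add: heis_rel_def hcls_eq_0_iff)
  moreover have n1: "(((0, 0), ((1, 0, 0, 0), 0)) :: ('a quad \<times> 'a) \<times> ('a quad \<times> 'a)) \<notin> {(p, q). fst p = fst q}"
    by (simp add: zero_prod_def)
  ultimately have "equiv UNIV (\<Union>i\<in>{0, 2}. heis_rel d i)" "(\<Union>i\<in>{0, 2}. heis_rel d i) \<noteq> heis_rel d 0"
    "(\<Union>i\<in>{0, 2}. heis_rel d i) \<noteq> UNIV \<times> UNIV"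
    unfolding eqv by blast+
  moreover have "{0, 2} \<subseteq> {..5::nat}" by simp
  ultimately show "imprimitive_scheme 5 UNIV (heis_rel d)"
    unfolding imprimitive_scheme_def using \<open>association_scheme 5 UNIV (heis_rel d)\<close>
    by (intro conjI exI[of _ "{0, 2}"])
qed

section \<open>Lines of the elliptic quadric\<close>

text \<open>Pigeonhole in place of a dimension count: two vectors with the same image differ by a
  kernel vector.\<close>

lemma ex_nonzero_kernel:
  fixes f :: "'a::{finite,ab_group_add} \<Rightarrow> 'b::{finite,ab_group_add}"
  assumes "\<And>x y. f (x - y) = f x - f y" "CARD('b) < CARD('a)"
  obtains v where "v \<noteq> 0" "f v = 0"
proof -
  have "\<not> inj f"
    using card_inj_on_le[of f UNIV UNIV] assms(2) by auto
  then obtain x y where "f x = f y" "x \<noteq> y" by (auto simp: inj_on_def)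
  then show thesis using that[of "x - y"] assms(1) by simp
qed

lemma card_field_power_less:
  assumes "m < n"
  shows "CARD('a::{field,finite}) ^ m < CARD('a) ^ n"
proof -
  have "card {0, 1::'a} \<le> CARD('a)" by (intro card_mono) auto
  then show ?thesis using assms by (simp add: power_strict_increasing)
qed

lemma span_1: "vec.span {x} = {p *s x | p. True}" for x :: "'f::field ^ 'n"
  by (auto simp: vec.span_singleton)

lemma mem_span_insert:
  fixes a :: "'f::field ^ 'n"
  shows "v \<in> vec.span (insert a S) \<longleftrightarrow> (\<exists>k w. w \<in> vec.span S \<and> v = k *s a + w)"
proof
  assume "v \<in> vec.span (insert a S)"
  then obtain k where "v - k *s a \<in> vec.span S" unfolding vec.span_breakdown_eq by blast
  moreover have "v = k *s a + (v - k *s a)" by simp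
  ultimately show "\<exists>k w. w \<in> vec.span S \<and> v = k *s a + w" by blast
next
  assume "\<exists>k w. w \<in> vec.span S \<and> v = k *s a + w"
  then obtain k w where "w \<in> vec.span S" "v = k *s a + w" by blast
  then have "v - k *s a \<in> vec.span S" by simp
  then show "v \<in> vec.span (insert a S)" unfolding vec.span_breakdown_eq by blast
qed

lemma span_2: "vec.span {x, y} = {p *s x + r *s y | p r. True}" for x :: "'f::field ^ 'n"
  unfolding set_eq_iff mem_span_insert span_1 by blast

lemma span_3: "vec.span {x, y, z} = {p *s x + (r *s y + s *s z) | p r s. True}" for x :: "'f::field ^ 'n"
  unfolding set_eq_iff mem_span_insert span_1 by blast

lemma subspace_dim_2_basis:
  fixes l :: "('f::field ^ 'n) set"
  assumes sub: "vec.subspace l" and dl: "vec.dim l = 2"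
  obtains x y where "x \<notin> vec.span {y}" "y \<notin> vec.span {x}" "l = vec.span {x, y}"
proof -
  obtain S where S: "S \<subseteq> l" "vec.independent S" "l \<subseteq> vec.span S" "card S = 2"
    using vec.basis_exists[of l] dl by metis
  have lS: "l = vec.span S" using S(1,3) sub by (metis vec.span_minimal subset_antisym)
  obtain x y where S2: "S = {x, y}" "x \<noteq> y" using S(4) by (meson card_2_iff)
  have "vec.independent {x, y}" using S(2) S2(1) by simp
  then have "x \<notin> vec.span {y}" using S2(2) by (simp add: vec.independent_insert)
  moreover have "vec.independent {y, x}" using S(2) S2(1) by (simp add: insert_commute)
  then have "y \<notin> vec.span {x}" using S2(2) by (simp add: vec.independent_insert split: if_splits)
  ultimately show thesis using that lS S2(1) by simp
qed

locale elliptic =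
  fixes Q :: "'f::{field,finite} ^ 6 \<Rightarrow> 'f"
  assumes ell: "elliptic_form Q" and two: "(2::'f) \<noteq> 0"
begin

abbreviation B where "B \<equiv> polar_form Q"

lemma Q_scale: "Q (c *s v) = c\<^sup>2 * Q v"
  using ell by (simp add: elliptic_form_def quadratic_form_def)

lemma B_linear: "Vector_Spaces.linear (*s) (*) (B u)"
  using ell by (simp add: elliptic_form_def quadratic_form_def)

lemma B_sym: "B u v = B v u"
  by (simp add: polar_form_def add.commute)

lemma B_right: "B u (v + w) = B u v + B u w" "B u (c *s v) = c * B u v"
proof -
  interpret L: Vector_Spaces.linear "(*s)" "(*)" "B u" by (rule B_linear)
  show "B u (v + w) = B u v + B u w" by (rule L.add)
  show "B u (c *s v) = c * B u v" by (rule L.scale)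
qed

lemma B_left: "B (v + w) u = B v u + B w u" "B (c *s v) u = c * B v u"
  using B_right[of u] by (simp_all add: B_sym[of _ u])

lemma B_zero: "B u 0 = 0" "B 0 u = 0"
  using B_right(2)[of u 0 0] B_left(2)[of 0 0 u] by simp_all

lemma B_minus: "B u (- v) = - B u v" "B (- v) u = - B v u"
  using B_right(2)[of u "- 1" v] B_left(2)[of "- 1" v u] by simp_all

lemma B_diff: "B u (v - w) = B u v - B u w" "B (v - w) u = B v u - B w u"
  using B_right(1)[of u v "- w"] B_left(1)[of v "- w" u] by (simp_all add: B_minus)

lemmas B_simps = B_right B_left B_zero B_minus B_diff

lemma Q_add: "Q (u + v) = Q u + Q v + B u v"
  by (simp add: polar_form_def)

lemma B_self: "B v v = 2 * Q v"
proof -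
  have "v + v = 2 *s v" by (simp add: vec_eq_iff)
  then have "Q (v + v) = 2\<^sup>2 * Q v" by (simp only: Q_scale)
  then show ?thesis unfolding polar_form_def by (simp add: power2_eq_square)
qed

lemma nondegenerate:
  assumes "\<And>u. B u v = 0"
  shows "v = 0"
  using ell assms by (auto simp: elliptic_form_def polar_perp_def)

lemma no_singular_plane:
  assumes "Q x = 0" "Q y = 0" "Q z = 0" "B x y = 0" "B x z = 0" "B y z = 0"
    and "x \<noteq> 0" "y \<notin> vec.span {x}" "z \<notin> vec.span {x, y}"
  shows False
proof -
  have ind: "vec.independent {z, y, x}"
    using assms(7-9) unfolding insert_commute[of x y "{}"] by (simp add: vec.independent_insert)
  have "y \<noteq> x" "z \<noteq> x" "z \<noteq> y" using assms(8,9) by (auto intro: vec.span_base)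
  then have "vec.dim (vec.span {z, y, x}) = 3"
    using vec.dim_span_eq_card_independent[OF ind] by simp
  moreover have "totally_singular Q (vec.span {z, y, x})"
  proof -
    have "B z y = 0" "B z x = 0" "B y x = 0" using assms(4-6) by (simp_all add: B_sym)
    then have "Q v = 0" if "v \<in> vec.span {z, y, x}" for v
      using that assms(1-3) unfolding span_3 by (auto simp: Q_add Q_scale B_simps)
    then show ?thesis by (simp add: totally_singular_def)
  qed
  ultimately show False using ell unfolding elliptic_form_def by blast
qed

text \<open>Otherwise \<open>B x\<close> would vanish on the kernel of \<open>B y\<close> and be a
  multiple of it, and nondegeneracy would make \<open>x\<close> a multiple of
  \<open>y\<close>.\<close>

lemma dual_vector:
  assumes "x \<notin> vec.span {y}"
  obtains b where "B x b = 1" "B y b = 0"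
proof -
  have "\<exists>v. B y v = 0 \<and> B x v \<noteq> 0"
  proof (rule ccontr)
    assume "\<not> ?thesis"
    then have ker: "B y v = 0 \<Longrightarrow> B x v = 0" for v by blast
    show False
    proof (cases "\<exists>z. B y z \<noteq> 0")
      case True
      then obtain z where z: "B y z \<noteq> 0" by blast
      have "B v (x - (B x z / B y z) *s y) = 0" for v
      proof -
        have "B y (v - (B y v / B y z) *s z) = 0" using z by (simp add: B_simps)
        from ker[OF this] have "B x v = B y v / B y z * B x z" by (simp add: B_simps)
        then show ?thesis by (simp add: B_simps B_sym[of v])
      qed
      then have "x - (B x z / B y z) *s y = 0" by (rule nondegenerate)
      then have "x = (B x z / B y z) *s y" by simp
      with assms show False unfolding span_1 by blast
    next
      case False
      then have "B v x = 0" for v using ker[of v] by (simp add: B_sym[of v])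
      then have "x = 0" by (rule nondegenerate)
      with assms show False by (simp add: vec.span_zero)
    qed
  qed
  then obtain v where "B y v = 0" "B x v \<noteq> 0" by blast
  then show thesis by (intro that[of "(1 / B x v) *s v"]) (simp_all add: B_simps)
qed

text \<open>A nonzero singular vector orthogonal to both hyperbolic pairs would span a totally
  singular plane together with \<open>a1\<close> and \<open>a2\<close>.\<close>

lemma hyperbolic_complement_anisotropic:
  assumes "Q a1 = 0" "Q a2 = 0" "B a1 a2 = 0" "B a1 b1 = 1" "B a1 b2 = 0" "B a2 b1 = 0" "B a2 b2 = 1"
    and "B a1 v = 0" "B a2 v = 0" "B b1 v = 0" "B b2 v = 0" "v \<noteq> 0"
  shows "Q v \<noteq> 0"
proof
  assume Qv: "Q v = 0"
  show False
  proof (rule no_singular_plane[of a1 a2 v])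
    show "a1 \<noteq> 0" using assms(4) by (auto simp: B_zero)
    show "a2 \<notin> vec.span {a1}"
      using assms by (auto simp: span_1 B_simps)
    show "v \<notin> vec.span {a1, a2}"
    proof
      assume "v \<in> vec.span {a1, a2}"
      then obtain p r where v: "v = p *s a1 + r *s a2" unfolding span_2 by blast
      have "B v b1 = p" "B v b2 = r" using assms by (simp_all add: v B_simps)
      moreover have "B v b1 = 0" "B v b2 = 0" using assms by (simp_all add: B_sym[of v])
      ultimately show False using v assms(12) by simp
    qed
  qed (use assms Qv in auto)
qed

end

text \<open>Two hyperbolic pairs and a plane on which \<open>Q\<close> is the norm form of
  \<open>x + y\<surd>d\<close>. The nonsquare \<open>d\<close> is a parameter because the comparison
  with the Hermitian surface dictates it.\<close>

locale elliptic_frame = elliptic Q for Q :: "'f::{field,finite} ^ 6 \<Rightarrow> 'f" +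
  fixes d :: 'f and a1 a2 b1 b2 w1 w2 :: "'f ^ 6"
  assumes nonsquare: "\<And>x. x\<^sup>2 \<noteq> d"
    and Q_frame: "Q a1 = 0" "Q a2 = 0" "Q b1 = 0" "Q b2 = 0" "Q w1 = 1" "Q w2 = - d"
    and B_frame: "B a1 a2 = 0" "B b1 b2 = 0" "B w1 w2 = 0"
      "B a1 b1 = 1" "B a1 b2 = 0" "B a2 b1 = 0" "B a2 b2 = 1"
      "B a1 w1 = 0" "B a1 w2 = 0" "B a2 w1 = 0" "B a2 w2 = 0"
      "B b1 w1 = 0" "B b1 w2 = 0" "B b2 w1 = 0" "B b2 w2 = 0"

lemma (in elliptic) ex_frame:
  assumes l: "l \<in> quadric_lines Q" and d: "\<And>x. x\<^sup>2 \<noteq> d"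
  obtains a1 a2 b1 b2 w1 w2 where "elliptic_frame Q d a1 a2 b1 b2 w1 w2" "l = vec.span {a1, a2}"
proof -
  have sub: "vec.subspace l" and Ql: "\<And>u. u \<in> l \<Longrightarrow> Q u = 0" and dl: "vec.dim l = 2"
    using l by (auto simp: quadric_lines_def totally_singular_def)
  obtain a1 a2 where ind: "a1 \<notin> vec.span {a2}" "a2 \<notin> vec.span {a1}" and l12: "l = vec.span {a1, a2}"
    using subspace_dim_2_basis[OF sub dl] by blast
  have "a1 \<in> l" "a2 \<in> l" unfolding l12 by (simp_all add: vec.span_base)
  then have Qa: "Q a1 = 0" "Q a2 = 0" "Q (a1 + a2) = 0"
    using Ql sub by (auto intro: vec.subspace_add)
  then have a12: "B a1 a2 = 0" by (simp add: polar_form_def)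
  have a21: "B a2 a1 = 0" using a12 by (simp add: B_sym)
  have a11: "B a1 a1 = 0" "B a2 a2 = 0" using Qa by (simp_all add: B_self)
  obtain c1 where c1: "B a1 c1 = 1" "B a2 c1 = 0" using dual_vector[OF ind(1)] by blast
  obtain c2 where c2: "B a2 c2 = 1" "B a1 c2 = 0" using dual_vector[OF ind(2)] by blast
  have c1': "B c1 a1 = 1" "B c1 a2 = 0" and c2': "B c2 a2 = 1" "B c2 a1 = 0"
    using c1 c2 by (simp_all add: B_sym)
  \<comment> \<open>Multiples of \<open>a1\<close> and \<open>a2\<close> are subtracted to make the
    dual vectors singular and orthogonal to each other, without spoiling the duality.\<close>
  define b1 where "b1 = c1 - Q c1 *s a1"
  define e2 where "e2 = c2 - B b1 c2 *s a1"
  define b2 where "b2 = e2 - Q e2 *s a2"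
  note Bl = B_simps a12 a21 a11 c1 c1' c2 c2' Qa
  have Qm: "Q (u - c *s v) = Q u - c * B u v + c\<^sup>2 * Q v" for u v c
    using Q_add[of u "- c *s v"] Q_scale[of "- c" v] B_right(2)[of u "- c" v] by simp
  have b1: "B a1 b1 = 1" "B a2 b1 = 0" "Q b1 = 0" "B b1 a1 = 1" "B b1 a2 = 0"
    unfolding b1_def Qm by (simp_all add: Bl)
  have e2: "B a1 e2 = 0" "B a2 e2 = 1" "B e2 a2 = 1" "B b1 e2 = 0"
    unfolding e2_def by (simp_all add: Bl b1)
  have b2: "B a1 b2 = 0" "B a2 b2 = 1" "Q b2 = 0" "B b1 b2 = 0"
    unfolding b2_def Qm by (simp_all add: Bl b1 e2)
  note aniso = hyperbolic_complement_anisotropic[OF Qa(1,2) a12 b1(1) b2(1) b1(2) b2(2)]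
  \<comment> \<open>Five linear conditions on a space of dimension 6.\<close>
  have perp: "\<exists>v. v \<noteq> 0 \<and> B a1 v = 0 \<and> B a2 v = 0 \<and> B b1 v = 0 \<and> B b2 v = 0 \<and> B w v = 0" for w
  proof -
    let ?f = "\<lambda>v. (B a1 v, B a2 v, B b1 v, B b2 v, B w v)"
    have "CARD('f \<times> 'f \<times> 'f \<times> 'f \<times> 'f) = CARD('f) ^ 5" by (simp add: power_numeral_reduce)
    then have "CARD('f \<times> 'f \<times> 'f \<times> 'f \<times> 'f) < CARD('f ^ 6)"
      using card_field_power_less[of 5 6, where 'a='f] by simp
    then obtain v where "v \<noteq> 0" "?f v = 0"
      using ex_nonzero_kernel[of ?f] by (auto simp: B_simps)
    then show ?thesis by (auto simp: zero_prod_def)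
  qed
  obtain w where w: "w \<noteq> 0" "B a1 w = 0" "B a2 w = 0" "B b1 w = 0" "B b2 w = 0" using perp[of 0] by blast
  obtain w' where w': "w' \<noteq> 0" "B a1 w' = 0" "B a2 w' = 0" "B b1 w' = 0" "B b2 w' = 0" "B w w' = 0"
    using perp[of w] by blast
  have "Q w \<noteq> 0" "Q w' \<noteq> 0" using aniso[of w] aniso[of w'] w w' by auto
  \<comment> \<open>Two orthogonal nonsingular vectors of the complement represent every value, in
    particular 1.\<close>
  then obtain x y where xy: "Q w * x\<^sup>2 + Q w' * y\<^sup>2 = 1" by (rule binary_form_universal)
  define w1 where "w1 = x *s w + y *s w'"
  have w1: "Q w1 = 1" "B a1 w1 = 0" "B a2 w1 = 0" "B b1 w1 = 0" "B b2 w1 = 0"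
    using xy w w' by (simp_all add: w1_def Q_add Q_scale B_simps mult.commute)
  obtain z where z: "z \<noteq> 0" "B a1 z = 0" "B a2 z = 0" "B b1 z = 0" "B b2 z = 0" "B w1 z = 0"
    using perp[of w1] by blast
  have Qz: "Q z \<noteq> 0" using aniso[of z] z by auto
  \<comment> \<open>If \<open>- Q z\<close> were a square, \<open>s *s w1 + z\<close> would be a
    nonzero singular vector of the anisotropic complement. So \<open>- Q z\<close> and
    \<open>d\<close> are both nonsquares and differ by a square factor \<open>t\<^sup>2\<close>,
    which dividing \<open>z\<close> by \<open>t\<close> removes.\<close>
  have "s\<^sup>2 \<noteq> - Q z" for s
  proof
    assume s: "s\<^sup>2 = - Q z"
    have "B w1 (s *s w1 + z) = s * 2" using z w1 by (simp add: B_simps B_self)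
    moreover have "s \<noteq> 0" using s Qz by auto
    ultimately have "s *s w1 + z \<noteq> 0" using two by (auto simp: B_zero)
    moreover have "Q (s *s w1 + z) = 0" using s w1 z by (simp add: Q_add Q_scale B_simps)
    ultimately show False using aniso[of "s *s w1 + z"] w1 z by (simp add: B_simps)
  qed
  then obtain t where t: "- Q z = d * t\<^sup>2" "t \<noteq> 0" using nonsquare_ratio[OF d] by metis
  define w2 where "w2 = (1 / t) *s z"
  have Qzt: "Q z = - d * t\<^sup>2" using arg_cong[OF t(1), of uminus] by simp
  have w2: "Q w2 = - d" "B a1 w2 = 0" "B a2 w2 = 0" "B b1 w2 = 0" "B b2 w2 = 0" "B w1 w2 = 0"
    using z t(2) by (simp_all add: w2_def Q_scale B_simps Qzt power_divide)
  have "elliptic_frame Q d a1 a2 b1 b2 w1 w2"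
    by unfold_locales (use d Qa a12 b1 b2 w1 w2 in auto)
  then show thesis using that l12 by blast
qed

section \<open>Coordinates in a frame\<close>

context elliptic_frame
begin

lemma d0: "d \<noteq> 0" using nonsquare[of 0] by auto

lemma B_frame': "B a2 a1 = 0" "B b2 b1 = 0" "B w2 w1 = 0"
  "B b1 a1 = 1" "B b2 a1 = 0" "B b1 a2 = 0" "B b2 a2 = 1"
  "B w1 a1 = 0" "B w2 a1 = 0" "B w1 a2 = 0" "B w2 a2 = 0"
  "B w1 b1 = 0" "B w2 b1 = 0" "B w1 b2 = 0" "B w2 b2 = 0"
  "B a1 a1 = 0" "B a2 a2 = 0" "B b1 b1 = 0" "B b2 b2 = 0" "B w1 w1 = 2" "B w2 w2 = - (2 * d)"
  using B_frame unfolding B_sym[of a2 a1] B_sym[of b2 b1] B_sym[of w2 w1] B_sym[of b1 a1] B_sym[of b2 a1]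
    B_sym[of b1 a2] B_sym[of b2 a2] B_sym[of w1 a1] B_sym[of w2 a1] B_sym[of w1 a2]
    B_sym[of w2 a2] B_sym[of w1 b1] B_sym[of w2 b1] B_sym[of w1 b2] B_sym[of w2 b2]
  by (simp_all add: B_self Q_frame)

lemmas gram = B_simps B_frame B_frame'

definition comb :: "'f \<Rightarrow> 'f \<Rightarrow> 'f \<Rightarrow> 'f \<Rightarrow> 'f \<Rightarrow> 'f \<Rightarrow> 'f ^ 6" where
  "comb p1 p2 r1 r2 x y = p1 *s a1 + (p2 *s a2 + (r1 *s b1 + (r2 *s b2 + (x *s w1 + y *s w2))))"

lemma B_comb: "B (comb p1 p2 r1 r2 x y) (comb p1' p2' r1' r2' x' y') =
    p1 * r1' + r1 * p1' + p2 * r2' + r2 * p2' + 2 * (x * x' - d * y * y')"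
  by (simp add: comb_def gram algebra_simps)

lemma Q_comb: "Q (comb p1 p2 r1 r2 x y) = p1 * r1 + p2 * r2 + qnorm d x y"
  by (simp add: comb_def gram Q_add Q_scale Q_frame qnorm_def algebra_simps)

lemma B_comb_frame:
  "B a1 (comb p1 p2 r1 r2 x y) = r1" "B a2 (comb p1 p2 r1 r2 x y) = r2"
  "B b1 (comb p1 p2 r1 r2 x y) = p1" "B b2 (comb p1 p2 r1 r2 x y) = p2"
  "B w1 (comb p1 p2 r1 r2 x y) = 2 * x" "B w2 (comb p1 p2 r1 r2 x y) = - (2 * d * y)"
  by (simp_all add: comb_def gram algebra_simps)

lemma comb_eq_iff:
  "comb p1 p2 r1 r2 x y = comb p1' p2' r1' r2' x' y' \<longleftrightarrow>
    p1 = p1' \<and> p2 = p2' \<and> r1 = r1' \<and> r2 = r2' \<and> x = x' \<and> y = y'"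
proof
  assume e: "comb p1 p2 r1 r2 x y = comb p1' p2' r1' r2' x' y'"
  have "B u (comb p1 p2 r1 r2 x y) = B u (comb p1' p2' r1' r2' x' y')" for u by (simp only: e)
  from this[of a1] this[of a2] this[of b1] this[of b2] this[of w1] this[of w2]
  show "p1 = p1' \<and> p2 = p2' \<and> r1 = r1' \<and> r2 = r2' \<and> x = x' \<and> y = y'"
    using two d0 by (simp add: B_comb_frame)
qed simp

lemma comb_add: "comb p1 p2 r1 r2 x y + comb p1' p2' r1' r2' x' y' =
    comb (p1 + p1') (p2 + p2') (r1 + r1') (r2 + r2') (x + x') (y + y')"
  by (simp add: comb_def vec.scale_left_distrib add_ac)

lemma comb_scale: "c *s comb p1 p2 r1 r2 x y = comb (c * p1) (c * p2) (c * r1) (c * r2) (c * x) (c * y)"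
  by (simp add: comb_def vec.scale_right_distrib)

text \<open>This shows that the frame spans the space. Adding to \<open>v\<close> a vector of the
  plane of \<open>w1\<close>, \<open>w2\<close> with norm \<open>- Q v\<close> gives a singular
  vector of the anisotropic complement, hence 0. Pairing it with \<open>v\<close> yields
  \<open>Q v = 0\<close>, and anisotropy applies once more to \<open>v\<close>.\<close>

lemma perp_frame_eq_0:
  assumes "B a1 v = 0" "B a2 v = 0" "B b1 v = 0" "B b2 v = 0" "B w1 v = 0" "B w2 v = 0"
  shows "v = 0"
proof (rule ccontr)
  assume "v \<noteq> 0"
  obtain x y where xy: "qnorm d x y = - Q v" using qnorm_surj[OF d0] by blast
  let ?z = "comb 0 0 0 0 x y + v"
  have "B v a1 = 0" "B v a2 = 0" "B v b1 = 0" "B v b2 = 0" "B v w1 = 0" "B v w2 = 0"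
    using assms by (simp_all only: B_sym)
  then have c: "B v (comb p1 p2 r1 r2 x y) = 0" "B (comb p1 p2 r1 r2 x y) v = 0" for p1 p2 r1 r2 x y
    unfolding comb_def using assms by (simp_all add: B_simps)
  have Qz: "Q ?z = 0" unfolding Q_add Q_comb xy c by simp
  have Bz: "B v ?z = 2 * Q v" by (simp only: B_right c B_self add_0)
  have aniso: "Q z \<noteq> 0" if "B a1 z = 0" "B a2 z = 0" "B b1 z = 0" "B b2 z = 0" "z \<noteq> 0" for z
    using hyperbolic_complement_anisotropic[of a1 a2 b1 b2 z] Q_frame B_frame that by simp
  have "?z = 0"
  proof (rule ccontr)
    assume "?z \<noteq> 0"
    moreover have "B a1 ?z = 0" "B a2 ?z = 0" "B b1 ?z = 0" "B b2 ?z = 0"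
      using assms by (simp_all add: B_right B_comb_frame)
    ultimately show False using aniso Qz by blast
  qed
  then have "2 * Q v = 0" using Bz by (simp only: B_zero)
  then show False using aniso[of v] assms \<open>v \<noteq> 0\<close> two by simp
qed

text \<open>The divisors are the values \<open>B w1 w1 = 2\<close> and
  \<open>B w2 w2 = - (2 * d)\<close>; the coefficient of a hyperbolic vector is read off with its
  partner.\<close>

lemma comb_expansion: "v = comb (B b1 v) (B b2 v) (B a1 v) (B a2 v) (B w1 v / 2) (- (B w2 v / (2 * d)))"
proof -
  have "v - comb (B b1 v) (B b2 v) (B a1 v) (B a2 v) (B w1 v / 2) (- (B w2 v / (2 * d))) = 0"
    by (rule perp_frame_eq_0) (use two d0 in \<open>simp_all add: B_diff B_comb_frame\<close>)
  then show ?thesis by simp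
qed

text \<open>The basis dual to \<open>a1, a2\<close> of the line with coordinates \<open>((x1, y1, x2, y2), a)\<close>: the coefficients
  of \<open>a1\<close> and \<open>a2\<close> are forced by total singularity, except that the two mixed ones may be shifted
  by \<open>\<plusminus>a\<close>.\<close>

fun m1 :: "'f quad \<times> 'f \<Rightarrow> 'f ^ 6" where
  "m1 ((x1, y1, x2, y2), a) = comb (- qnorm d x1 y1) (a - (x1 * x2 - d * y1 * y2)) 1 0 x1 y1"

fun m2 :: "'f quad \<times> 'f \<Rightarrow> 'f ^ 6" where
  "m2 ((x1, y1, x2, y2), a) = comb (- a - (x1 * x2 - d * y1 * y2)) (- qnorm d x2 y2) 0 1 x2 y2"

definition L :: "('f ^ 6) set" where "L = vec.span {a1, a2}"

definition M :: "'f quad \<times> 'f \<Rightarrow> ('f ^ 6) set" where "M p = vec.span {m1 p, m2 p}"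

lemma B_a_m: "B a1 (m1 p) = 1" "B a2 (m1 p) = 0" "B a1 (m2 p) = 0" "B a2 (m2 p) = 1"
  by (cases p rule: m1.cases; simp add: B_comb_frame)+

text \<open>The symmetric part of the matrix of the polar form between two dual bases; its antisymmetric
  part is given by the height.\<close>

fun g11 g12 g22 :: "'f quad \<Rightarrow> 'f" where
  "g11 (x1, y1, x2, y2) = - qnorm d x1 y1"
| "g12 (x1, y1, x2, y2) = - (x1 * x2 - d * y1 * y2)"
| "g22 (x1, y1, x2, y2) = - qnorm d x2 y2"

lemma Q_m: "Q (m1 p) = 0" "Q (m2 p) = 0"
  by (cases p rule: m1.cases; simp add: Q_comb)+

lemma B_m:
  "B (m1 p) (m1 q) = g11 (fst p - fst q)"
  "B (m1 p) (m2 q) = g12 (fst p - fst q) + height d p q"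
  "B (m2 p) (m1 q) = g12 (fst p - fst q) - height d p q"
  "B (m2 p) (m2 q) = g22 (fst p - fst q)"
proof -
  obtain x1 y1 x2 y2 a where p: "p = ((x1, y1, x2, y2), a)" by (cases p rule: m1.cases)
  obtain z1 t1 z2 t2 b where q: "q = ((z1, t1, z2, t2), b)" by (cases q rule: m1.cases)
  show "B (m1 p) (m1 q) = g11 (fst p - fst q)" "B (m2 p) (m2 q) = g22 (fst p - fst q)"
    by (simp_all add: p q B_comb qnorm_def power2_eq_square algebra_simps)
  show "B (m1 p) (m2 q) = g12 (fst p - fst q) + height d p q"
    "B (m2 p) (m1 q) = g12 (fst p - fst q) - height d p q"
    by (simp_all add: p q B_comb algebra_simps)
qed

lemma g_zero: "g11 0 = 0" "g12 0 = 0" "g22 0 = 0"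
  by (simp_all add: zero_prod_def qnorm_def)

lemma B_m_self: "B (m1 p) (m1 p) = 0" "B (m1 p) (m2 p) = 0" "B (m2 p) (m1 p) = 0" "B (m2 p) (m2 p) = 0"
  by (simp_all add: B_m g_zero)

text \<open>The determinant of the Gram matrix between two dual bases is thus the norm of
  \<open>h + dt u \<surd>d\<close>, which is 0 only if both parts are.\<close>

lemma g_det: "g11 u * g22 u - (g12 u + h) * (g12 u - h) = h\<^sup>2 - d * (dt u)\<^sup>2"
  by (cases u) (simp add: qnorm_def power2_eq_square algebra_simps)

lemma g_det_eq_0_iff: "g11 u * g22 u - (g12 u + h) * (g12 u - h) = 0 \<longleftrightarrow> h = 0 \<and> dt u = 0"
  unfolding g_det using qnorm_eq_0_iff[OF nonsquare, of h "dt u"] by (simp add: qnorm_def)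

end

lemma dim_span_2:
  fixes x y :: "'f::field ^ 'n"
  assumes "x \<noteq> 0" "y \<notin> vec.span {x}"
  shows "vec.dim (vec.span {x, y}) = 2"
proof -
  have "vec.independent {y, x}" using assms by (simp add: vec.independent_insert)
  moreover have "y \<noteq> x" using assms by (auto intro: vec.span_base)
  ultimately show ?thesis
    using vec.dim_span_eq_card_independent[of "{y, x}"] by (simp add: insert_commute)
qed

section \<open>The lines disjoint from \<open>l\<close>\<close>

context elliptic_frame
begin

lemma m_in_M: "m1 p \<in> M p" "m2 p \<in> M p"
  by (simp_all add: M_def vec.span_base)

lemma M_subspace: "vec.subspace (M p)" by (simp add: M_def)

lemma M_coords: "x \<in> M p \<Longrightarrow> x = B a1 x *s m1 p + B a2 x *s m2 p"
  unfolding M_def span_2 by (auto simp: B_simps B_a_m)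

lemma M_singular: "x \<in> M p \<Longrightarrow> Q x = 0"
  unfolding M_def span_2 by (auto simp: B_simps Q_add Q_scale Q_m B_m_self)

lemma B_M_M: "x \<in> M p \<Longrightarrow> y \<in> M p \<Longrightarrow> B x y = 0"
  unfolding M_def span_2 by (auto simp: B_simps B_m_self)

lemma M_line: "M p \<in> quadric_lines Q"
proof -
  have "m1 p \<noteq> 0" using B_a_m(1)[of p] by (auto simp: B_zero)
  moreover have "m2 p \<notin> vec.span {m1 p}"
  proof
    assume "m2 p \<in> vec.span {m1 p}"
    then obtain r where "m2 p = r *s m1 p" unfolding span_1 by blast
    then have "B a2 (m2 p) = 0" by (simp add: B_simps B_a_m)
    then show False by (simp add: B_a_m)
  qed
  ultimately have "vec.dim (M p) = 2" unfolding M_def by (rule dim_span_2)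
  then show ?thesis using M_singular M_subspace by (simp add: quadric_lines_def totally_singular_def)
qed

lemma L_iff: "x \<in> L \<longleftrightarrow> (\<exists>p r. x = p *s a1 + r *s a2)"
  unfolding L_def span_2 by blast

lemma L_M_disjoint: "L \<inter> M p = {0}"
proof -
  have "x = 0" if "x \<in> L" "x \<in> M p" for x
  proof -
    obtain r s where "x = r *s a1 + s *s a2" using \<open>x \<in> L\<close> unfolding L_iff by blast
    then have "B a1 x = 0" "B a2 x = 0" by (simp_all add: gram)
    then show ?thesis using M_coords[OF \<open>x \<in> M p\<close>] by simp
  qed
  moreover have "0 \<in> L" "0 \<in> M p" by (simp_all add: L_def M_def vec.span_zero)
  ultimately show ?thesis by blast
qed

lemma M_disjoint_lines: "M p \<in> disjoint_lines Q L"
  by (simp add: disjoint_lines_def M_line L_M_disjoint)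

lemma M_inj: "M p = M q \<Longrightarrow> p = q"
proof -
  assume e: "M p = M q"
  have "m1 p = m1 q" using M_coords[of "m1 p" q] m_in_M(1)[of p] by (simp add: e B_a_m)
  moreover have "m2 p = m2 q" using M_coords[of "m2 p" q] m_in_M(2)[of p] by (simp add: e B_a_m)
  ultimately show "p = q"
    by (cases p rule: m1.cases; cases q rule: m1.cases) (simp add: comb_eq_iff)
qed

lemma a2_notin: "a1 \<noteq> 0" "a2 \<notin> vec.span {a1}"
proof -
  show "a1 \<noteq> 0" using B_frame(4) by (auto simp: B_zero)
  show "a2 \<notin> vec.span {a1}"
  proof
    assume "a2 \<in> vec.span {a1}"
    then obtain r where "a2 = r *s a1" unfolding span_1 by blast
    then have "B b2 a2 = r * B b2 a1" by (simp add: B_simps)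
    then show False by (simp add: B_frame')
  qed
qed

text \<open>No totally singular plane contains \<open>l\<close>, so no nonzero vector of a line disjoint from \<open>l\<close> is
  orthogonal to \<open>l\<close>.\<close>

lemma disjoint_line_eq_0:
  assumes m: "m \<in> disjoint_lines Q L" and v: "v \<in> m" "B a1 v = 0" "B a2 v = 0"
  shows "v = 0"
proof (rule ccontr)
  assume "v \<noteq> 0"
  then have "v \<notin> L" using m v(1) unfolding disjoint_lines_def by blast
  moreover have "Q v = 0" using m v(1) by (simp add: disjoint_lines_def quadric_lines_def totally_singular_def)
  ultimately show False
    using no_singular_plane[of a1 a2 v] Q_frame B_frame a2_notin v(2,3) by (simp add: L_def)
qed

text \<open>On \<open>m\<close> the pairing with \<open>a1\<close> and \<open>a2\<close> is
  injective by \<open>disjoint_line_eq_0\<close>, hence surjective onto the coordinate pairs by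
  finiteness.\<close>

lemma disjoint_line_dual_basis:
  assumes m: "m \<in> disjoint_lines Q L"
  obtains n1 n2 where "n1 \<in> m" "n2 \<in> m" "B a1 n1 = 1" "B a2 n1 = 0" "B a1 n2 = 0" "B a2 n2 = 1"
proof -
  have sub: "vec.subspace m" and dim: "vec.dim m = 2"
    using m by (auto simp: disjoint_lines_def quadric_lines_def totally_singular_def)
  obtain c1 c2 where c: "c1 \<notin> vec.span {c2}" "c2 \<notin> vec.span {c1}" "m = vec.span {c1, c2}"
    using subspace_dim_2_basis[OF sub dim] by blast
  define v where "v p = fst p *s c1 + snd p *s c2" for p :: "'f \<times> 'f"
  have vm: "v p \<in> m" for p unfolding c(3) span_2 v_def by blast
  have vd: "v (p - q) = v p - v q" for p q
    by (simp add: v_def vec.scale_left_diff_distrib algebra_simps)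
  have v0: "p = 0" if "v p = 0" for p
  proof -
    have z: "fst p *s c1 + snd p *s c2 = 0" using that by (simp add: v_def)
    have "fst p = 0"
    proof (rule ccontr)
      assume n: "fst p \<noteq> 0"
      have "(1 / fst p) *s (fst p *s c1 + snd p *s c2) = 0" by (simp only: z vec.scale_zero_right)
      then have "c1 + (snd p / fst p) *s c2 = 0" using n by (simp add: vec.scale_right_distrib)
      then have "c1 = (- (snd p / fst p)) *s c2" by (simp add: eq_neg_iff_add_eq_0)
      then show False using c(1) unfolding span_1 by blast
    qed
    moreover have "c2 \<noteq> 0" using c(2) vec.span_zero by metis
    ultimately show ?thesis using z by (simp add: prod_eq_iff)
  qed
  let ?f = "\<lambda>p. (B a1 (v p), B a2 (v p))"
  have "inj ?f"
  proof (rule injI)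
    fix p q assume "?f p = ?f q"
    then have "B a1 (v (p - q)) = 0" "B a2 (v (p - q)) = 0" by (simp_all add: vd B_diff)
    then have "v (p - q) = 0" using disjoint_line_eq_0[OF m vm] by blast
    then show "p = q" using v0[of "p - q"] by simp
  qed
  then have "surj ?f" by (intro finite_UNIV_inj_surj) simp_all
  then obtain p q where "(1, 0) = ?f p" "(0, 1) = ?f q" by (meson surjD)
  then show thesis using that[of "v p" "v q"] vm by simp
qed

lemma M_surj:
  assumes m: "m \<in> disjoint_lines Q L"
  obtains p where "M p = m"
proof -
  have sub: "vec.subspace m" and Qm: "\<And>x. x \<in> m \<Longrightarrow> Q x = 0"
    using m by (auto simp: disjoint_lines_def quadric_lines_def totally_singular_def)
  obtain n1 n2 where n: "n1 \<in> m" "n2 \<in> m" "B a1 n1 = 1" "B a2 n1 = 0" "B a1 n2 = 0" "B a2 n2 = 1"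
    using disjoint_line_dual_basis[OF m] by blast
  have "Q (n1 + n2) = 0" using Qm vec.subspace_add[OF sub] n by blast
  then have Qn: "Q n1 = 0" "Q n2 = 0" "B n1 n2 = 0" using Qm n by (simp_all add: polar_form_def)
  obtain p11 p12 x1 y1 where n1: "n1 = comb p11 p12 1 0 x1 y1"
    using comb_expansion[of n1] n by metis
  obtain p21 p22 x2 y2 where n2: "n2 = comb p21 p22 0 1 x2 y2"
    using comb_expansion[of n2] n by metis
  have p11: "p11 = - qnorm d x1 y1" "p22 = - qnorm d x2 y2"
    using Qn(1,2) by (simp_all add: n1 n2 Q_comb eq_neg_iff_add_eq_0)
  have p12: "p21 + p12 + 2 * (x1 * x2 - d * y1 * y2) = 0"
    using Qn(3) by (simp add: n1 n2 B_comb)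
  \<comment> \<open>Orthogonality of \<open>n1\<close> and \<open>n2\<close> fixes only the sum of
    the mixed coefficients \<open>p12\<close> and \<open>p21\<close>; \<open>a\<close> is half their
    difference.\<close>
  define a where "a = p12 + (x1 * x2 - d * y1 * y2)"
  let ?p = "((x1, y1, x2, y2), a)"
  have "p21 = - a - (x1 * x2 - d * y1 * y2)"
    using p12 unfolding a_def by (simp add: algebra_simps eq_neg_iff_add_eq_0)
  then have e: "m1 ?p = n1" "m2 ?p = n2" by (simp_all add: n1 n2 p11 a_def)
  have "M ?p = m"
  proof
    show "M ?p \<subseteq> m" unfolding M_def e using n sub by (intro vec.span_minimal) auto
    show "m \<subseteq> M ?p"
    proof
      fix x assume x: "x \<in> m"
      let ?z = "x - (B a1 x *s n1 + B a2 x *s n2)"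
      have "?z \<in> m" using x n sub by (intro vec.subspace_diff vec.subspace_add vec.subspace_scale)
      moreover have "B a1 ?z = 0" "B a2 ?z = 0" using n by (simp_all add: B_simps)
      ultimately have "?z = 0" using disjoint_line_eq_0[OF m] by blast
      then have "x = B a1 x *s n1 + B a2 x *s n2" by simp
      then show "x \<in> M ?p" unfolding M_def e span_2 by blast
    qed
  qed
  then show thesis by (rule that)
qed

lemma M_bij: "bij_betw M UNIV (disjoint_lines Q L)"
proof (rule bij_betw_imageI)
  show "inj M" using M_inj by (rule injI)
  show "range M = disjoint_lines Q L" using M_disjoint_lines M_surj by blast
qed

section \<open>Intersection of two lines\<close>

lemma kernel_2x2:
  fixes A C D E :: 'f
  assumes "A * E - C * D = 0"
  obtains r s where "r * A + s * D = 0" "r * C + s * E = 0" "r \<noteq> 0 \<or> s \<noteq> 0"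
proof -
  consider "E \<noteq> 0 \<or> C \<noteq> 0" | "A \<noteq> 0 \<or> D \<noteq> 0" | "A = 0" "C = 0" "D = 0" "E = 0" by blast
  then show thesis
  proof cases
    case 1
    \<comment> \<open>The witnesses in this case and the next are the rows of the adjugate
      matrix.\<close>
    then show thesis using assms by (intro that[of E "- C"]) (auto simp: algebra_simps)
  next
    case 2
    then show thesis using assms by (intro that[of "- D" A]) (auto simp: algebra_simps)
  next
    case 3
    then show thesis by (intro that[of 1 0]) auto
  qed
qed

lemma injective_2x2:
  fixes A C D E :: 'f
  assumes "A * E - C * D \<noteq> 0" "r * A + s * D = 0" "r * C + s * E = 0"
  shows "r = 0" "s = 0"
proof -
  have "r * (A * E - C * D) = (r * A + s * D) * E - (r * C + s * E) * D"
    "s * (A * E - C * D) = (r * C + s * E) * A - (r * A + s * D) * C"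
    by (simp_all add: algebra_simps)
  then show "r = 0" "s = 0" using assms by simp_all
qed

text \<open>A kernel vector of the Gram matrix gives a nonzero vector of \<open>M p\<close>
  orthogonal to \<open>M q\<close>; outside \<open>M q\<close> it would extend that line to a
  totally singular plane. Conversely, a common vector is orthogonal to \<open>M q\<close>, so its
  coordinates lie in the kernel.\<close>

lemma M_Int_trivial_iff: "M p \<inter> M q = {0} \<longleftrightarrow> \<not> (height d p q = 0 \<and> dt (fst p - fst q) = 0)"
proof -
  let ?u = "fst p - fst q" and ?h = "height d p q"
  have B_comb_m: "B (r *s m1 p + s *s m2 p) (m1 q) = r * g11 ?u + s * (g12 ?u - ?h)"
    "B (r *s m1 p + s *s m2 p) (m2 q) = r * (g12 ?u + ?h) + s * g22 ?u" for r s
    by (simp_all only: B_left B_m)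
  have zero: "0 \<in> M p \<inter> M q" by (simp add: M_def vec.span_zero)
  show ?thesis
  proof (cases "g11 ?u * g22 ?u - (g12 ?u + ?h) * (g12 ?u - ?h) = 0")
    case True
    obtain r s where rs: "r * g11 ?u + s * (g12 ?u - ?h) = 0" "r * (g12 ?u + ?h) + s * g22 ?u = 0" "r \<noteq> 0 \<or> s \<noteq> 0"
      using kernel_2x2[OF True] by blast
    define v where "v = r *s m1 p + s *s m2 p"
    have vp: "v \<in> M p" unfolding M_def span_2 v_def by blast
    have "B a1 v = r" "B a2 v = s" by (simp_all add: v_def B_simps B_a_m)
    then have "v \<noteq> 0" using rs(3) by (auto simp: B_zero)
    have "B v (m1 q) = 0" "B v (m2 q) = 0" unfolding v_def B_comb_m by (fact rs)+
    then have vq: "B (m1 q) v = 0" "B (m2 q) v = 0" by (simp_all only: B_sym)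
    have "v \<in> M q"
    proof (rule ccontr)
      assume "v \<notin> M q"
      moreover have "m1 q \<noteq> 0" using B_a_m(1)[of q] by (auto simp: B_zero)
      moreover have "m2 q \<notin> vec.span {m1 q}"
      proof
        assume "m2 q \<in> vec.span {m1 q}"
        then obtain r where "m2 q = r *s m1 q" unfolding span_1 by blast
        then have "B a2 (m2 q) = 0" by (simp add: B_simps B_a_m)
        then show False by (simp add: B_a_m)
      qed
      ultimately show False
        using no_singular_plane[of "m1 q" "m2 q" v] Q_m M_singular[OF vp] B_m_self vq by (simp add: M_def)
    qed
    then have "M p \<inter> M q \<noteq> {0}" using vp \<open>v \<noteq> 0\<close> by blast
    then show ?thesis using True unfolding g_det_eq_0_iff by blast
  next
    case False
    have "v = 0" if v: "v \<in> M p" "v \<in> M q" for v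
    proof -
      have "B v (m1 q) = 0" "B v (m2 q) = 0" using B_M_M v m_in_M by blast+
      then have "B (B a1 v *s m1 p + B a2 v *s m2 p) (m1 q) = 0" "B (B a1 v *s m1 p + B a2 v *s m2 p) (m2 q) = 0"
        using M_coords[OF v(1)] by simp_all
      then have "B a1 v = 0" "B a2 v = 0" unfolding B_comb_m using injective_2x2[OF False] by blast+
      then show "v = 0" using M_coords[OF v(1)] by simp
    qed
    then have "M p \<inter> M q = {0}" using zero by blast
    then show ?thesis using False unfolding g_det_eq_0_iff by blast
  qed
qed

lemma dim_M_Int:
  assumes "p \<noteq> q"
  shows "vec.dim (M p \<inter> M q) = 1 \<longleftrightarrow> M p \<inter> M q \<noteq> {0}"
proof -
  let ?W = "M p \<inter> M q"
  have dM: "vec.dim (M r) = 2" for r using M_line by (simp add: quadric_lines_def)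
  have sub: "vec.subspace ?W" by (intro vec.subspace_inter M_subspace)
  have zero: "0 \<in> ?W" by (simp add: M_def vec.span_zero)
  have "vec.dim ?W \<le> 2" using vec.dim_subset[of ?W "M p"] dM by simp
  moreover have "vec.dim ?W \<noteq> 2"
  proof
    assume "vec.dim ?W = 2"
    then have "?W = M p" "?W = M q"
      using vec.subspace_dim_equal[OF sub M_subspace, of p] vec.subspace_dim_equal[OF sub M_subspace, of q] dM by auto
    then show False using assms M_inj by blast
  qed
  moreover have "vec.dim ?W = 0 \<longleftrightarrow> ?W = {0}" using zero by (auto simp: vec.dim_eq_0)
  ultimately show ?thesis by linarith
qed

lemma notin_span_if_B:
  assumes "\<And>x. x \<in> S \<Longrightarrow> B z x = 0" "B z v \<noteq> 0"
  shows "v \<notin> vec.span S"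
proof
  assume "v \<in> vec.span S"
  then have "B z v = 0"
    by (induction rule: vec.span_induct_alt) (simp_all add: B_simps assms(1))
  then show False using assms(2) by simp
qed

section \<open>The span of \<open>l\<close> and two further lines\<close>

abbreviation wvec :: "'f \<Rightarrow> 'f \<Rightarrow> 'f ^ 6" where "wvec x y \<equiv> comb 0 0 0 0 x y"

lemma comb_add_a: "comb p1 p2 r1 r2 x y + (e *s a1 + f *s a2) = comb (p1 + e) (p2 + f) r1 r2 x y"
  by (simp add: comb_def vec.scale_left_distrib add_ac)

text \<open>Modulo \<open>L\<close> the two dual bases differ by the vectors \<open>wvec\<close> of
  the rows of the difference, so these can replace the second line.\<close>

lemma span_lines_eq:
  assumes u: "fst p - fst q = (x1, y1, x2, y2)"
  shows "vec.span (L \<union> M p \<union> M q) = vec.span {m1 p, m2 p, wvec x2 y2, wvec x1 y1, a2, a1}" (is "_ = vec.span ?S")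
proof -
  obtain e1 f1 where e1: "m1 p = m1 q + (wvec x1 y1 + (e1 *s a1 + f1 *s a2))"
  proof -
    obtain X1 Y1 X2 Y2 a Z1 T1 Z2 T2 b where pq: "p = ((X1, Y1, X2, Y2), a)" "q = ((Z1, T1, Z2, T2), b)"
      by (cases p rule: m1.cases; cases q rule: m1.cases) blast
    have "X1 = Z1 + x1" "Y1 = T1 + y1" using u by (auto simp: pq)
    then show thesis
      by (intro that[of "- qnorm d X1 Y1 + qnorm d Z1 T1" "a - (X1 * X2 - d * Y1 * Y2) - (b - (Z1 * Z2 - d * T1 * T2))"])
        (simp only: pq m1.simps m2.simps comb_add_a comb_add comb_eq_iff, simp)
  qed
  obtain e2 f2 where e2: "m2 p = m2 q + (wvec x2 y2 + (e2 *s a1 + f2 *s a2))"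
  proof -
    obtain X1 Y1 X2 Y2 a Z1 T1 Z2 T2 b where pq: "p = ((X1, Y1, X2, Y2), a)" "q = ((Z1, T1, Z2, T2), b)"
      by (cases p rule: m1.cases; cases q rule: m1.cases) blast
    have "X2 = Z2 + x2" "Y2 = T2 + y2" using u by (auto simp: pq)
    then show thesis
      by (intro that[of "- a - (X1 * X2 - d * Y1 * Y2) - (- b - (Z1 * Z2 - d * T1 * T2))" "- qnorm d X2 Y2 + qnorm d Z2 T2"])
        (simp only: pq m1.simps m2.simps comb_add_a comb_add comb_eq_iff, simp)
  qed
  let ?T = "L \<union> M p \<union> M q"
  have S: "m1 p \<in> vec.span ?S" "m2 p \<in> vec.span ?S" "wvec x1 y1 \<in> vec.span ?S" "wvec x2 y2 \<in> vec.span ?S"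
    "a1 \<in> vec.span ?S" "a2 \<in> vec.span ?S" by (simp_all add: vec.span_base)
  have "m1 q = m1 p - (wvec x1 y1 + (e1 *s a1 + f1 *s a2))" "m2 q = m2 p - (wvec x2 y2 + (e2 *s a1 + f2 *s a2))"
    by (simp_all add: e1 e2)
  then have S': "m1 q \<in> vec.span ?S" "m2 q \<in> vec.span ?S"
    using S by (auto intro!: vec.span_diff vec.span_add vec.span_scale)
  have "L \<subseteq> vec.span ?S" "M p \<subseteq> vec.span ?S" "M q \<subseteq> vec.span ?S"
    unfolding L_def M_def by (rule vec.span_minimal; use S S' in simp)+
  then have 1: "vec.span ?T \<subseteq> vec.span ?S" by (intro vec.span_minimal) auto
  have "a1 \<in> L" "a2 \<in> L" by (simp_all add: L_def vec.span_base)
  then have T: "m1 p \<in> vec.span ?T" "m2 p \<in> vec.span ?T" "m1 q \<in> vec.span ?T" "m2 q \<in> vec.span ?T"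
    "a1 \<in> vec.span ?T" "a2 \<in> vec.span ?T"
    using m_in_M[of p] m_in_M[of q] vec.span_superset[of ?T] by blast+
  have "wvec x1 y1 = m1 p - m1 q - (e1 *s a1 + f1 *s a2)" "wvec x2 y2 = m2 p - m2 q - (e2 *s a1 + f2 *s a2)"
    by (simp_all add: e1 e2)
  then have "wvec x1 y1 \<in> vec.span ?T" "wvec x2 y2 \<in> vec.span ?T"
    using T by (auto intro!: vec.span_diff vec.span_add vec.span_scale)
  then have "vec.span ?S \<subseteq> vec.span ?T" using T by (intro vec.span_minimal) auto
  then show ?thesis using 1 by blast
qed

lemma wvec_eq_0_iff: "wvec x y = 0 \<longleftrightarrow> x = 0 \<and> y = 0"
proof -
  have "comb 0 0 0 0 0 0 = 0" by (simp add: comb_def)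
  then show ?thesis using comb_eq_iff[of 0 0 0 0 x y 0 0 0 0 0 0] by simp
qed

lemma dim_wvec:
  "vec.dim {wvec x2 y2, wvec x1 y1, a2, a1} = 2 + rk (x1, y1, x2, y2)"
proof -
  have B_w_a: "B (wvec x y) a1 = 0" "B (wvec x y) a2 = 0" for x y
    using B_comb_frame(1,2)[of 0 0 0 0 x y] by (simp_all only: B_sym)
  have B_w_w: "B (wvec x y) (wvec x' y') = 2 * (x * x' - d * y * y')" for x y x' y'
    by (simp add: B_comb)
  have nw: "wvec x y \<notin> vec.span {a2, a1}" if "wvec x y \<noteq> 0" for x y
  proof (rule notin_span_if_B[where z = "wvec x y"])
    have "qnorm d x y \<noteq> 0" using qnorm_eq_0_iff[OF nonsquare] that wvec_eq_0_iff by blast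
    then show "B (wvec x y) (wvec x y) \<noteq> 0" using two by (simp add: B_w_w qnorm_def power2_eq_square mult.assoc)
  qed (auto simp: B_w_a)
  have dim_a: "vec.dim {a2, a1} = 2" using a2_notin by (simp add: vec.dim_insert)
  consider "(x1, y1, x2, y2) = 0" | "(x1, y1, x2, y2) \<noteq> 0" "x1 * y2 - x2 * y1 = 0" | "x1 * y2 - x2 * y1 \<noteq> 0" by blast
  then show ?thesis
  proof cases
    case 1
    then have "wvec x1 y1 = 0" "wvec x2 y2 = 0" by (simp_all add: wvec_eq_0_iff zero_prod_def)
    then show ?thesis using dim_a 1 by (simp add: vec.dim_insert vec.span_zero rk_def)
  next
    case 2
    show ?thesis
    proof (cases "wvec x1 y1 = 0")
      case True
      then have "wvec x2 y2 \<noteq> 0" using 2 by (auto simp: wvec_eq_0_iff zero_prod_def)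
      moreover have "vec.span {0, a2, a1} = vec.span {a2, a1}" by simp
      ultimately show ?thesis using dim_a 2 nw[of x2 y2] by (simp add: True vec.dim_insert vec.span_zero rk_def)
    next
      case False
      define t where "t = (if x1 = 0 then y2 / y1 else x2 / x1)"
      have "x1 * y2 = x2 * y1" "x1 \<noteq> 0 \<or> y1 \<noteq> 0" using 2(2) False by (simp_all add: wvec_eq_0_iff)
      then have "x2 = t * x1" "y2 = t * y1" by (auto simp: t_def field_simps)
      then have "wvec x2 y2 = t *s wvec x1 y1" by (simp add: comb_scale)
      then have "wvec x2 y2 \<in> vec.span {wvec x1 y1, a2, a1}"
        by (simp add: vec.span_scale vec.span_base)
      then show ?thesis using dim_a 2 nw[OF False] by (simp add: vec.dim_insert rk_def)
    qed
  next
    case 3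
    then have n1: "wvec x1 y1 \<noteq> 0" by (auto simp: wvec_eq_0_iff)
    have "wvec x2 y2 \<notin> vec.span {wvec x1 y1, a2, a1}"
    \<comment> \<open>The witness is \<open>x1 + y1\<surd>d\<close> multiplied by
      \<open>\<surd>d\<close>: it is orthogonal to \<open>wvec x1 y1\<close> and pairs with
      \<open>wvec x2 y2\<close> to a nonzero multiple of the determinant.\<close>
    proof (rule notin_span_if_B[where z = "wvec (d * y1) x1"])
      have "B (wvec (d * y1) x1) (wvec x2 y2) = - (2 * d * (x1 * y2 - x2 * y1))"
        by (simp add: B_w_w algebra_simps)
      then show "B (wvec (d * y1) x1) (wvec x2 y2) \<noteq> 0" using two d0 3 by simp
    qed (auto simp: B_w_a B_w_w)
    then show ?thesis using dim_a 3 nw[OF n1] by (auto simp: vec.dim_insert rk_def zero_prod_def)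
  qed
qed

text \<open>Pairing with \<open>a2\<close> separates \<open>m2 p\<close>, and pairing with
  \<open>a1\<close> separates \<open>m1 p\<close>, from the spanning vectors that follow
  them.\<close>

lemma dim_lines: "vec.dim (L \<union> M p \<union> M q) = 4 + rk (fst p - fst q)"
proof -
  obtain x1 y1 x2 y2 where u: "fst p - fst q = (x1, y1, x2, y2)" by (metis prod_cases4)
  let ?S = "{wvec x2 y2, wvec x1 y1, a2, a1}"
  have Ba: "B a1 (wvec x y) = 0" "B a2 (wvec x y) = 0" for x y by (simp_all add: B_comb_frame)
  have "m2 p \<notin> vec.span ?S"
    by (rule notin_span_if_B[where z = a2]) (auto simp: Ba gram B_a_m)
  moreover have "m1 p \<notin> vec.span (insert (m2 p) ?S)"
    by (rule notin_span_if_B[where z = a1]) (auto simp: Ba gram B_a_m)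
  ultimately have "vec.dim {m1 p, m2 p, wvec x2 y2, wvec x1 y1, a2, a1} = 4 + rk (x1, y1, x2, y2)"
    using dim_wvec[of x2 y2 x1 y1] by (simp add: vec.dim_insert[of "m1 p"] vec.dim_insert[of "m2 p"])
  then show ?thesis
    unfolding u using span_lines_eq[OF u] vec.dim_span[of "L \<union> M p \<union> M q"] by (metis vec.dim_span)
qed

lemma span_lines_UNIV_iff: "vec.span (L \<union> M p \<union> M q) = UNIV \<longleftrightarrow> rk (fst p - fst q) = 2"
proof -
  have "vec.span (L \<union> M p \<union> M q) = UNIV \<longleftrightarrow> vec.dim (L \<union> M p \<union> M q) = CARD(6)"
    using vec.dim_eq_full[of "L \<union> M p \<union> M q"] vec_dim_card[where 'a='f and 'n=6]
    by (metis vec.dim_UNIV vec.dimension_def)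
  then show ?thesis unfolding dim_lines by simp
qed

section \<open>Perspectivity\<close>

lemma polar_perp_subspace: "vec.subspace (polar_perp Q U)"
  by (auto simp: polar_perp_def B_simps intro!: vec.subspaceI)

lemma mem_polar_perp_span_2: "v \<in> polar_perp Q (vec.span {x, y}) \<longleftrightarrow> B x v = 0 \<and> B y v = 0"
proof
  assume "v \<in> polar_perp Q (vec.span {x, y})"
  then show "B x v = 0 \<and> B y v = 0" by (simp add: polar_perp_def vec.span_base)
next
  assume "B x v = 0 \<and> B y v = 0"
  then show "v \<in> polar_perp Q (vec.span {x, y})" unfolding polar_perp_def span_2 by (auto simp: B_simps)
qed

lemma bex_span_2: "(\<exists>t\<in>vec.span {x, y}. P t) \<longleftrightarrow> (\<exists>r s. P (r *s x + s *s y))" for x :: "'f ^ 6"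
  unfolding span_2 by blast

lemma mem_span_Un_subspaces:
  fixes S :: "('f ^ 6) set"
  assumes "vec.subspace S" "vec.subspace T"
  shows "v \<in> vec.span (S \<union> T) \<longleftrightarrow> (\<exists>t\<in>T. v - t \<in> S)"
proof -
  have "vec.span (S \<union> T) = {x + y | x y. x \<in> S \<and> y \<in> T}"
    using assms by (simp add: vec.span_Un vec.span_eq_iff[THEN iffD2])
  moreover have "(\<exists>x y. v = x + y \<and> x \<in> S \<and> y \<in> T) \<longleftrightarrow> (\<exists>t\<in>T. v - t \<in> S)"
    by (metis add_diff_cancel_right' diff_add_cancel)
  ultimately show ?thesis by blast
qed

text \<open>\<open>L\<close> is dual to both lines, so the component of \<open>v\<close> in
  \<open>L\<close> can be read off by pairing with either dual basis. Membership says that the two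
  readings agree.\<close>

lemma mem_Sigma_1:
  "v \<in> vec.span (polar_perp Q (M p) \<inter> polar_perp Q (M q) \<union> L) \<longleftrightarrow>
    B (m1 p) v = B (m1 q) v \<and> B (m2 p) v = B (m2 q) v"
proof -
  have Ba: "B (m1 p) (r *s a1 + s *s a2) = r" "B (m2 p) (r *s a1 + s *s a2) = s" for p r s
  proof -
    have "B (m1 p) a1 = 1" "B (m1 p) a2 = 0" "B (m2 p) a1 = 0" "B (m2 p) a2 = 1"
      using B_a_m[of p] by (simp_all only: B_sym)
    then show "B (m1 p) (r *s a1 + s *s a2) = r" "B (m2 p) (r *s a1 + s *s a2) = s" by (simp_all add: B_simps)
  qed
  have "v \<in> vec.span (polar_perp Q (M p) \<inter> polar_perp Q (M q) \<union> L) \<longleftrightarrow>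
      (\<exists>t\<in>L. v - t \<in> polar_perp Q (M p) \<inter> polar_perp Q (M q))"
    by (intro mem_span_Un_subspaces vec.subspace_inter polar_perp_subspace) (simp add: L_def)
  also have "\<dots> \<longleftrightarrow> (\<exists>r s. B (m1 p) v = r \<and> B (m2 p) v = s \<and> B (m1 q) v = r \<and> B (m2 q) v = s)"
    unfolding L_def bex_span_2 M_def Int_iff mem_polar_perp_span_2 B_diff Ba by auto
  finally show ?thesis by auto
qed

text \<open>Here pairing with \<open>a1\<close>, \<open>a2\<close> fixes the component of
  \<open>v\<close> in \<open>M p\<close>, and orthogonality of the rest to \<open>M q\<close> gives
  the two equations. With \<open>p\<close> and \<open>q\<close> exchanged this also describes the
  third subspace.\<close>

lemma mem_Sigma_2:
  "v \<in> vec.span (polar_perp Q L \<inter> polar_perp Q (M q) \<union> M p) \<longleftrightarrow>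
    B (m1 q) v = B a1 v * B (m1 q) (m1 p) + B a2 v * B (m1 q) (m2 p) \<and>
    B (m2 q) v = B a1 v * B (m2 q) (m1 p) + B a2 v * B (m2 q) (m2 p)"
proof -
  have "v \<in> vec.span (polar_perp Q L \<inter> polar_perp Q (M q) \<union> M p) \<longleftrightarrow>
      (\<exists>t\<in>M p. v - t \<in> polar_perp Q L \<inter> polar_perp Q (M q))"
    by (intro mem_span_Un_subspaces vec.subspace_inter polar_perp_subspace M_subspace)
  also have "\<dots> \<longleftrightarrow> (\<exists>r s. B a1 v = r \<and> B a2 v = s \<and> B (m1 q) v = r * B (m1 q) (m1 p) + s * B (m1 q) (m2 p) \<and>
    B (m2 q) v = r * B (m2 q) (m1 p) + s * B (m2 q) (m2 p))"
    unfolding L_def bex_span_2 M_def Int_iff mem_polar_perp_span_2 B_diff B_right B_a_m by auto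
  finally show ?thesis by auto
qed

lemma dim_span_2_dual:
  assumes "B a1 x = r" "B a2 x = 0" "B a1 y = 0" "B a2 y = r" "r \<noteq> 0"
  shows "vec.dim (vec.span {x, y}) = 2"
proof (rule dim_span_2)
  show "x \<noteq> 0" using assms by (auto simp: B_zero)
  show "y \<notin> vec.span {x}"
    by (rule notin_span_if_B[where z = a2]) (use assms in auto)
qed

text \<open>Write \<open>v = \<Sum> \<alpha>\<^sub>i a\<^sub>i + \<beta>\<^sub>i m\<^sub>i + \<gamma>\<^sub>i n\<^sub>i\<close> and let \<open>G\<close> be the matrix of the values \<open>B(m\<^sub>i, n\<^sub>j)\<close>.  The
  conditions for \<open>v\<close> to lie in the second and third of the three subspaces are \<open>\<alpha> = G\<^sup>T \<gamma>\<close> and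
  \<open>\<alpha> = G \<beta>\<close>, and the first one is \<open>G \<gamma> = G\<^sup>T \<beta>\<close>.\<close>

lemma in_perspective_iff:
  assumes rk: "rk (fst p - fst q) = 2"
  shows "in_perspective Q L (M p) (M q) \<longleftrightarrow> height d p q = 0"
proof -
  let ?u = "fst p - fst q" and ?h = "height d p q"
  define A C D E where "A = g11 ?u" and "C = g12 ?u + ?h" and "D = g12 ?u - ?h" and "E = g22 ?u"
  have Bpq: "B (m1 p) (m1 q) = A" "B (m1 p) (m2 q) = C" "B (m2 p) (m1 q) = D" "B (m2 p) (m2 q) = E"
    by (simp_all add: B_m A_def C_def D_def E_def)
  then have Bqp: "B (m1 q) (m1 p) = A" "B (m2 q) (m1 p) = C" "B (m1 q) (m2 p) = D" "B (m2 q) (m2 p) = E"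
    by (simp_all only: B_sym)
  have Bma: "B (m1 r) a1 = 1" "B (m1 r) a2 = 0" "B (m2 r) a1 = 0" "B (m2 r) a2 = 1" for r
    using B_a_m[of r] by (simp_all only: B_sym)
  define V where "V \<alpha>1 \<alpha>2 \<beta>1 \<beta>2 \<gamma>1 \<gamma>2 = \<alpha>1 *s a1 + (\<alpha>2 *s a2 + (\<beta>1 *s m1 p + (\<beta>2 *s m2 p + (\<gamma>1 *s m1 q + \<gamma>2 *s m2 q))))"
    for \<alpha>1 \<alpha>2 \<beta>1 \<beta>2 \<gamma>1 \<gamma>2
  have BV: "B a1 (V \<alpha>1 \<alpha>2 \<beta>1 \<beta>2 \<gamma>1 \<gamma>2) = \<beta>1 + \<gamma>1" "B a2 (V \<alpha>1 \<alpha>2 \<beta>1 \<beta>2 \<gamma>1 \<gamma>2) = \<beta>2 + \<gamma>2"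
    "B (m1 p) (V \<alpha>1 \<alpha>2 \<beta>1 \<beta>2 \<gamma>1 \<gamma>2) = \<alpha>1 + (\<gamma>1 * A + \<gamma>2 * C)"
    "B (m2 p) (V \<alpha>1 \<alpha>2 \<beta>1 \<beta>2 \<gamma>1 \<gamma>2) = \<alpha>2 + (\<gamma>1 * D + \<gamma>2 * E)"
    "B (m1 q) (V \<alpha>1 \<alpha>2 \<beta>1 \<beta>2 \<gamma>1 \<gamma>2) = \<alpha>1 + (\<beta>1 * A + \<beta>2 * D)"
    "B (m2 q) (V \<alpha>1 \<alpha>2 \<beta>1 \<beta>2 \<gamma>1 \<gamma>2) = \<alpha>2 + (\<beta>1 * C + \<beta>2 * E)"
    for \<alpha>1 \<alpha>2 \<beta>1 \<beta>2 \<gamma>1 \<gamma>2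
    by (simp_all add: V_def B_right Bpq Bqp Bma B_a_m B_m_self B_frame B_frame')
  define S1 S2 S3 where "S1 = vec.span (polar_perp Q (M p) \<inter> polar_perp Q (M q) \<union> L)"
    and "S2 = vec.span (polar_perp Q L \<inter> polar_perp Q (M q) \<union> M p)"
    and "S3 = vec.span (polar_perp Q L \<inter> polar_perp Q (M p) \<union> M q)"
  have S1: "V \<alpha>1 \<alpha>2 \<beta>1 \<beta>2 \<gamma>1 \<gamma>2 \<in> S1 \<longleftrightarrow>
      \<gamma>1 * A + \<gamma>2 * C = \<beta>1 * A + \<beta>2 * D \<and> \<gamma>1 * D + \<gamma>2 * E = \<beta>1 * C + \<beta>2 * E" for \<alpha>1 \<alpha>2 \<beta>1 \<beta>2 \<gamma>1 \<gamma>2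
    unfolding S1_def mem_Sigma_1 BV by simp
  have S2: "V \<alpha>1 \<alpha>2 \<beta>1 \<beta>2 \<gamma>1 \<gamma>2 \<in> S2 \<longleftrightarrow> \<alpha>1 = \<gamma>1 * A + \<gamma>2 * D \<and> \<alpha>2 = \<gamma>1 * C + \<gamma>2 * E" for \<alpha>1 \<alpha>2 \<beta>1 \<beta>2 \<gamma>1 \<gamma>2
    unfolding S2_def mem_Sigma_2 BV Bqp by (simp add: distrib_right algebra_simps)
  have S3: "V \<alpha>1 \<alpha>2 \<beta>1 \<beta>2 \<gamma>1 \<gamma>2 \<in> S3 \<longleftrightarrow> \<alpha>1 = \<beta>1 * A + \<beta>2 * C \<and> \<alpha>2 = \<beta>1 * D + \<beta>2 * E" for \<alpha>1 \<alpha>2 \<beta>1 \<beta>2 \<gamma>1 \<gamma>2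
    unfolding S3_def mem_Sigma_2 BV Bpq by (simp add: distrib_right algebra_simps)
  have rep: "\<exists>\<alpha>1 \<alpha>2 \<beta>1 \<beta>2 \<gamma>1 \<gamma>2. v = V \<alpha>1 \<alpha>2 \<beta>1 \<beta>2 \<gamma>1 \<gamma>2" for v
  proof -
    have LM: "vec.span (L \<union> M p) = {x + y | x y. x \<in> L \<and> y \<in> M p}"
    proof -
      have "vec.span L = L" "vec.span (M p) = M p" by (simp_all add: L_def M_def)
      then show ?thesis by (simp only: vec.span_Un)
    qed
    have "v \<in> vec.span ((L \<union> M p) \<union> M q)" using span_lines_UNIV_iff[of p q] rk by simp
    then obtain x y where xy: "x \<in> vec.span (L \<union> M p)" "y \<in> vec.span (M q)" "v = x + y"
      unfolding vec.span_Un[of "L \<union> M p"] by blast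
    from xy(1) obtain x1 x2 where x: "x1 \<in> L" "x2 \<in> M p" "x = x1 + x2" unfolding LM by blast
    have "y \<in> M q" using xy(2) by (simp only: M_def vec.span_span)
    then obtain \<gamma>1 \<gamma>2 where "y = \<gamma>1 *s m1 q + \<gamma>2 *s m2 q" unfolding M_def span_2 by blast
    moreover obtain \<beta>1 \<beta>2 where "x2 = \<beta>1 *s m1 p + \<beta>2 *s m2 p" using x(2) unfolding M_def span_2 by blast
    moreover obtain \<alpha>1 \<alpha>2 where "x1 = \<alpha>1 *s a1 + \<alpha>2 *s a2" using x(1) unfolding L_iff by blast
    ultimately have "v = V \<alpha>1 \<alpha>2 \<beta>1 \<beta>2 \<gamma>1 \<gamma>2" unfolding V_def xy(3) x(3) by (simp only: add.assoc)
    then show ?thesis by blast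
  qed
  have dt: "dt ?u \<noteq> 0" using rk by (auto simp: rk_def split: if_splits)
  define G where "G = A * E - C * D"
  have G: "G \<noteq> 0" using g_det_eq_0_iff[of ?u ?h] dt unfolding G_def A_def C_def D_def E_def by blast
  \<comment> \<open>The second row of a matrix of rank 2 is nonzero, and \<open>E\<close> is minus
    its norm.\<close>
  have E: "E \<noteq> 0"
  proof -
    obtain x1 y1 x2 y2 where u: "?u = (x1, y1, x2, y2)" by (metis prod_cases4)
    then show ?thesis using dt qnorm_eq_0_iff[OF nonsquare, of x2 y2] by (auto simp: E_def)
  qed
  define W where "W = S1 \<inter> S2 \<inter> S3"
  have persp: "in_perspective Q L (M p) (M q) \<longleftrightarrow> vec.dim W = 2"
    by (simp add: in_perspective_def Let_def W_def S1_def S2_def S3_def)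
  have subW: "vec.subspace W"
    unfolding W_def S1_def S2_def S3_def by (intro vec.subspace_inter vec.subspace_span)
  \<comment> \<open>In the code \<open>G\<close> is the determinant of the matrix. Its being nonzero
    lets \<alpha> determine \<beta> and \<gamma> through the adjugate; the two generators are the
    solutions with \<alpha> equal to \<open>(G, 0)\<close> and \<open>(0, G)\<close>.\<close>
  have W_rep: "v \<in> vec.span {V G 0 E (- D) E (- C), V 0 G (- C) A (- D) A}" if v: "v \<in> S2" "v \<in> S3" for v
  proof -
    obtain \<alpha>1 \<alpha>2 \<beta>1 \<beta>2 \<gamma>1 \<gamma>2 where veq: "v = V \<alpha>1 \<alpha>2 \<beta>1 \<beta>2 \<gamma>1 \<gamma>2" using rep by blast
    have e: "\<alpha>1 = \<gamma>1 * A + \<gamma>2 * D" "\<alpha>2 = \<gamma>1 * C + \<gamma>2 * E" "\<alpha>1 = \<beta>1 * A + \<beta>2 * C" "\<alpha>2 = \<beta>1 * D + \<beta>2 * E"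
      using v unfolding veq S2 S3 by auto
    have "\<alpha>1 * E - \<alpha>2 * C = G * \<beta>1" "\<alpha>2 * A - \<alpha>1 * D = G * \<beta>2"
      unfolding e(3,4) by (simp_all add: G_def algebra_simps)
    moreover have "\<alpha>1 * E - \<alpha>2 * D = G * \<gamma>1" "\<alpha>2 * A - \<alpha>1 * C = G * \<gamma>2"
      unfolding e(1,2) by (simp_all add: G_def algebra_simps)
    ultimately have b: "\<beta>1 = (\<alpha>1 * E - \<alpha>2 * C) / G" "\<beta>2 = (\<alpha>2 * A - \<alpha>1 * D) / G"
      "\<gamma>1 = (\<alpha>1 * E - \<alpha>2 * D) / G" "\<gamma>2 = (\<alpha>2 * A - \<alpha>1 * C) / G" using G by simp_all
    have VV: "r *s V \<alpha>1 \<alpha>2 \<beta>1 \<beta>2 \<gamma>1 \<gamma>2 + s *s V \<alpha>1' \<alpha>2' \<beta>1' \<beta>2' \<gamma>1' \<gamma>2' =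
      V (r * \<alpha>1 + s * \<alpha>1') (r * \<alpha>2 + s * \<alpha>2') (r * \<beta>1 + s * \<beta>1') (r * \<beta>2 + s * \<beta>2')
        (r * \<gamma>1 + s * \<gamma>1') (r * \<gamma>2 + s * \<gamma>2')"
      for r s \<alpha>1 \<alpha>2 \<beta>1 \<beta>2 \<gamma>1 \<gamma>2 \<alpha>1' \<alpha>2' \<beta>1' \<beta>2' \<gamma>1' \<gamma>2'
      by (simp add: V_def vec.scale_left_distrib vec.scale_right_distrib add_ac)
    have "v = (\<alpha>1 / G) *s V G 0 E (- D) E (- C) + (\<alpha>2 / G) *s V 0 G (- C) A (- D) A"
    proof -
      have "\<alpha>1 / G * G + \<alpha>2 / G * 0 = \<alpha>1" "\<alpha>1 / G * 0 + \<alpha>2 / G * G = \<alpha>2"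
        "\<alpha>1 / G * E + \<alpha>2 / G * (- C) = \<beta>1" "\<alpha>1 / G * (- D) + \<alpha>2 / G * A = \<beta>2"
        "\<alpha>1 / G * E + \<alpha>2 / G * (- D) = \<gamma>1" "\<alpha>1 / G * (- C) + \<alpha>2 / G * A = \<gamma>2"
        unfolding b using G by (simp_all add: diff_divide_distrib)
      then show ?thesis unfolding VV veq by (simp only:)
    qed
    then show ?thesis unfolding span_2 by blast
  qed
  show ?thesis
  proof (cases "?h = 0")
    case True
    then have CD: "C = D" by (simp add: C_def D_def)
    \<comment> \<open>When the matrix is symmetric the conditions collapse to \<beta> = \<gamma>,
      with \<alpha> the image of \<beta>; the generators take the unit vectors for \<beta>.\<close>
    let ?t1 = "V A C 1 0 1 0" and ?t2 = "V D E 0 1 0 1"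
    have "W = vec.span {?t1, ?t2}"
    proof
      have "?t1 \<in> W" "?t2 \<in> W" unfolding W_def Int_iff S1 S2 S3 by (simp_all add: CD)
      then show "vec.span {?t1, ?t2} \<subseteq> W" using subW by (intro vec.span_minimal) auto
      show "W \<subseteq> vec.span {?t1, ?t2}"
      proof
        fix v assume v: "v \<in> W"
        obtain \<alpha>1 \<alpha>2 \<beta>1 \<beta>2 \<gamma>1 \<gamma>2 where veq: "v = V \<alpha>1 \<alpha>2 \<beta>1 \<beta>2 \<gamma>1 \<gamma>2" using rep by blast
        have e: "\<alpha>1 = \<gamma>1 * A + \<gamma>2 * D" "\<alpha>2 = \<gamma>1 * C + \<gamma>2 * E" "\<alpha>1 = \<beta>1 * A + \<beta>2 * C" "\<alpha>2 = \<beta>1 * D + \<beta>2 * E"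
          using v unfolding W_def Int_iff veq S2 S3 by auto
        have "\<beta>1 * A + \<beta>2 * C = \<gamma>1 * A + \<gamma>2 * D" "\<beta>1 * D + \<beta>2 * E = \<gamma>1 * C + \<gamma>2 * E"
          using e by auto
        then have "(\<beta>1 - \<gamma>1) * A + (\<beta>2 - \<gamma>2) * D = 0" "(\<beta>1 - \<gamma>1) * C + (\<beta>2 - \<gamma>2) * E = 0"
          by (simp_all add: CD left_diff_distrib add_diff_eq diff_add_eq)
        from injective_2x2[OF G[unfolded G_def] this] have bg: "\<gamma>1 = \<beta>1" "\<gamma>2 = \<beta>2" by simp_all
        have "v = \<beta>1 *s ?t1 + \<beta>2 *s ?t2"
          unfolding veq e(3,4) bg V_def CD by (simp add: vec.scale_left_distrib vec.scale_right_distrib add_ac)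
        then show "v \<in> vec.span {?t1, ?t2}" unfolding span_2 by blast
      qed
    qed
    moreover have "vec.dim (vec.span {?t1, ?t2}) = 2"
      by (rule dim_span_2_dual[where r = 2]) (simp_all add: BV two)
    ultimately show ?thesis using persp True by simp
  next
    case False
    \<comment> \<open>The second and third subspaces meet in dimension at most 2, so
      \<open>vec.dim W = 2\<close> would put the first generator into \<open>S1\<close>. That
      membership amounts to \<open>2 * (E * (D - C)) = 0\<close>, contradicting the nonzero
      height.\<close>
    have "vec.dim W \<noteq> 2"
    proof
      assume dW: "vec.dim W = 2"
      let ?X = "{V G 0 E (- D) E (- C), V 0 G (- C) A (- D) A}"
      have "W \<subseteq> vec.span ?X" using W_rep by (auto simp: W_def)
      moreover have "vec.dim (vec.span ?X) \<le> 2"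
        using vec.dim_le_card[of "vec.span ?X" ?X] card_insert_le_m1[of 2 "{V 0 G (- C) A (- D) A}" "V G 0 E (- D) E (- C)"]
        by simp
      ultimately have "W = vec.span ?X"
        using vec.subspace_dim_equal[OF subW vec.subspace_span, of ?X] dW by simp
      then have "V G 0 E (- D) E (- C) \<in> S1" using vec.span_base[of _ ?X] unfolding W_def by blast
      then have "E * D + (- C) * E = E * C + (- D) * E" unfolding S1 by blast
      then have "2 * (E * (D - C)) = 0" by (simp add: algebra_simps)
      then have "D = C" using two E by simp
      then have "2 * ?h = 0" by (simp add: C_def D_def algebra_simps)
      then show False using two False by simp
    qed
    then show ?thesis using persp False by simp
  qed
qed

lemma line_rel_M_iff:
  assumes "i \<le> 5"
  shows "(M p, M q) \<in> line_rel Q L i \<longleftrightarrow> (p, q) \<in> heis_rel d i"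
proof (cases "p = q")
  case True
  then show ?thesis using M_disjoint_lines hcls_eq_0_iff[of d q q] by (auto simp: line_rel_def heis_rel_def)
next
  case False
  then have ne: "M p \<noteq> M q" using M_inj by blast
  let ?r = "rk (fst p - fst q)" and ?h = "height d p q"
  \<comment> \<open>This excludes rank 0 together with height 0, so in relation 1 the condition
    \<open>?r \<noteq> 2\<close> means rank 1.\<close>
  have 0: "hcls d p q \<noteq> 0" using False by (simp add: hcls_eq_0_iff)
  have r: "?r = 0 \<or> ?r = 1 \<or> ?r = 2" using rk_le[of "fst p - fst q"] by linarith
  have triv: "M p \<inter> M q = {0} \<longleftrightarrow> \<not> (?h = 0 \<and> ?r \<noteq> 2)"
    unfolding M_Int_trivial_iff by (auto simp: rk_def)
  have dim: "vec.dim (M p \<inter> M q) = 1 \<longleftrightarrow> ?h = 0 \<and> ?r \<noteq> 2"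
    using dim_M_Int[OF False] triv by blast
  have dim_Suc: "vec.dim (M p \<inter> M q) = Suc 0 \<longleftrightarrow> ?h = 0 \<and> ?r \<noteq> 2" using dim by simp
  have "(M p, M q) \<in> line_rel Q L i \<longleftrightarrow> i \<noteq> 0 \<and>
      (if i = 1 then ?h = 0 \<and> ?r \<noteq> 2 else if i = 2 then ?r = 0
       else if i = 3 then \<not> (?h = 0 \<and> ?r \<noteq> 2) \<and> ?r = 1
       else if i = 4 then ?r = 2 \<and> ?h \<noteq> 0 else ?r = 2 \<and> ?h = 0)"
  proof -
    consider "i = 0" | "i = 1" | "i = 2" | "i = 3" | "i = 4" | "i = 5" using assms by linarith
    then show ?thesis
      using ne in_perspective_iff[of p q]
      by cases (simp_all add: line_rel_def M_disjoint_lines triv dim_Suc dim_lines span_lines_UNIV_iff cong: conj_cong)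
  qed
  also have "\<dots> \<longleftrightarrow> hcls d p q = i"
    using r 0 assms by (auto simp: hcls_def cls_def split: if_splits)
  finally show ?thesis by (simp add: heis_rel_def)
qed

end

section \<open>Points of the Hermitian surface\<close>

text \<open>The two fields are unrelated types, so the subfield appears as the range of \<sigma>.
  Additivity of the \<open>q\<close>-th power reflects that \<open>q\<close> is a power of the
  characteristic.\<close>

locale subfield_embedding =
  fixes q :: nat and \<sigma> :: "'f::{field,finite} \<Rightarrow> 'g::{field,finite}"
  assumes odd_q: "odd q" and card_f: "CARD('f) = q" and card_g: "CARD('g) = q\<^sup>2"
    and frobenius_add: "\<And>x y::'g. (x + y) ^ q = x ^ q + y ^ q"
    and \<sigma>_add: "\<And>x y. \<sigma> (x + y) = \<sigma> x + \<sigma> y" and \<sigma>_mult: "\<And>x y. \<sigma> (x * y) = \<sigma> x * \<sigma> y"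
    and \<sigma>_one: "\<sigma> 1 = 1"
begin

lemma two_g: "(2::'g) \<noteq> 0"
  by (rule two_neq_zero_if_odd_card) (simp add: card_g odd_q)

lemma q_pos: "q > 0" using odd_q by (simp add: odd_pos)

lemma \<sigma>_zero: "\<sigma> 0 = 0" using \<sigma>_add[of 0 0] by (metis add_0 add_cancel_left_left)

lemma \<sigma>_minus: "\<sigma> (- x) = - \<sigma> x"
  using \<sigma>_add[of x "- x"] by (simp add: \<sigma>_zero eq_neg_iff_add_eq_0 add.commute)

lemma \<sigma>_diff: "\<sigma> (x - y) = \<sigma> x - \<sigma> y"
  using \<sigma>_add[of x "- y"] by (simp add: \<sigma>_minus)

lemma \<sigma>_power: "\<sigma> (x ^ n) = \<sigma> x ^ n"
  by (induction n) (simp_all add: \<sigma>_one \<sigma>_mult)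

lemma \<sigma>_eq_0_iff: "\<sigma> x = 0 \<longleftrightarrow> x = 0"
proof
  assume "\<sigma> x = 0"
  then have "\<sigma> (x * inverse x) = 0" by (simp add: \<sigma>_mult)
  then show "x = 0" using \<sigma>_one by (cases "x = 0") auto
qed (simp add: \<sigma>_zero)

lemma \<sigma>_inj: "inj \<sigma>"
  by (rule injI) (metis \<sigma>_diff \<sigma>_eq_0_iff eq_iff_diff_eq_0)

lemma \<sigma>_frobenius: "\<sigma> x ^ q = \<sigma> x"
  using finite_field_power_card[of x] by (simp add: card_f flip: \<sigma>_power)

lemma frobenius_involution: "(x ^ q) ^ q = (x::'g)"
  using finite_field_power_card[of x] by (simp add: card_g power2_eq_square flip: power_mult)

lemma frobenius_zero: "(0::'g) ^ q = 0" using q_pos by simp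

lemma frobenius_minus: "(- x) ^ q = - (x ^ q :: 'g)"
  using odd_q by simp

lemma frobenius_diff: "(x - y) ^ q = x ^ q - (y ^ q :: 'g)"
  using frobenius_add[of x "- y"] by (simp add: frobenius_minus)

lemma frobenius_two: "(2::'g) ^ q = 2"
  using frobenius_add[of 1 1] by simp

text \<open>The polynomial \<open>X^q - X\<close> has at most \<open>q\<close> roots, and the range
  of \<sigma> already provides \<open>q\<close> of them.\<close>

lemma fixed_field: "x ^ q = x \<longleftrightarrow> x \<in> range \<sigma>"
proof -
  let ?P = "monom 1 q - monom 1 1 :: 'g poly"
  have q1: "q > 1"
  proof -
    have "card {0, 1::'f} \<le> q" unfolding card_f[symmetric] by (intro card_mono) auto
    then show ?thesis by simp
  qed
  have c: "coeff ?P q = 1" using q1 by simp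
  have "?P \<noteq> 0"
  proof
    assume "?P = 0"
    then have "coeff ?P q = 0" by (simp only: coeff_0)
    with c show False by simp
  qed
  moreover have "degree ?P \<le> q" using q1 by (intro degree_diff_le) (simp_all add: degree_monom_eq)
  moreover have "{x. poly ?P x = 0} = {x. x ^ q = x}" by (simp add: poly_monom)
  ultimately have "card {x::'g. x ^ q = x} \<le> q" using card_poly_roots_bound[of ?P] by simp
  moreover have "card (range \<sigma>) = q" using \<sigma>_inj by (simp add: card_image card_f)
  moreover have "range \<sigma> \<subseteq> {x. x ^ q = x}" using \<sigma>_frobenius by auto
  ultimately have "range \<sigma> = {x. x ^ q = x}" by (intro card_seteq) auto
  then show ?thesis by blast
qed

end

locale quadratic_extension = subfield_embedding q \<sigma>
  for q :: nat and \<sigma> :: "'f::{field,finite} \<Rightarrow> 'g::{field,finite}" +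
  fixes \<theta> :: 'g and d :: 'f
  assumes \<theta>: "\<theta> \<noteq> 0" "\<theta> ^ q = - \<theta>" "\<theta>\<^sup>2 = \<sigma> d"
begin

lemmas frobenius = frobenius_add frobenius_minus frobenius_diff frobenius_two frobenius_zero
  frobenius_involution power_mult_distrib power_divide \<sigma>_frobenius \<theta>(2)

text \<open>The symmetric part of \<open>z\<close> under the conjugation
  \<open>x \<mapsto> x ^ q\<close> is fixed; the antisymmetric part is \<theta> times a fixed
  element, because \<theta> changes sign.\<close>

lemma decompose: obtains x y where "z = \<sigma> x + \<theta> * \<sigma> y"
proof -
  have "((z + z ^ q) / 2) ^ q = (z + z ^ q) / 2" "((z - z ^ q) / (2 * \<theta>)) ^ q = (z - z ^ q) / (2 * \<theta>)"
    using \<theta>(1) two_g by (simp_all add: frobenius field_simps)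
  then obtain x y where "(z + z ^ q) / 2 = \<sigma> x" "(z - z ^ q) / (2 * \<theta>) = \<sigma> y" unfolding fixed_field by blast
  moreover have "z = (z + z ^ q) / 2 + \<theta> * ((z - z ^ q) / (2 * \<theta>))"
  proof -
    have "(z + z ^ q) / 2 + \<theta> * ((z - z ^ q) / (2 * \<theta>)) = (z + z ^ q) / 2 + (z - z ^ q) / 2"
      using \<theta>(1) by simp
    also have "\<dots> = (2 * z) / 2" by (simp flip: add_divide_distrib)
    finally show ?thesis using two_g by simp
  qed
  ultimately show thesis using that by metis
qed

lemma decompose_eq_0_iff: "\<sigma> x + \<theta> * \<sigma> y = 0 \<longleftrightarrow> x = 0 \<and> y = 0"
proof
  assume e: "\<sigma> x + \<theta> * \<sigma> y = 0"
  have "(\<sigma> x + \<theta> * \<sigma> y) ^ q = \<sigma> x - \<theta> * \<sigma> y" by (simp add: frobenius)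
  then have e': "\<sigma> x - \<theta> * \<sigma> y = 0" unfolding e frobenius_zero by simp
  have "2 * \<sigma> x = (\<sigma> x + \<theta> * \<sigma> y) + (\<sigma> x - \<theta> * \<sigma> y)" by simp
  then have "\<sigma> x = 0" unfolding e e' using two_g by simp
  then show "x = 0 \<and> y = 0" using e \<theta>(1) by (simp add: \<sigma>_eq_0_iff \<sigma>_zero)
qed (simp add: \<sigma>_zero)

text \<open>A root of \<open>d\<close> in the subfield would equal \<theta> up to sign and so make
  \<theta> fixed under conjugation.\<close>

lemma nonsquare_d: "x\<^sup>2 \<noteq> d"
proof
  assume "x\<^sup>2 = d"
  then have "\<theta>\<^sup>2 = (\<sigma> x)\<^sup>2" using \<theta>(3) by (simp flip: \<sigma>_power)
  then have "\<theta> = \<sigma> x \<or> \<theta> = - \<sigma> x" by (simp add: power2_eq_iff)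
  then have "\<theta> ^ q = \<theta>" using \<sigma>_frobenius[of x] by (auto simp: frobenius_minus)
  then have "\<theta> + \<theta> = 0" using \<theta>(2) by (metis add.left_inverse)
  then have "2 * \<theta> = 0" by simp
  then show False using two_g \<theta>(1) by simp
qed

lemma norm_surj:
  assumes "c ^ q = (c::'g)"
  obtains z :: 'g where "z * z ^ q = c"
proof -
  obtain b where b: "c = \<sigma> b" using assms fixed_field by blast
  have "d \<noteq> 0" using nonsquare_d[of 0] by auto
  then obtain x y where xy: "qnorm d x y = b" by (rule qnorm_surj)
  have "(\<sigma> x + \<theta> * \<sigma> y) * (\<sigma> x + \<theta> * \<sigma> y) ^ q = (\<sigma> x)\<^sup>2 - \<theta>\<^sup>2 * (\<sigma> y)\<^sup>2"
    by (simp add: frobenius power2_eq_square algebra_simps)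
  also have "\<dots> = c" by (simp add: \<theta>(3) b flip: xy \<sigma>_power) (simp add: qnorm_def \<sigma>_diff \<sigma>_mult)
  finally show thesis by (rule that)
qed

section \<open>The Hermitian form and adapted bases\<close>

abbreviation h :: "'g ^ 4 \<Rightarrow> 'g ^ 4 \<Rightarrow> 'g" where "h \<equiv> herm q"

lemma h_left: "h (x + y) z = h x z + h y z" "h (c *s x) z = c * h x z"
  by (simp_all add: herm_def algebra_simps)

lemma h_right: "h x (y + z) = h x y + h x z" "h x (c *s y) = c ^ q * h x y"
  by (simp_all add: herm_def frobenius_add power_mult_distrib algebra_simps)

lemma h_conj: "h y x = (h x y) ^ q"
  by (simp add: herm_def frobenius algebra_simps)

lemma h_minus: "h (- x) z = - h x z" "h x (- z) = - h x z"
  by (simp_all add: herm_def frobenius_minus)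

lemma h_diff: "h (x - y) z = h x z - h y z" "h x (y - z) = h x y - h x z"
  using h_left(1)[of x "- y" z] h_right(1)[of x y "- z"] by (simp_all add: h_minus)

lemma h_zero: "h 0 z = 0" "h x 0 = 0"
  by (simp_all add: herm_def frobenius_zero)

lemmas h_simps = h_left h_right h_minus h_diff h_zero

lemma h_eq_0_commute: "h x y = 0 \<longleftrightarrow> h y x = 0"
  by (subst h_conj) (use q_pos in simp)

lemma h_nondegenerate:
  assumes "x \<noteq> 0"
  obtains y where "h x y \<noteq> 0"
proof (rule ccontr)
  assume "\<not> thesis"
  then have z: "h x y = 0" for y using that by blast
  have ne: "(0::4) \<noteq> 1" "(0::4) \<noteq> 2" "(0::4) \<noteq> 3" "(1::4) \<noteq> 2" "(1::4) \<noteq> 3" "(2::4) \<noteq> 3" by simp_all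
  have "x $ 0 = 0" "x $ 1 = 0" "x $ 2 = 0" "x $ 3 = 0"
    using z[of "axis 3 1"] z[of "axis 1 1"] z[of "axis 2 1"] z[of "axis 0 1"] ne ne[symmetric]
    by (simp_all add: herm_def axis_def frobenius_zero)
  moreover have "i = 0 \<or> i = 1 \<or> i = 2 \<or> i = 3" for i :: 4
    using exhaust_4[of i] by auto
  ultimately have "x = 0" unfolding vec_eq_iff by (metis zero_index)
  then show False using assms by simp
qed

lemma h_perp:
  obtains v where "v \<noteq> 0" "h v x = 0" "h v y = 0" "h v z = 0"
proof -
  let ?f = "\<lambda>v. (h v x, h v y, h v z)"
  have "CARD('g \<times> 'g \<times> 'g) < CARD('g ^ 4)"
    using card_field_power_less[of 3 4, where 'a='g] by (simp add: power_numeral_reduce)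
  then obtain v where "v \<noteq> 0" "?f v = 0"
    using ex_nonzero_kernel[of ?f] by (auto simp: h_simps)
  then show thesis using that[of v] by (auto simp: zero_prod_def)
qed

end

text \<open>With \<open>e1\<close>, \<open>e2\<close> isotropic and of product
  \<open>- \<theta>\<close>, the form on their plane is \<open>- \<theta>\<close> times the
  expression whose rational part is \<open>om\<close>; this is what makes the coordinates match
  those of the lines.\<close>

locale hermitian_frame = quadratic_extension q \<sigma> \<theta> d
  for q :: nat and \<sigma> :: "'f::{field,finite} \<Rightarrow> 'g::{field,finite}" and \<theta> :: 'g and d :: 'f +
  fixes p p' e1 e2 :: "'g ^ 4"
  assumes h_frame: "herm q p p = 0" "herm q p' p' = 0" "herm q e1 e1 = 0" "herm q e2 e2 = 0"
    "herm q p p' = 1" "herm q e1 e2 = - \<theta>"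
    "herm q p e1 = 0" "herm q p e2 = 0" "herm q p' e1 = 0" "herm q p' e2 = 0"

context quadratic_extension
begin

text \<open>The complement of \<open>p\<close>, \<open>p'\<close> contains two orthogonal vectors.
  If neither is isotropic, surjectivity of the norm supplies a multiple of one that cancels the
  value of the other.\<close>

lemma ex_isotropic:
  assumes "herm q p p = 0" "herm q p' p' = 0" "herm q p p' = 1"
  obtains e where "e \<noteq> 0" "h e e = 0" "h e p = 0" "h e p' = 0"
proof -
  obtain v where v: "v \<noteq> 0" "h v p = 0" "h v p' = 0" by (rule h_perp[of p p' 0])
  obtain w where w: "w \<noteq> 0" "h w p = 0" "h w p' = 0" "h w v = 0" by (rule h_perp[of p p' v])
  show thesis
  proof (cases "h v v = 0 \<or> h w w = 0")
    case True
    then show thesis using that[of v] that[of w] v w by blast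
  next
    case False
    have "(- (h v v / h w w)) ^ q = - (h v v / h w w)"
      using h_conj[of v v] h_conj[of w w] by (simp add: frobenius)
    then obtain t where t: "t * t ^ q = - (h v v / h w w)" by (rule norm_surj)
    have "h v w = 0" using w(4) h_eq_0_commute by blast
    then have "h (v + t *s w) (v + t *s w) = h v v + t * t ^ q * h w w"
      using w(4) by (simp add: h_simps)
    then have "h (v + t *s w) (v + t *s w) = 0" unfolding t using False by simp
    moreover have "h (v + t *s w) v = h v v" using w(4) by (simp add: h_simps)
    then have "v + t *s w \<noteq> 0" using False h_zero by metis
    ultimately show thesis using that[of "v + t *s w"] v w by (simp add: h_simps)
  qed
qed

lemma ex_frame:
  assumes p: "p \<noteq> 0" "h p p = 0"
  obtains p' e1 e2 where "hermitian_frame q \<sigma> \<theta> d p p' e1 e2"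
proof -
  obtain y0 where y0: "h p y0 \<noteq> 0" using h_nondegenerate[OF p(1)] by blast
  \<comment> \<open>The \<open>q\<close>-th power compensates for the conjugation in the second
    argument of \<open>h\<close>; the same happens for \<open>z\<close> below.\<close>
  define y where "y = (1 / h p y0) ^ q *s y0"
  have py: "h p y = 1" using y0 by (simp add: y_def h_simps frobenius_involution)
  then have yp: "h y p = 1" using h_conj[of y p] by simp
  \<comment> \<open>Chosen so that \<open>h p' p' = h y y + 2 * t\<close> vanishes.\<close>
  define t where "t = - (h y y / 2)"
  have t: "t ^ q = t" using h_conj[of y y] by (simp add: t_def frobenius)
  define p' where "p' = y + t *s p"
  have "h p' p' = h y y + t + t" by (simp add: p'_def h_simps t py yp p(2) add.assoc)
  also have "\<dots> = h y y + 2 * t" by simp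
  also have "\<dots> = 0" using two_g by (simp add: t_def)
  finally have p': "h p' p' = 0" "h p p' = 1" by (simp_all add: p'_def h_simps py p(2))
  have p'p: "h p' p = 1" using h_conj[of p' p] p'(2) by simp
  obtain e1 where e1: "e1 \<noteq> 0" "h e1 e1 = 0" "h e1 p = 0" "h e1 p' = 0"
    using ex_isotropic[OF p(2) p'] by blast
  obtain z0 where z0: "h e1 z0 \<noteq> 0" using h_nondegenerate[OF e1(1)] by blast
  \<comment> \<open>Removes the component of \<open>z0\<close> in the plane of \<open>p\<close> and
    \<open>p'\<close>; the product with \<open>e1\<close> is unaffected.\<close>
  define z1 where "z1 = z0 - (h z0 p' *s p + h z0 p *s p')"
  have z1: "h z1 p = 0" "h z1 p' = 0" "h e1 z1 \<noteq> 0"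
    using z0 by (simp_all add: z1_def h_simps p p' p'p e1)
  define z where "z = (- \<theta> / h e1 z1) ^ q *s z1"
  have z: "h z p = 0" "h z p' = 0" "h e1 z = - \<theta>"
    using z1 by (simp_all add: z_def h_simps frobenius_involution)
  have ze: "h z e1 = \<theta>" using h_conj[of z e1] z(3) by (simp add: frobenius)
  \<comment> \<open>Because \<theta> is antisymmetric, each of the two cross terms in
    \<open>h e2 e2\<close> contributes \<open>- r\<close>.\<close>
  define r where "r = h z z / 2"
  have r: "r ^ q = r" using h_conj[of z z] by (simp add: r_def frobenius)
  define e2 where "e2 = z + (r / \<theta>) *s e1"
  have "h e2 e2 = h z z + (r / \<theta>) ^ q * \<theta> + r / \<theta> * - \<theta>"
    by (simp add: e2_def h_simps z(3) ze e1(2))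
  also have "\<dots> = h z z - 2 * r" using \<theta>(1) by (simp add: frobenius r)
  also have "\<dots> = 0" using two_g by (simp add: r_def)
  finally have e2: "h e2 e2 = 0" "h e1 e2 = - \<theta>" "h e2 p = 0" "h e2 p' = 0"
    by (simp_all add: e2_def h_simps z e1)
  have sw: "h p e1 = 0" "h p e2 = 0" "h p' e1 = 0" "h p' e2 = 0"
    using e1 e2 h_eq_0_commute by blast+
  have "hermitian_frame q \<sigma> \<theta> d p p' e1 e2"
    by unfold_locales (fact p(2) p' e1(2) e2 sw)+
  then show thesis by (rule that)
qed

end

section \<open>Normalized representatives of points\<close>

context hermitian_frame
begin

lemma h_frame': "h p' p = 1" "h e2 e1 = \<theta>" "h e1 p = 0" "h e2 p = 0" "h e1 p' = 0" "h e2 p' = 0"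
  using h_frame h_conj[of p' p] h_conj[of e2 e1] h_conj[of e1 p] h_conj[of e2 p] h_conj[of e1 p'] h_conj[of e2 p']
  by (simp_all add: frobenius)

definition hcomb :: "'g \<Rightarrow> 'g \<Rightarrow> 'g \<Rightarrow> 'g \<Rightarrow> 'g ^ 4" where
  "hcomb r s z1 z2 = r *s p + (s *s p' + (z1 *s e1 + z2 *s e2))"

lemma h_hcomb: "h (hcomb r s z1 z2) (hcomb r' s' z1' z2') =
    r * s' ^ q + s * r' ^ q - \<theta> * (z1 * z2' ^ q - z2 * z1' ^ q)"
  by (simp add: hcomb_def h_simps h_frame h_frame' algebra_simps)

lemma h_hcomb_frame:
  "h (hcomb r s z1 z2) p' = r" "h (hcomb r s z1 z2) p = s"
  "h (hcomb r s z1 z2) e2 = - (\<theta> * z1)" "h (hcomb r s z1 z2) e1 = \<theta> * z2"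
  by (simp_all add: hcomb_def h_simps h_frame h_frame' algebra_simps)

lemma hcomb_eq_iff:
  "hcomb r s z1 z2 = hcomb r' s' z1' z2' \<longleftrightarrow> r = r' \<and> s = s' \<and> z1 = z1' \<and> z2 = z2'"
proof
  assume e: "hcomb r s z1 z2 = hcomb r' s' z1' z2'"
  have "h (hcomb r s z1 z2) u = h (hcomb r' s' z1' z2') u" for u by (simp only: e)
  from this[of p] this[of p'] this[of e1] this[of e2]
  show "r = r' \<and> s = s' \<and> z1 = z1' \<and> z2 = z2'" using \<theta>(1) by (simp add: h_hcomb_frame)
qed simp

lemma hcomb_diff: "hcomb r s z1 z2 - hcomb r' s' z1' z2' = hcomb (r - r') (s - s') (z1 - z1') (z2 - z2')"
  by (simp add: hcomb_def vec.scale_left_diff_distrib algebra_simps)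

text \<open>The coefficients are unique, and there are as many quadruples of coefficients as
  vectors.\<close>

lemma hcomb_expansion:
  obtains r z1 z2 where "v = hcomb r (h v p) z1 z2"
proof -
  let ?f = "\<lambda>(r, s, z1, z2). hcomb r s z1 z2"
  have "inj ?f" by (rule injI) (auto simp: hcomb_eq_iff)
  moreover have "CARD('g \<times> 'g \<times> 'g \<times> 'g) = CARD('g ^ 4)" by (simp add: power_numeral_reduce)
  ultimately have "range ?f = UNIV"
    by (intro card_subset_eq) (simp_all add: card_image)
  then have "v \<in> range ?f" by blast
  then obtain r s z1 z2 where v: "v = hcomb r s z1 z2" by auto
  then have "v = hcomb r (h v p) z1 z2" using h_hcomb_frame(2)[of r s z1 z2] by simp
  then show thesis by (rule that)
qed

text \<open>Isotropy of the vector determines the rational part of the coefficient of \<open>p\<close>.\<close>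

fun pt :: "'f quad \<times> 'f \<Rightarrow> 'g ^ 4" where
  "pt ((x1, y1, x2, y2), a) =
    hcomb (- \<sigma> (d * (x1 * y2 - x2 * y1)) - \<theta> * \<sigma> a) 1 (\<sigma> x1 + \<theta> * \<sigma> y1) (\<sigma> x2 + \<theta> * \<sigma> y2)"

text \<open>The coefficients of \<open>p\<close> contribute the determinants of both matrices and
  the difference of the last coordinates. In the part from \<open>e1\<close>, \<open>e2\<close>, the
  rational component completes the height, and the \<theta>-component, with
  \<open>\<theta>\<^sup>2 = d\<close>, completes the determinants to that of the difference.\<close>

lemma h_pt: "h (pt u) (pt v) = - (\<sigma> (d * dt (fst u - fst v)) + \<theta> * \<sigma> (height d u v))"
proof -
  obtain x1 y1 x2 y2 a where u: "u = ((x1, y1, x2, y2), a)" by (cases u rule: pt.cases)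
  obtain z1 t1 z2 t2 b where v: "v = ((z1, t1, z2, t2), b)" by (cases v rule: pt.cases)
  have tt: "\<theta> * (\<theta> * c) = \<sigma> d * c" for c using \<theta>(3) by (simp add: power2_eq_square flip: mult.assoc)
  show ?thesis
    by (simp add: u v h_hcomb frobenius \<sigma>_add \<sigma>_diff \<sigma>_mult \<sigma>_minus algebra_simps tt)
qed

lemma h_pt_p: "h (pt u) p = 1" "h p (pt u) = 1"
proof -
  show "h (pt u) p = 1" by (cases u rule: pt.cases) (simp add: h_hcomb_frame)
  then show "h p (pt u) = 1" using h_conj[of p "pt u"] by simp
qed

end

lemma subspace_dim_1_eq_span:
  fixes R :: "('f::field ^ 'n) set"
  assumes "vec.subspace R" "vec.dim R = 1" "s \<in> R" "s \<noteq> 0"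
  shows "R = vec.span {s}"
proof (rule sym, rule vec.subspace_dim_equal)
  show "vec.span {s} \<subseteq> R" using assms by (intro vec.span_minimal) auto
  show "vec.dim R \<le> vec.dim (vec.span {s})" using assms by simp
qed (use assms in auto)

section \<open>Cosets of the units of the subfield\<close>

context quadratic_extension
begin

lemma subfield_units_eq: "subfield_units q = \<sigma> ` (UNIV - {0})"
  using fixed_field \<sigma>_eq_0_iff by (auto simp: subfield_units_def)

lemma subfield_units_mult:
  "x \<in> subfield_units q \<Longrightarrow> y \<in> subfield_units q \<Longrightarrow> x * (y::'g) \<in> subfield_units q"
  by (simp add: subfield_units_def power_mult_distrib)

lemma unit_coset_zero: "unit_coset q (0::'g) = {0}"
proof -
  have "(1::'g) \<in> subfield_units q" by (simp add: subfield_units_def)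
  then show ?thesis by (auto simp: unit_coset_def)
qed

lemma unit_coset_eq_iff: "unit_coset q a = unit_coset q b \<longleftrightarrow> (\<exists>k\<in>subfield_units q. a = b * (k::'g))"
proof
  assume e: "unit_coset q a = unit_coset q b"
  have "a * 1 \<in> unit_coset q a" unfolding unit_coset_def by (rule imageI) (simp add: subfield_units_def)
  then show "\<exists>k\<in>subfield_units q. a = b * k" unfolding e by (auto simp: unit_coset_def)
next
  assume "\<exists>k\<in>subfield_units q. a = b * k"
  then obtain k where k: "k \<in> subfield_units q" "a = b * k" by blast
  have inv: "1 / k \<in> subfield_units q" using k(1) by (simp add: subfield_units_def power_divide)
  have "k \<noteq> 0" using k(1) by (simp add: subfield_units_def)
  show "unit_coset q a = unit_coset q b"
  proof
    show "unit_coset q a \<subseteq> unit_coset q b"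
      unfolding unit_coset_def k(2) using subfield_units_mult[OF k(1)] by (auto simp: mult.assoc)
    show "unit_coset q b \<subseteq> unit_coset q a"
    proof
      fix x assume "x \<in> unit_coset q b"
      then obtain c where c: "c \<in> subfield_units q" "x = b * c" by (auto simp: unit_coset_def)
      then have "x = a * (1 / k * c)" using k(2) \<open>k \<noteq> 0\<close> by simp
      then show "x \<in> unit_coset q a" unfolding unit_coset_def using subfield_units_mult[OF inv c(1)] by blast
    qed
  qed
qed

text \<open>Nonzero cosets are the points of a projective line over the smaller field with
  homogeneous coordinates \<open>D\<close>, \<open>s\<close>; the cosets of 1 and \<theta> are the
  two coordinate points.\<close>

lemma unit_coset_cases:
  fixes D s :: 'f
  defines "z \<equiv> - (\<sigma> D + \<theta> * \<sigma> s)"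
  shows "unit_coset q z = {0} \<longleftrightarrow> D = 0 \<and> s = 0"
    "unit_coset q z = unit_coset q \<theta> \<longleftrightarrow> D = 0 \<and> s \<noteq> 0"
    "unit_coset q z \<in> other_cosets q \<theta> \<longleftrightarrow> D \<noteq> 0 \<and> s \<noteq> 0"
    "unit_coset q z = unit_coset q 1 \<longleftrightarrow> D \<noteq> 0 \<and> s = 0"
proof -
  have z0: "z = 0 \<longleftrightarrow> D = 0 \<and> s = 0" unfolding z_def neg_equal_0_iff_equal by (rule decompose_eq_0_iff)
  have "unit_coset q z = {0} \<longleftrightarrow> z = 0"
  proof -
    have one: "(1::'g) \<in> subfield_units q" by (simp add: subfield_units_def)
    have "unit_coset q z = {0} \<longleftrightarrow> (\<exists>k\<in>subfield_units q. z = 0 * k)"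
      using unit_coset_eq_iff[of z 0] by (simp only: unit_coset_zero)
    also have "\<dots> \<longleftrightarrow> z = 0" unfolding mult_zero_left using one by blast
    finally show ?thesis .
  qed
  then show 1: "unit_coset q z = {0} \<longleftrightarrow> D = 0 \<and> s = 0" using z0 by simp
  have "z = \<theta> * \<sigma> k \<longleftrightarrow> D = 0 \<and> s = - k" for k
  proof -
    have "z = \<theta> * \<sigma> k \<longleftrightarrow> \<sigma> D + \<theta> * \<sigma> (s + k) = 0"
      unfolding z_def neg_eq_iff_add_eq_0 \<sigma>_add distrib_left add.assoc by (rule refl)
    then show ?thesis unfolding decompose_eq_0_iff by (simp add: eq_neg_iff_add_eq_0)
  qed
  moreover have eq_iff: "unit_coset q z = unit_coset q w \<longleftrightarrow> (\<exists>k. k \<noteq> 0 \<and> z = w * \<sigma> k)" for w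
    unfolding unit_coset_eq_iff subfield_units_eq by blast
  ultimately have "unit_coset q z = unit_coset q \<theta> \<longleftrightarrow> (\<exists>k. k \<noteq> 0 \<and> D = 0 \<and> s = - k)" by (simp only:)
  then show 2: "unit_coset q z = unit_coset q \<theta> \<longleftrightarrow> D = 0 \<and> s \<noteq> 0"
    by (metis minus_minus neg_equal_0_iff_equal)
  have "z = 1 * \<sigma> k \<longleftrightarrow> D = - k \<and> s = 0" for k
  proof -
    have "z = 1 * \<sigma> k \<longleftrightarrow> \<sigma> (D + k) + \<theta> * \<sigma> s = 0"
      unfolding z_def neg_eq_iff_add_eq_0 \<sigma>_add by (simp only: mult_1 add_ac)
    then show ?thesis unfolding decompose_eq_0_iff by (simp add: eq_neg_iff_add_eq_0)
  qed
  then have "unit_coset q z = unit_coset q 1 \<longleftrightarrow> (\<exists>k. k \<noteq> 0 \<and> D = - k \<and> s = 0)" unfolding eq_iff by (simp only:)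
  then show 3: "unit_coset q z = unit_coset q 1 \<longleftrightarrow> D \<noteq> 0 \<and> s = 0"
    by (metis minus_minus neg_equal_0_iff_equal)
  have "(\<exists>a. unit_coset q z = unit_coset q a \<and> a \<noteq> 0) \<longleftrightarrow> z \<noteq> 0"
  proof -
    have "z \<noteq> 0" if "unit_coset q z = unit_coset q a" "a \<noteq> 0" for a
      using that unfolding unit_coset_eq_iff by (auto simp: subfield_units_def)
    then show ?thesis by blast
  qed
  then show "unit_coset q z \<in> other_cosets q \<theta> \<longleftrightarrow> D \<noteq> 0 \<and> s \<noteq> 0"
    unfolding other_cosets_def using z0 2 3 by auto
qed

end

section \<open>The points not collinear with \<open>P\<close>\<close>

context hermitian_frame
begin

definition P0 :: "('g ^ 4) set" where "P0 = vec.span {p}"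

definition PT :: "'f quad \<times> 'f \<Rightarrow> ('g ^ 4) set" where "PT u = vec.span {pt u}"

lemma PT_noncollinear: "PT u \<in> noncollinear_points q P0"
proof -
  have "pt u \<noteq> 0" using h_pt_p(1)[of u] by (auto simp: h_zero)
  moreover have "h (pt u) (pt u) = 0" by (simp add: h_pt \<sigma>_zero)
  then have "h x x = 0" if "x \<in> PT u" for x
    using that unfolding PT_def span_1 by (auto simp: h_simps)
  moreover have "p \<in> P0" "pt u \<in> PT u" by (simp_all add: P0_def PT_def vec.span_base)
  then have "\<not> collinear_points q P0 (PT u)"
    unfolding collinear_points_def using h_pt_p(2)[of u] by force
  ultimately show ?thesis
    by (simp add: noncollinear_points_def hermitian_points_def PT_def)
qed

lemma PT_inj:
  assumes "PT u = PT v"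
  shows "u = v"
proof -
  obtain x1 y1 x2 y2 a where u: "u = ((x1, y1, x2, y2), a)" by (cases u rule: pt.cases)
  obtain z1 t1 z2 t2 b where v: "v = ((z1, t1, z2, t2), b)" by (cases v rule: pt.cases)
  have "pt u \<in> PT v" unfolding assms[symmetric] by (simp add: PT_def vec.span_base)
  then obtain c where c: "pt u = c *s pt v" unfolding PT_def span_1 by blast
  then have "h (pt u) p = c * h (pt v) p" by (simp add: h_simps)
  then have "c = 1" by (simp add: h_pt_p)
  then have e: "pt u = pt v" using c by simp
  have dec: "x = x' \<and> y = y'" if "\<sigma> x + \<theta> * \<sigma> y = \<sigma> x' + \<theta> * \<sigma> y'" for x y x' y'
    using decompose_eq_0_iff[of "x - x'" "y - y'"] that by (simp add: \<sigma>_diff algebra_simps)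
  have "\<sigma> x1 + \<theta> * \<sigma> y1 = \<sigma> z1 + \<theta> * \<sigma> t1" "\<sigma> x2 + \<theta> * \<sigma> y2 = \<sigma> z2 + \<theta> * \<sigma> t2"
    using e unfolding u v pt.simps hcomb_eq_iff by blast+
  then have *: "x1 = z1 \<and> y1 = t1" "x2 = z2 \<and> y2 = t2" using dec by blast+
  then have "\<theta> * \<sigma> a = \<theta> * \<sigma> b" using e by (simp add: u v hcomb_eq_iff)
  then have "a = b" using \<theta>(1) injD[OF \<sigma>_inj] by simp
  then show ?thesis using * by (simp add: u v)
qed

lemma PT_surj:
  assumes R: "R \<in> noncollinear_points q P0"
  obtains u where "PT u = R"
proof -
  have sub: "vec.subspace R" and dim: "vec.dim R = 1" and iso: "\<And>x. x \<in> R \<Longrightarrow> h x x = 0"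
    using R by (auto simp: noncollinear_points_def hermitian_points_def)
  obtain x s where xs: "x \<in> P0" "s \<in> R" "h x s \<noteq> 0"
    using R by (auto simp: noncollinear_points_def collinear_points_def)
  obtain c where "x = c *s p" using xs(1) unfolding P0_def span_1 by blast
  then have "h p s \<noteq> 0" using xs(3) by (auto simp: h_simps)
  then have sp: "h s p \<noteq> 0" using h_eq_0_commute by blast
  define s' where "s' = (1 / h s p) *s s"
  have s'R: "s' \<in> R" unfolding s'_def using sub xs(2) by (rule vec.subspace_scale)
  have s'p: "h s' p = 1" using sp by (simp add: s'_def h_simps)
  then have "s' \<noteq> 0" by (auto simp: h_zero)
  obtain r z1 z2 where s': "s' = hcomb r 1 z1 z2" using hcomb_expansion[of s'] unfolding s'p by blast
  obtain x1 y1 where z1: "z1 = \<sigma> x1 + \<theta> * \<sigma> y1" by (rule decompose)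
  obtain x2 y2 where z2: "z2 = \<sigma> x2 + \<theta> * \<sigma> y2" by (rule decompose)
  let ?D = "\<sigma> (d * (x1 * y2 - x2 * y1))"
  have tt: "\<theta> * (\<theta> * c) = \<sigma> d * c" for c using \<theta>(3) by (simp add: power2_eq_square flip: mult.assoc)
  have "\<theta> * (z1 * z2 ^ q - z2 * z1 ^ q) = - (?D + ?D)"
    by (simp add: z1 z2 frobenius \<sigma>_diff \<sigma>_mult algebra_simps tt)
  then have "r + r ^ q + (?D + ?D) = 0" using iso[OF s'R] by (simp add: s' h_hcomb)
  \<comment> \<open>Isotropy says that \<open>r + ?D\<close> changes sign under conjugation, so it
    is \<theta> times an element of the subfield, and that element gives the last
    coordinate.\<close>
  then have "(r + ?D) ^ q = - (r + ?D)" by (simp add: frobenius eq_neg_iff_add_eq_0 algebra_simps)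
  then have "((r + ?D) / \<theta>) ^ q = (r + ?D) / \<theta>" by (simp only: power_divide \<theta>(2) minus_divide_divide)
  then obtain b where "(r + ?D) / \<theta> = \<sigma> b" unfolding fixed_field by blast
  then have "r + ?D = \<theta> * \<sigma> b" using \<theta>(1) by (simp add: divide_eq_eq mult.commute)
  then have "r = - ?D - \<theta> * \<sigma> (- b)" by (simp add: \<sigma>_minus eq_diff_eq)
  then have "pt ((x1, y1, x2, y2), - b) = s'" by (simp add: s' z1 z2)
  then have "PT ((x1, y1, x2, y2), - b) = R"
    unfolding PT_def using subspace_dim_1_eq_span[OF sub dim s'R \<open>s' \<noteq> 0\<close>] by simp
  then show thesis by (rule that)
qed

lemma PT_bij: "bij_betw PT UNIV (noncollinear_points q P0)"
proof (rule bij_betw_imageI)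
  show "inj PT" using PT_inj by (rule injI)
  show "range PT = noncollinear_points q P0" using PT_noncollinear PT_surj by blast
qed

text \<open>The normalization against \<open>p\<close> turns two factors of the triple product into
  1; other representatives only contribute norms.\<close>

lemma z_coset_PT: "z_coset q P0 (PT u) (PT v) = unit_coset q (h (pt u) (pt v))"
proof -
  let ?H = "h (pt u) (pt v)"
  have mem: "x \<in> vec.span {y} - {0} \<Longrightarrow> \<exists>c. c \<noteq> 0 \<and> x = c *s y" for x y :: "'g ^ 4"
    unfolding span_1 by auto
  have norm: "c * c ^ q \<in> subfield_units q" if "c \<noteq> 0" for c :: 'g
    using that by (simp add: subfield_units_def frobenius mult.commute)
  have eq: "unit_coset q (h x r * h r s * h s x) = unit_coset q ?H"
    if xrs: "x \<in> P0 - {0}" "r \<in> PT u - {0}" "s \<in> PT v - {0}" for x r s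
  proof -
    obtain a where a: "a \<noteq> 0" "x = a *s p" using mem[OF xrs(1)[unfolded P0_def]] by blast
    obtain b where b: "b \<noteq> 0" "r = b *s pt u" using mem[OF xrs(2)[unfolded PT_def]] by blast
    obtain c where c: "c \<noteq> 0" "s = c *s pt v" using mem[OF xrs(3)[unfolded PT_def]] by blast
    have "h x r * h r s * h s x = ?H * ((a * a ^ q) * (b * b ^ q) * (c * c ^ q))"
    proof -
      have "h x r = a * b ^ q" "h s x = c * a ^ q" "h r s = b * (c ^ q * ?H)"
        by (simp_all only: a(2) b(2) c(2) h_left(2) h_right(2) h_pt_p mult_1_left mult_1_right mult_ac)
      then show ?thesis by (simp only: mult_ac)
    qed
    moreover have "(a * a ^ q) * (b * b ^ q) * (c * c ^ q) \<in> subfield_units q"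
      by (intro subfield_units_mult norm a(1) b(1) c(1))
    ultimately show ?thesis unfolding unit_coset_eq_iff by blast
  qed
  have ne: "p \<in> P0 - {0}" "pt u \<in> PT u - {0}" "pt v \<in> PT v - {0}"
    using h_pt_p[of u] h_pt_p[of v] by (auto simp: P0_def PT_def vec.span_base h_zero)
  show ?thesis unfolding z_coset_def using eq ne by auto
qed

text \<open>The difference of two normalized representatives has no \<open>p'\<close>-component. It
  is a multiple of \<open>p\<close> exactly if the \<open>e1\<close> and \<open>e2\<close>
  coefficients agree; otherwise it is independent of \<open>p\<close> and
  \<open>pt u\<close>.\<close>

lemma on_common_line_PT: "on_common_line P0 (PT u) (PT v) \<longleftrightarrow> fst u = fst v"
proof -
  obtain x1 y1 x2 y2 a where u: "u = ((x1, y1, x2, y2), a)" by (cases u rule: pt.cases)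
  obtain z1 t1 z2 t2 b where v: "v = ((z1, t1, z2, t2), b)" by (cases v rule: pt.cases)
  have p0: "p \<noteq> 0" using h_frame(5) by (auto simp: h_zero)
  have notin: "x \<notin> vec.span S" if "\<And>y. y \<in> S \<Longrightarrow> h y w = 0" "h x w \<noteq> 0" for x w S
  proof
    assume "x \<in> vec.span S"
    then have "h x w = 0"
      by (induction rule: vec.span_induct_alt) (simp_all add: h_simps that(1))
    then show False using that(2) by simp
  qed
  define D where "D = pt u - pt v"
  obtain r where D: "D = hcomb r 0 (\<sigma> (x1 - z1) + \<theta> * \<sigma> (y1 - t1)) (\<sigma> (x2 - z2) + \<theta> * \<sigma> (y2 - t2))"
    by (simp add: D_def u v hcomb_diff \<sigma>_diff algebra_simps)
  show ?thesis
  proof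
    assume "on_common_line P0 (PT u) (PT v)"
    then obtain L where L: "vec.subspace L" "vec.dim L = 2" "P0 \<subseteq> L" "PT u \<subseteq> L" "PT v \<subseteq> L"
      by (auto simp: on_common_line_def)
    show "fst u = fst v"
    proof (rule ccontr)
      assume ne: "fst u \<noteq> fst v"
      have "D \<notin> vec.span {p}"
      proof
        assume "D \<in> vec.span {p}"
        then obtain c where c: "D = c *s p" unfolding span_1 by blast
        have "h D e2 = 0" "h D e1 = 0" unfolding c by (simp_all add: h_simps h_frame)
        then have "x1 - z1 = 0 \<and> y1 - t1 = 0" "x2 - z2 = 0 \<and> y2 - t2 = 0"
          using \<theta>(1) unfolding D by (simp_all add: h_hcomb_frame decompose_eq_0_iff del: right_minus_eq)
        then show False using ne by (simp add: u v)
      qed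
      moreover have "pt u \<notin> vec.span {D, p}"
        by (rule notin[where w = p]) (auto simp: D h_hcomb_frame h_frame h_pt_p)
      ultimately have "vec.dim {pt u, D, p} = 3" using p0 by (simp add: vec.dim_insert)
      moreover have "pt u \<in> L" "pt v \<in> L" "p \<in> L"
        using L(3-5) by (auto simp: P0_def PT_def vec.span_base)
      then have "{pt u, D, p} \<subseteq> L" using L(1) by (auto simp: D_def intro: vec.subspace_diff)
      ultimately show False using vec.dim_subset[of "{pt u, D, p}" L] L(2) by simp
    qed
  next
    assume "fst u = fst v"
    then have "D = hcomb r 0 0 0" by (simp add: D u v \<sigma>_zero)
    then have "D = r *s p" by (simp add: hcomb_def)
    then have v': "pt v = pt u - r *s p" by (simp add: D_def algebra_simps)
    have "pt u \<notin> vec.span {p}"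
      by (rule notin[where w = p]) (auto simp: h_frame h_pt_p)
    then have "vec.dim (vec.span {p, pt u}) = 2" by (rule dim_span_2[OF p0])
    moreover have "pt v \<in> vec.span {p, pt u}"
      unfolding v' by (intro vec.span_diff vec.span_scale vec.span_base) auto
    then have "P0 \<subseteq> vec.span {p, pt u}" "PT u \<subseteq> vec.span {p, pt u}" "PT v \<subseteq> vec.span {p, pt u}"
      unfolding P0_def PT_def by (intro vec.span_minimal; simp add: vec.span_base)+
    ultimately show "on_common_line P0 (PT u) (PT v)"
      unfolding on_common_line_def by (intro exI[of _ "vec.span {p, pt u}"]) simp
  qed
qed

lemma point_rel_PT_iff:
  assumes "i \<le> 5"
  shows "(PT u, PT v) \<in> point_rel q \<theta> P0 i \<longleftrightarrow> (u, v) \<in> heis_rel d i"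
proof (cases "u = v")
  case True
  then show ?thesis using PT_noncollinear hcls_eq_0_iff[of d v v] by (auto simp: point_rel_def heis_rel_def)
next
  case False
  then have ne: "PT u \<noteq> PT v" using PT_inj by blast
  let ?r = "rk (fst u - fst v)" and ?s = "height d u v"
  have 0: "hcls d u v \<noteq> 0" using False by (simp add: hcls_eq_0_iff)
  have r: "?r = 0 \<or> ?r = 1 \<or> ?r = 2" using rk_le[of "fst u - fst v"] by linarith
  have d: "d \<noteq> 0" using nonsquare_d[of 0] by auto
  have D: "d * dt (fst u - fst v) = 0 \<longleftrightarrow> ?r \<noteq> 2" using d by (auto simp: rk_def)
  have L: "on_common_line P0 (PT u) (PT v) \<longleftrightarrow> ?r = 0"
    unfolding on_common_line_PT by (simp add: rk_def)
  have Z: "z_coset q P0 (PT u) (PT v) = {0} \<longleftrightarrow> ?r \<noteq> 2 \<and> ?s = 0"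
    "z_coset q P0 (PT u) (PT v) = unit_coset q \<theta> \<longleftrightarrow> ?r \<noteq> 2 \<and> ?s \<noteq> 0"
    "z_coset q P0 (PT u) (PT v) \<in> other_cosets q \<theta> \<longleftrightarrow> ?r = 2 \<and> ?s \<noteq> 0"
    "z_coset q P0 (PT u) (PT v) = unit_coset q 1 \<longleftrightarrow> ?r = 2 \<and> ?s = 0"
    unfolding z_coset_PT h_pt unit_coset_cases D by simp_all
  have "(PT u, PT v) \<in> point_rel q \<theta> P0 i \<longleftrightarrow> i \<noteq> 0 \<and>
      (if i = 1 then ?r \<noteq> 2 \<and> ?s = 0 else if i = 2 then ?r = 0
       else if i = 3 then (?r \<noteq> 2 \<and> ?s \<noteq> 0) \<and> ?r \<noteq> 0
       else if i = 4 then ?r = 2 \<and> ?s \<noteq> 0 else ?r = 2 \<and> ?s = 0)"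
  proof -
    consider "i = 0" | "i = 1" | "i = 2" | "i = 3" | "i = 4" | "i = 5" using assms by linarith
    then show ?thesis
      using ne by cases
        (simp_all add: point_rel_def PT_noncollinear Z L)
  qed
  also have "\<dots> \<longleftrightarrow> hcls d u v = i"
    using r 0 assms by (auto simp: hcls_def cls_def split: if_splits)
  finally show ?thesis by (simp add: heis_rel_def)
qed

end

section \<open>Transport along a bijection\<close>

text \<open>As \<open>f\<close> is onto, \<open>sub\<close> and \<open>rel\<close> together make
  each \<open>S i\<close> the image of \<open>R i\<close>, so every axiom can be carried
  over.\<close>

lemma association_scheme_transfer:
  assumes A: "association_scheme n X R" and f: "bij_betw f X Y"
    and rel: "\<And>i x y. i \<le> n \<Longrightarrow> x \<in> X \<Longrightarrow> y \<in> X \<Longrightarrow> (f x, f y) \<in> S i \<longleftrightarrow> (x, y) \<in> R i"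
    and sub: "\<And>i. i \<le> n \<Longrightarrow> S i \<subseteq> Y \<times> Y"
  shows "association_scheme n Y S"
proof -
  have img: "Y = f ` X" and inj: "inj_on f X" using f by (auto simp: bij_betw_def)
  have finX: "finite X" and neX: "X \<noteq> {}" and neR: "\<forall>i\<le>n. R i \<noteq> {}" and dis: "disjoint_family_on R {..n}"
    and un: "(\<Union>i\<le>n. R i) = X \<times> X" and diag: "R 0 = Id_on X" and conv: "\<forall>i\<le>n. \<exists>j\<le>n. (R i)\<inverse> = R j"
    and cnt: "\<forall>i\<le>n. \<forall>j\<le>n. \<forall>k\<le>n. \<exists>p. \<forall>(x, y) \<in> R k. card {w \<in> X. (x, w) \<in> R i \<and> (w, y) \<in> R j} = p"
    using A unfolding association_scheme_def by - (elim conjE, assumption)+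
  have RX: "R i \<subseteq> X \<times> X" if "i \<le> n" for i unfolding un[symmetric] using that by blast
  have S: "S i = (\<lambda>(x, y). (f x, f y)) ` R i" if i: "i \<le> n" for i
  proof
    show "S i \<subseteq> (\<lambda>(x, y). (f x, f y)) ` R i"
    proof
      fix z assume z: "z \<in> S i"
      then obtain x y where xy: "x \<in> X" "y \<in> X" "z = (f x, f y)" using sub[OF i] img by blast
      then have "(x, y) \<in> R i" using rel[OF i] z by blast
      then show "z \<in> (\<lambda>(x, y). (f x, f y)) ` R i" using xy(3) by force
    qed
    show "(\<lambda>(x, y). (f x, f y)) ` R i \<subseteq> S i" using RX[OF i] rel[OF i] by fast
  qed
  show ?thesis unfolding association_scheme_def
  proof (intro conjI)
    show "finite Y" "Y \<noteq> {}" using finX neX img by simp_all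
    show "\<forall>i\<le>n. S i \<noteq> {}" using neR by (simp add: S)
    show "disjoint_family_on S {..n}"
    proof -
      have "S i \<inter> S j = {}" if ij: "i \<le> n" "j \<le> n" "i \<noteq> j" for i j
      proof -
        have disj: "R i \<inter> R j = {}" using dis ij by (simp add: disjoint_family_on_def)
        have False if zi: "z \<in> S i" and zj: "z \<in> S j" for z
        proof -
          obtain x y where xy: "x \<in> X" "y \<in> X" "z = (f x, f y)" using sub[OF ij(1)] img zi by blast
          then show False using rel[OF ij(1) xy(1,2)] rel[OF ij(2) xy(1,2)] zi zj disj by blast
        qed
        then show ?thesis by blast
      qed
      then show ?thesis by (auto simp: disjoint_family_on_def)
    qed
    show "(\<Union>i\<le>n. S i) = Y \<times> Y"
    proof
      show "(\<Union>i\<le>n. S i) \<subseteq> Y \<times> Y" using sub by blast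
      show "Y \<times> Y \<subseteq> (\<Union>i\<le>n. S i)"
      proof
        fix z assume "z \<in> Y \<times> Y"
        then obtain x y where xy: "x \<in> X" "y \<in> X" "z = (f x, f y)" unfolding img by blast
        have "(x, y) \<in> (\<Union>i\<le>n. R i)" unfolding un using xy(1,2) by blast
        then obtain i where "i \<le> n" "(x, y) \<in> R i" by blast
        then show "z \<in> (\<Union>i\<le>n. S i)" using rel[OF _ xy(1,2)] xy(3) by blast
      qed
    qed
    show "S 0 = Id_on Y" unfolding S[OF le0] diag img by (auto simp: Id_on_def)
    show "\<forall>i\<le>n. \<exists>j\<le>n. (S i)\<inverse> = S j"
    proof (intro allI impI)
      fix i assume i: "i \<le> n"
      then obtain j where j: "j \<le> n" "(R i)\<inverse> = R j" using conv by blast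
      have "(S i)\<inverse> = (\<lambda>(x, y). (f x, f y)) ` ((R i)\<inverse>)" unfolding S[OF i] by auto
      then have "(S i)\<inverse> = S j" unfolding S[OF j(1)] j(2) .
      then show "\<exists>j\<le>n. (S i)\<inverse> = S j" using j(1) by blast
    qed
    show "\<forall>i\<le>n. \<forall>j\<le>n. \<forall>k\<le>n. \<exists>c. \<forall>(x, y)\<in>S k. card {w \<in> Y. (x, w) \<in> S i \<and> (w, y) \<in> S j} = c"
    proof (intro allI impI)
      fix i j k assume i: "i \<le> n" and j: "j \<le> n" and k: "k \<le> n"
      then obtain c where c: "\<And>x y. (x, y) \<in> R k \<Longrightarrow> card {w \<in> X. (x, w) \<in> R i \<and> (w, y) \<in> R j} = c"
        using cnt[rule_format, OF i j k] by blast
      have "card {w \<in> Y. (a, w) \<in> S i \<and> (w, b) \<in> S j} = c" if ab: "(a, b) \<in> S k" for a b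
      proof -
        obtain x y where xy: "x \<in> X" "y \<in> X" "a = f x" "b = f y" using sub[OF k] img ab by blast
        have "(x, y) \<in> R k" using rel[OF k xy(1,2)] ab xy(3,4) by simp
        have "{w \<in> Y. (a, w) \<in> S i \<and> (w, b) \<in> S j} = f ` {w \<in> X. (x, w) \<in> R i \<and> (w, y) \<in> R j}"
          unfolding xy(3,4) img using rel[OF i xy(1)] rel[OF j _ xy(2)] by auto
        moreover have "inj_on f {w \<in> X. (x, w) \<in> R i \<and> (w, y) \<in> R j}"
          by (rule inj_on_subset[OF inj]) blast
        ultimately show ?thesis using c[OF \<open>(x, y) \<in> R k\<close>] by (simp add: card_image)
      qed
      then show "\<exists>c. \<forall>(x, y)\<in>S k. card {w \<in> Y. (x, w) \<in> S i \<and> (w, y) \<in> S j} = c" by blast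
    qed
  qed
qed

context
  fixes n :: nat and X :: "'a set" and R :: "nat \<Rightarrow> ('a \<times> 'a) set"
    and Y :: "'b set" and S :: "nat \<Rightarrow> ('b \<times> 'b) set" and f :: "'a \<Rightarrow> 'b"
  assumes f: "bij_betw f X Y"
    and rel: "\<And>i x y. i \<le> n \<Longrightarrow> x \<in> X \<Longrightarrow> y \<in> X \<Longrightarrow> (f x, f y) \<in> S i \<longleftrightarrow> (x, y) \<in> R i"
    and sub: "\<And>i. i \<le> n \<Longrightarrow> S i \<subseteq> Y \<times> Y"
begin

lemma symmetric_scheme_transfer:
  assumes "symmetric_scheme n X R"
  shows "symmetric_scheme n Y S"
proof -
  have A: "association_scheme n X R" and sy: "\<And>i. i \<le> n \<Longrightarrow> sym (R i)"
    using assms by (auto simp: symmetric_scheme_def)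
  have "sym (S i)" if i: "i \<le> n" for i
  proof (rule symI)
    fix a b assume ab: "(a, b) \<in> S i"
    then obtain x y where xy: "x \<in> X" "y \<in> X" "a = f x" "b = f y"
      using sub[OF i] f by (auto simp: bij_betw_def)
    then show "(b, a) \<in> S i" using rel[OF i] ab sy[OF i] by (simp add: sym_def)
  qed
  then show ?thesis using association_scheme_transfer[OF A f rel sub] by (simp add: symmetric_scheme_def)
qed

lemma imprimitive_scheme_transfer:
  assumes "imprimitive_scheme n X R"
  shows "imprimitive_scheme n Y S"
proof -
  have A: "association_scheme n X R" using assms by (simp add: imprimitive_scheme_def)
  obtain I where I: "I \<subseteq> {..n}" "equiv X (\<Union>i\<in>I. R i)" "(\<Union>i\<in>I. R i) \<noteq> R 0" "(\<Union>i\<in>I. R i) \<noteq> X \<times> X"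
    using assms unfolding imprimitive_scheme_def by blast
  define E where "E = (\<Union>i\<in>I. R i)"
  define E' where "E' = (\<Union>i\<in>I. S i)"
  have img: "Y = f ` X" using f by (simp add: bij_betw_def)
  have E: "(f x, f y) \<in> E' \<longleftrightarrow> (x, y) \<in> E" if "x \<in> X" "y \<in> X" for x y
    unfolding E_def E'_def using rel[OF _ that] I(1) by blast
  have E'sub: "E' \<subseteq> Y \<times> Y" unfolding E'_def using sub I(1) by blast
  have Esub: "E \<subseteq> X \<times> X" and refl: "\<And>x. x \<in> X \<Longrightarrow> (x, x) \<in> E"
    and sy: "\<And>x y. (x, y) \<in> E \<Longrightarrow> (y, x) \<in> E" and tr: "\<And>x y z. (x, y) \<in> E \<Longrightarrow> (y, z) \<in> E \<Longrightarrow> (x, z) \<in> E"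
    using I(2) unfolding E_def[symmetric] by (auto simp: equiv_def refl_on_def dest: symD transD)
  have "equiv Y E'"
  proof (rule equivI)
    show "E' \<subseteq> Y \<times> Y" by (rule E'sub)
    show "refl_on Y E'" using E refl img by (auto simp: refl_on_def)
    show "sym E'"
    proof (rule symI)
      fix a b assume ab: "(a, b) \<in> E'"
      then obtain x y where xy: "x \<in> X" "y \<in> X" "a = f x" "b = f y" using E'sub img by blast
      then show "(b, a) \<in> E'" using E sy ab by simp
    qed
    show "trans E'"
    proof (rule transI)
      fix a b c assume ab: "(a, b) \<in> E'" and bc: "(b, c) \<in> E'"
      then obtain x y z where xyz: "x \<in> X" "y \<in> X" "z \<in> X" "a = f x" "b = f y" "c = f z"
        using E'sub img by blast
      then have "(x, y) \<in> E" "(y, z) \<in> E" using E ab bc by simp_all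
      then show "(a, c) \<in> E'" using tr E[OF xyz(1,3)] xyz by blast
    qed
  qed
  moreover have "E' \<noteq> S 0"
  proof
    assume e: "E' = S 0"
    have "R 0 \<subseteq> X \<times> X" using A by (auto simp: association_scheme_def)
    moreover have "(x, y) \<in> E \<longleftrightarrow> (x, y) \<in> R 0" if "x \<in> X" "y \<in> X" for x y
      using E[OF that] rel[OF le0 that] e by simp
    ultimately have "E = R 0" using Esub by auto
    then show False using I(3) by (simp add: E_def)
  qed
  moreover have "E' \<noteq> Y \<times> Y"
  proof
    assume e: "E' = Y \<times> Y"
    have "(x, y) \<in> E" if "x \<in> X" "y \<in> X" for x y using E[OF that] that e img by blast
    then have "E = X \<times> X" using Esub by blast
    then show False using I(4) by (simp add: E_def)
  qed
  moreover have "association_scheme n Y S" by (rule association_scheme_transfer[OF A f rel sub])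
  ultimately show ?thesis unfolding imprimitive_scheme_def E'_def using I(1) by blast
qed

end

section \<open>Comparison of the two geometries\<close>

lemma line_rel_subset: "line_rel Q l i \<subseteq> disjoint_lines Q l \<times> disjoint_lines Q l"
  by (auto simp: line_rel_def)

lemma point_rel_subset: "point_rel q \<theta> P i \<subseteq> noncollinear_points q P \<times> noncollinear_points q P"
  by (auto simp: point_rel_def)

lemma ex_quadratic_extension:
  fixes \<theta> :: "'g::{field,finite}"
  assumes "primepow q" "odd q" "CARD('f::{field,finite}) = q" "CARD('g) = q\<^sup>2" "\<theta> \<noteq> 0" "\<theta> ^ q = - \<theta>"
  obtains \<sigma> :: "'f::{field,finite} \<Rightarrow> 'g" and d where "quadratic_extension q \<sigma> \<theta> d"
proof -
  obtain p k where pk: "prime p" "q = p ^ k" using assms(1) unfolding primepow_def by blast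
  have cf: "CARD('f) = p ^ k" and cg: "CARD('g) = p ^ (k * 2)"
    using assms(3,4) pk(2) by (simp_all add: power_mult)
  obtain \<sigma> :: "'f \<Rightarrow> 'g" where \<sigma>: "\<And>x y. \<sigma> (x + y) = \<sigma> x + \<sigma> y" "\<And>x y. \<sigma> (x * y) = \<sigma> x * \<sigma> y" "\<sigma> 1 = 1"
    using finite_field_embedding[OF pk(1) cf cg] by blast
  have char: "CHAR('g) = p" by (rule CHAR_finite_field[OF pk(1) cg])
  have add: "(x + y) ^ q = x ^ q + y ^ q" for x y :: 'g
    by (rule freshmans_dream') (simp_all add: char pk)
  interpret E: subfield_embedding q \<sigma>
    by unfold_locales (fact assms(2-4) add \<sigma>)+
  have "(\<theta>\<^sup>2) ^ q = \<theta>\<^sup>2" using assms(6) by (simp flip: power_mult) (simp add: mult.commute power_mult)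
  then obtain d where "\<theta>\<^sup>2 = \<sigma> d" unfolding E.fixed_field by blast
  then have "quadratic_extension q \<sigma> \<theta> d" by unfold_locales (use assms in auto)
  then show thesis by (rule that)
qed

theorem theorem5p2:
  fixes q :: nat
    and Q :: "'f::{field,finite} ^ 6 \<Rightarrow> 'f"
    and l :: "('f ^ 6) set"
  assumes "primepow q" and "odd q"
    and "CARD('f) = q" and "CARD('g::{field,finite}) = q\<^sup>2"
    and "elliptic_form Q" and "l \<in> quadric_lines Q"
  shows "symmetric_scheme 5 (disjoint_lines Q l) (line_rel Q l) \<and>
    imprimitive_scheme 5 (disjoint_lines Q l) (line_rel Q l) \<and>
    (\<forall>\<theta>::'g. \<forall>P\<in>hermitian_points q. \<theta> \<noteq> 0 \<and> \<theta> ^ q = - \<theta> \<longrightarrow>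
       scheme_isomorphic 5 (disjoint_lines Q l) (line_rel Q l)
         (noncollinear_points q P) (point_rel q \<theta> P))"
proof -
  have two: "(2::'f) \<noteq> 0" by (rule two_neq_zero_if_odd_card) (use assms in simp)
  interpret elliptic Q by unfold_locales (fact assms(5) two)+
  \<comment> \<open>Stated for every nonsquare: the isomorphism with the points needs the particular
    \<open>d\<close> that comes from \<theta>, which is not yet available here.\<close>
  have line_side: "\<exists>f. bij_betw f UNIV (disjoint_lines Q l) \<and>
      (\<forall>i\<le>5. \<forall>x y. (f x, f y) \<in> line_rel Q l i \<longleftrightarrow> (x, y) \<in> heis_rel d i)"
    if d: "\<And>x. x\<^sup>2 \<noteq> d" for d :: 'f
  proof -
    obtain a1 a2 b1 b2 w1 w2 where fr: "elliptic_frame Q d a1 a2 b1 b2 w1 w2" and l: "l = vec.span {a1, a2}"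
      using ex_frame[OF assms(6) d] by blast
    interpret F: elliptic_frame Q d a1 a2 b1 b2 w1 w2 by (rule fr)
    have "F.L = l" by (simp add: F.L_def l)
    then show ?thesis using F.M_bij F.line_rel_M_iff by (intro exI[of _ F.M]) simp
  qed
  \<comment> \<open>For the symmetric and imprimitive scheme on the lines alone, any nonsquare
    serves.\<close>
  obtain d0 :: 'f where d0: "\<And>x. x\<^sup>2 \<noteq> d0" using ex_nonsquare[OF two] by blast
  obtain f0 where f0: "bij_betw f0 UNIV (disjoint_lines Q l)"
      "\<And>i x y. i \<le> 5 \<Longrightarrow> (f0 x, f0 y) \<in> line_rel Q l i \<longleftrightarrow> (x, y) \<in> heis_rel d0 i"
    using line_side[OF d0] by blast
  have sym: "symmetric_scheme 5 (disjoint_lines Q l) (line_rel Q l)"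
    by (rule symmetric_scheme_transfer[OF f0 line_rel_subset heis_scheme(1)[OF d0 two]])
  have imp: "imprimitive_scheme 5 (disjoint_lines Q l) (line_rel Q l)"
    by (rule imprimitive_scheme_transfer[OF f0 line_rel_subset heis_scheme(2)[OF d0 two]])
  have iso: "scheme_isomorphic 5 (disjoint_lines Q l) (line_rel Q l) (noncollinear_points q P) (point_rel q \<theta> P)"
    if P: "P \<in> hermitian_points q" and \<theta>: "\<theta> \<noteq> 0" "\<theta> ^ q = - \<theta>" for \<theta> :: 'g and P
  proof -
    obtain \<sigma> :: "'f \<Rightarrow> 'g" and d where ext: "quadratic_extension q \<sigma> \<theta> d"
      using ex_quadratic_extension[OF assms(1-4) \<theta>] by blast
    interpret K: quadratic_extension q \<sigma> \<theta> d by (rule ext)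
    have P1: "vec.subspace P" "vec.dim P = 1" "\<And>x. x \<in> P \<Longrightarrow> herm q x x = 0"
      using P by (auto simp: hermitian_points_def)
    have "\<not> P \<subseteq> {0}" using P1(2) vec.dim_eq_0[of P] by simp
    then obtain p where p: "p \<in> P" "p \<noteq> 0" by blast
    obtain p' e1 e2 where fr: "hermitian_frame q \<sigma> \<theta> d p p' e1 e2"
      using K.ex_frame[OF p(2) P1(3)[OF p(1)]] by blast
    interpret H: hermitian_frame q \<sigma> \<theta> d p p' e1 e2 by (rule fr)
    have HP: "H.P0 = P" unfolding H.P0_def using subspace_dim_1_eq_span[OF P1(1,2) p] by (rule HOL.sym)
    obtain f where f: "bij_betw f UNIV (disjoint_lines Q l)"
      "\<And>i x y. i \<le> 5 \<Longrightarrow> (f x, f y) \<in> line_rel Q l i \<longleftrightarrow> (x, y) \<in> heis_rel d i"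
      using line_side[OF K.nonsquare_d] by blast
    have g: "bij_betw H.PT UNIV (noncollinear_points q P)"
      "\<And>i x y. i \<le> 5 \<Longrightarrow> (H.PT x, H.PT y) \<in> point_rel q \<theta> P i \<longleftrightarrow> (x, y) \<in> heis_rel d i"
      using H.PT_bij H.point_rel_PT_iff unfolding HP by simp_all
    have "symmetric_scheme 5 (noncollinear_points q P) (point_rel q \<theta> P)"
      by (rule symmetric_scheme_transfer[OF g point_rel_subset heis_scheme(1)[OF K.nonsquare_d two]])
    moreover have "bij_betw (H.PT \<circ> inv_into UNIV f) (disjoint_lines Q l) (noncollinear_points q P)"
      by (rule bij_betw_trans[OF bij_betw_inv_into[OF f(1)] g(1)])
    moreover have "(x, y) \<in> line_rel Q l i \<longleftrightarrow> ((H.PT \<circ> inv_into UNIV f) x, (H.PT \<circ> inv_into UNIV f) y) \<in> point_rel q \<theta> P i"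
      if i: "i \<le> 5" and x: "x \<in> disjoint_lines Q l" and y: "y \<in> disjoint_lines Q l" for i x y
    proof -
      have "f (inv_into UNIV f x) = x" "f (inv_into UNIV f y) = y"
        using x y f(1) by (auto simp: bij_betw_def f_inv_into_f)
      then show ?thesis using f(2)[OF i, of "inv_into UNIV f x" "inv_into UNIV f y"] g(2)[OF i] by simp
    qed
    ultimately show ?thesis using sym unfolding scheme_isomorphic_def symmetric_scheme_def by blast
  qed
  show ?thesis using sym imp iso by blast
qed

end
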